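(* Let $L,M>0$. There exists $\bar\kappa>0$ depending only on $L,M$ such that for every $\kappa_0\in(0,\bar\kappa]$ there exist a tuning constant $c_{\mathsf{srs},1}>0$ (in the definition of $\hat{\boldsymbol\theta}_{\mathsf{srs}}$) and constants $C,C'>0$, all depending only on $L,M,\kappa_0$, for which the following holds. Let $n\ge2$, $N=2n$, $p\ge2$, $1\le s\le p$, and assume: (i) the $\xi_i$ are $L$-subGaussian; (ii) the $X_{ij}$ are $M$-subGaussian; (iii) $s\log(ep/s)/N\le\kappa_0$. Then for any $0<v\le n^{1/3}$, $$\sup_{\boldsymbol\theta\in B_0(s)}\sup_{\sigma>0}\mathbf P_{\boldsymbol\theta,\sigma}\Big(\big[\hat Q_D^{HD}-\|\boldsymbol\theta\|_2^2\big]^2>Cv\Big(\sigma^4\frac p{n^2}+\sigma^2\frac{\|\boldsymbol\theta\|_2^2}n\Big)\Big)\le C'\Big[e^{-v}+e^{-\frac{n\wedge s\log(ep/s)}{C'}}\Big]$$ and $$\sup_{\boldsymbol\theta\in B_0(s)}\sup_{\sigma>0}\mathbf P_{\boldsymbol\theta,\sigma}\Big(\big|\hat\Lambda_D^{HD}-\|\boldsymbol\theta\|_2\big|>C\sigma\frac{(pv)^{1/4}}{\sqrt n}\Big)\le C'\Big[e^{-v}+e^{-\frac{n\wedge s\log(ep/s)}{C'}}\Big].$$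
   Context: Model: one observes $(\mathbb X,\mathbf Y)$ with $\mathbf Y=\mathbb X\boldsymbol\theta+\sigma\boldsymbol\xi$, where $\mathbb X=(X_{ij})$ is a random $N\times p$ matrix, $\boldsymbol\theta\in\mathbb R^p$, $\boldsymbol\xi=(\xi_1,\dots,\xi_N)\in\mathbb R^N$ is random noise and $\sigma>0$. The $N(p+1)$ random variables $X_{ij},\xi_i$ are jointly independent, with zero mean and variance $1$. $\mathbf P_{\boldsymbol\theta,\sigma}$ is the law of $(\mathbb X,\mathbf Y)$. $B_0(s)$ is the set of vectors in $\mathbb R^p$ with at most $s$ nonzero components. A random variable $Z$ is $L$-subGaussian if $\mathbf E\exp(tZ)\le\exp(L^2t^2/2)$ for all $t\in\mathbb R$. $a\wedge b=\min(a,b)$. The sample is split (by rows) into two disjoint subsamples $(\mathbb X_1,\mathbf Y_1),(\mathbb X_2,\mathbf Y_2)$, each of size $n$. The Square-Root Slope estimator is $$\hat{\boldsymbol\theta}_{\mathsf{srs}}\in\arg\min_{\mathbf t\in\mathbb R^p}\Big\{\tfrac1{\sqrt n}\|\mathbf Y_1-\mathbb X_1\mathbf t\|_2+\|\mathbf t\|_*\Big\},\quad\|\mathbf t\|_*=\sum_{i=1}^p\lambda_i|t|_{(p-i+1)},\quad\lambda_j=c_{\mathsf{srs},1}\sqrt{\frac{\log(2p/j)}n},$$ where $|t|_{(1)}\le\dots\le|t|_{(p)}$ are the order statistics of $|t_1|,\dots,|t_p|$. For an estimator $\hat{\boldsymbol\theta}=(\hat\theta_1,\dots,\hat\theta_p)$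 based on $(\mathbb X_1,\mathbf Y_1)$ define $$a_j(\hat{\boldsymbol\theta})=\hat\theta_j^2+\frac{2\hat\theta_j}{n}\mathbf X_{2,j}^T(\mathbf Y_2-\mathbb X_2\hat{\boldsymbol\theta})+\frac1{n(n-1)}\sum_{k\ne l}X_{2,kj}X_{2,lj}\big(Y_{2,k}-\mathbf X_2^k\hat{\boldsymbol\theta}\big)\big(Y_{2,l}-\mathbf X_2^l\hat{\boldsymbol\theta}\big),$$ where $\mathbf X_{2,j}$, $\mathbf X_2^k$ and $X_{2,kj}$ are the $j$th column, the $k$th row and the $(k,j)$ entry of $\mathbb X_2$, and $Y_{2,k}$ is the $k$th entry of $\mathbf Y_2$. Set $\hat Q_D^{HD}=\sum_{j=1}^pa_j(\hat{\boldsymbol\theta}_{\mathsf{srs}})$ and $\hat\Lambda_D^{HD}=|\hat Q_D^{HD}|^{1/2}$. *)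

theory Defs
  imports "HOL-Probability.Probability"
begin

text \<open>
  The dimensions are quantified inside the theorem, so vectors and matrices are functions on
  \<open>nat\<close> and \<open>nat \<times> nat\<close> (row, column), indexed from 0 and extensional outside their index
  sets. A (sub)sample is indexed by a finite set \<open>I\<close> of rows; its size is \<open>card I\<close>.
\<close>

type_synonym vec = "nat \<Rightarrow> real"
type_synonym mat = "nat \<times> nat \<Rightarrow> real"

definition vec_space :: "nat set \<Rightarrow> vec measure" where
  "vec_space J = (\<Pi>\<^sub>M j\<in>J. borel)"

definition data_space :: "nat set \<Rightarrow> nat \<Rightarrow> (mat \<times> vec) measure" where
  "data_space I p = (\<Pi>\<^sub>M ij\<in>I \<times> {..<p}. borel) \<Otimes>\<^sub>M vec_space I"

definition norm2 :: "nat set \<Rightarrow> vec \<Rightarrow> real" where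
  "norm2 J x = sqrt (\<Sum>j\<in>J. (x j)\<^sup>2)"

definition B0 :: "nat \<Rightarrow> nat \<Rightarrow> vec set" where
  "B0 p s = {\<theta> \<in> space (vec_space {..<p}). card {j \<in> {..<p}. \<theta> j \<noteq> 0} \<le> s}"

text \<open>The integrability clause excludes the default value 0 of the Bochner integral.\<close>

definition subgaussian :: "'a measure \<Rightarrow> real \<Rightarrow> ('a \<Rightarrow> real) \<Rightarrow> bool" where
  "subgaussian \<Omega> K Z \<longleftrightarrow>
     (\<forall>t. integrable \<Omega> (\<lambda>w. exp (t * Z w)) \<and>
          (\<integral>w. exp (t * Z w) \<partial>\<Omega>) \<le> exp (K\<^sup>2 * t\<^sup>2 / 2))"

text \<open>
  The variables \<open>X\<^bsub>ij\<^esub>\<close>, \<open>\<xi>\<^bsub>i\<^esub>\<close> are the coordinates on the space of pairs \<open>(X, \<xi>)\<close>, and the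
  measure \<open>Q\<close> is their joint law. Taking the canonical sample space loses no generality, as only
  laws matter, and lets the constants of the theorem be uniform over all such laws.
\<close>

definition entry :: "nat \<Rightarrow> nat \<Rightarrow> mat \<times> vec \<Rightarrow> real" where
  "entry i j w = fst w (i, j)"

definition noise :: "nat \<Rightarrow> mat \<times> vec \<Rightarrow> real" where
  "noise i w = snd w i"

definition standardized :: "'a measure \<Rightarrow> ('a \<Rightarrow> real) \<Rightarrow> bool" where
  "standardized \<Omega> Z \<longleftrightarrow> integrable \<Omega> Z \<and> integrable \<Omega> (\<lambda>w. (Z w)\<^sup>2) \<and>
     (\<integral>w. Z w \<partial>\<Omega>) = 0 \<and> (\<integral>w. (Z w - (\<integral>w'. Z w' \<partial>\<Omega>))\<^sup>2 \<partial>\<Omega>) = 1"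

definition design_noise_law :: "nat \<Rightarrow> nat \<Rightarrow> (mat \<times> vec) measure \<Rightarrow> bool" where
  "design_noise_law N p Q \<longleftrightarrow>
     prob_space Q \<and> sets Q = sets (data_space {..<N} p) \<and>
     prob_space.indep_vars Q (\<lambda>_. borel)
       (\<lambda>k. case k of Inl (i, j) \<Rightarrow> entry i j | Inr i \<Rightarrow> noise i)
       (({..<N} \<times> {..<p}) <+> {..<N}) \<and>
     (\<forall>i<N. \<forall>j<p. standardized Q (entry i j)) \<and>
     (\<forall>i<N. standardized Q (noise i))"

text \<open>The law \<open>P\<^bsub>\<theta>,\<sigma>\<^esub>\<close> of \<open>(X, Y)\<close> with \<open>Y = X \<theta> + \<sigma> \<xi>\<close>.\<close>

definition obs_law ::
    "nat \<Rightarrow> nat \<Rightarrow> (mat \<times> vec) measure \<Rightarrow> vec \<Rightarrow> real \<Rightarrow> (mat \<times> vec) measure" where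
  "obs_law N p Q \<theta> \<sigma> = distr Q (data_space {..<N} p)
     (\<lambda>(X, \<xi>). (X, \<lambda>i\<in>{..<N}. (\<Sum>j<p. X (i, j) * \<theta> j) + \<sigma> * \<xi> i))"

definition subsample :: "nat set \<Rightarrow> nat \<Rightarrow> mat \<times> vec \<Rightarrow> mat \<times> vec" where
  "subsample I p = (\<lambda>(X, Y). (restrict X (I \<times> {..<p}), restrict Y I))"

definition resid :: "nat \<Rightarrow> mat \<times> vec \<Rightarrow> vec \<Rightarrow> nat \<Rightarrow> real" where
  "resid p d t k = snd d k - (\<Sum>j<p. fst d (k, j) * t j)"

text \<open>\<open>order_stat p t k\<close> is \<open>|t|\<^bsub>(k)\<^esub>\<close>, for \<open>1 \<le> k \<le> p\<close>, in nondecreasing order.\<close>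

definition order_stat :: "nat \<Rightarrow> vec \<Rightarrow> nat \<Rightarrow> real" where
  "order_stat p t k = sort (map (\<lambda>i. \<bar>t i\<bar>) [0..<p]) ! (k - 1)"

definition slope_weight :: "real \<Rightarrow> nat \<Rightarrow> nat \<Rightarrow> nat \<Rightarrow> real" where
  "slope_weight c n p j = c * sqrt (ln (2 * real p / real j) / real n)"

definition slope_norm :: "real \<Rightarrow> nat \<Rightarrow> nat \<Rightarrow> vec \<Rightarrow> real" where
  "slope_norm c n p t = (\<Sum>i=1..p. slope_weight c n p i * order_stat p t (p - i + 1))"

definition srs_objective :: "real \<Rightarrow> nat set \<Rightarrow> nat \<Rightarrow> mat \<times> vec \<Rightarrow> vec \<Rightarrow> real" where
  "srs_objective c I p d t =
     norm2 I (resid p d t) / sqrt (real (card I)) + slope_norm c (card I) p t"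

text \<open>
  A Square-Root Slope estimator is any measurable selection of a minimizer, as a function of the
  subsample with row set \<open>I\<close>.
\<close>

definition srs_estimator :: "real \<Rightarrow> nat set \<Rightarrow> nat \<Rightarrow> (mat \<times> vec \<Rightarrow> vec) \<Rightarrow> bool" where
  "srs_estimator c I p est \<longleftrightarrow>
     est \<in> data_space I p \<rightarrow>\<^sub>M vec_space {..<p} \<and>
     (\<forall>d \<in> space (data_space I p).
        is_arg_min (srs_objective c I p d) (\<lambda>t. t \<in> space (vec_space {..<p})) (est d))"

definition debiased_sq :: "nat set \<Rightarrow> nat \<Rightarrow> mat \<times> vec \<Rightarrow> vec \<Rightarrow> nat \<Rightarrow> real" where
  "debiased_sq I p d t j =
     (let n = real (card I); X = fst d; r = resid p d t in
      (t j)\<^sup>2 + 2 * t j / n * (\<Sum>k\<in>I. X (k, j) * r k)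
      + 1 / (n * (n - 1)) * (\<Sum>k\<in>I. \<Sum>l\<in>I - {k}. X (k, j) * X (l, j) * r k * r l))"

text \<open>\<open>I1\<close>: rows used for the pilot estimator; \<open>I2\<close>: rows used for debiasing.\<close>

definition Q_hat ::
    "nat set \<Rightarrow> nat set \<Rightarrow> nat \<Rightarrow> (mat \<times> vec \<Rightarrow> vec) \<Rightarrow> mat \<times> vec \<Rightarrow> real" where
  "Q_hat I1 I2 p est d =
     (\<Sum>j<p. debiased_sq I2 p (subsample I2 p d) (est (subsample I1 p d)) j)"

definition Lambda_hat ::
    "nat set \<Rightarrow> nat set \<Rightarrow> nat \<Rightarrow> (mat \<times> vec \<Rightarrow> vec) \<Rightarrow> mat \<times> vec \<Rightarrow> real" where
  "Lambda_hat I1 I2 p est d = sqrt \<bar>Q_hat I1 I2 p est d\<bar>"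

definition sample_split :: "nat \<Rightarrow> nat set \<Rightarrow> nat set \<Rightarrow> bool" where
  "sample_split n I1 I2 \<longleftrightarrow>
     I1 \<union> I2 = {..<2 * n} \<and> I1 \<inter> I2 = {} \<and> card I1 = n \<and> card I2 = n"

definition sparsity_rate :: "nat \<Rightarrow> nat \<Rightarrow> real" where
  "sparsity_rate p s = real s * ln (exp 1 * real p / real s)"

text \<open>
  The maps entering the theorem are measurable, so neither \<open>distr\<close> nor \<open>measure\<close> falls back to a
  default value there.
\<close>

lemma measurable_observation:
  "(\<lambda>(X, \<xi>). (X, \<lambda>i\<in>{..<N}. (\<Sum>j<p. X (i, j) * \<theta> j) + \<sigma> * \<xi> i))
     \<in> data_space {..<N} p \<rightarrow>\<^sub>M data_space {..<N} p"
proof -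
  have "(\<lambda>w. fst w (i, j)) \<in> borel_measurable (data_space {..<N} p)" if "i < N" "j < p" for i j
    unfolding data_space_def using that
    by (intro measurable_compose[OF measurable_fst measurable_component_singleton]) auto
  moreover have "(\<lambda>w. snd w i) \<in> borel_measurable (data_space {..<N} p)" if "i < N" for i
    unfolding data_space_def vec_space_def using that
    by (intro measurable_compose[OF measurable_snd measurable_component_singleton]) auto
  ultimately have "(\<lambda>w. \<lambda>i\<in>{..<N}. (\<Sum>j<p. fst w (i, j) * \<theta> j) + \<sigma> * snd w i)
      \<in> data_space {..<N} p \<rightarrow>\<^sub>M vec_space {..<N}"
    unfolding vec_space_def
    by (intro measurable_restrict borel_measurable_add borel_measurable_sum
        borel_measurable_times) auto
  moreover have "fst \<in> data_space {..<N} p \<rightarrow>\<^sub>M (\<Pi>\<^sub>M ij\<in>{..<N} \<times> {..<p}. borel)"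
    unfolding data_space_def by simp
  ultimately show ?thesis
    unfolding data_space_def[of "{..<N}"] case_prod_unfold by (intro measurable_Pair) auto
qed

lemma measurable_Q_hat:
  assumes "sample_split n I1 I2" and est: "srs_estimator c I1 p est"
  shows "Q_hat I1 I2 p est \<in> borel_measurable (data_space {..<2 * n} p)"
proof -
  let ?D = "data_space {..<2 * n} p"
  have sub: "I1 \<subseteq> {..<2 * n}" "I2 \<subseteq> {..<2 * n}"
    using assms(1) by (auto simp: sample_split_def)
  have X: "(\<lambda>w. fst w (i, j)) \<in> borel_measurable ?D" if "i < 2 * n" "j < p" for i j
    unfolding data_space_def using that
    by (intro measurable_compose[OF measurable_fst measurable_component_singleton]) auto
  have Y: "(\<lambda>w. snd w i) \<in> borel_measurable ?D" if "i < 2 * n" for i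
    unfolding data_space_def vec_space_def using that
    by (intro measurable_compose[OF measurable_snd measurable_component_singleton]) auto
  have "(\<lambda>d. restrict (fst d) (I1 \<times> {..<p})) \<in> ?D \<rightarrow>\<^sub>M (\<Pi>\<^sub>M ij\<in>I1 \<times> {..<p}. borel)"
    by (rule measurable_restrict) (use sub in \<open>auto intro: X\<close>)
  moreover have "(\<lambda>d. restrict (snd d) I1) \<in> ?D \<rightarrow>\<^sub>M vec_space I1"
    unfolding vec_space_def by (rule measurable_restrict) (use sub in \<open>auto intro: Y\<close>)
  ultimately have "subsample I1 p \<in> ?D \<rightarrow>\<^sub>M data_space I1 p"
    unfolding subsample_def case_prod_unfold data_space_def[of I1] by (intro measurable_Pair) auto
  then have "(\<lambda>d. est (subsample I1 p d)) \<in> ?D \<rightarrow>\<^sub>M vec_space {..<p}"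
    by (rule measurable_compose) (use est in \<open>simp add: srs_estimator_def\<close>)
  then have t: "(\<lambda>d. est (subsample I1 p d) j) \<in> borel_measurable ?D" if "j < p" for j
    unfolding vec_space_def
    by (rule measurable_compose, intro measurable_component_singleton) (use that in simp)
  have r: "(\<lambda>d. resid p (subsample I2 p d) (est (subsample I1 p d)) k) \<in> borel_measurable ?D"
    if "k \<in> I2" for k
    unfolding resid_def subsample_def[of I2] case_prod_unfold using that sub
    by (simp, intro borel_measurable_diff borel_measurable_sum borel_measurable_times X Y t) auto
  have x: "(\<lambda>d. fst (subsample I2 p d) (k, j)) \<in> borel_measurable ?D" if "k \<in> I2" "j < p" for k j
    unfolding subsample_def case_prod_unfold using that sub by (auto intro!: X)
  show ?thesis
    unfolding Q_hat_def[abs_def] debiased_sq_def Let_def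
    by (intro borel_measurable_sum borel_measurable_add borel_measurable_times
        borel_measurable_power borel_measurable_divide borel_measurable_const r x t) auto
qed

end

theory Submission
  imports Defs
begin

text \<open>The vectors W_k are products of two subgaussian forms. Linear forms in them are only
  subexponential, and their inner products have in general no exponential moment, so a Chernoff
  bound is out of reach for the off-diagonal sum. Moments of order q still grow in the Gaussian way
  while q is at most n (for linear forms summed over n rows) and at most p (for the squared norm of
  one row); this is the origin of the cap min n p. Treating the noise as one more column of the
  design lets a single subgaussian constant K = max L M govern everything: all constants of the
  theorem are functions of K, and \<kappa>0 enters only through \<kappa>0 \<le> \<kappa>bar. Lattice
  points replace nets of sparse vectors because supports and values are then counted at once: a ball
  of squared radius of order m in the integer lattice has exp (O (m ln (e p / m))) points, and the
  sign vectors with m nonzero entries are points of such a ball.\<close>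

text \<open>
  Only a crude bound for the pilot is needed: its error is at most a constant multiple of \<open>\<sigma>\<close>, with
  probability \<open>1 - O(exp (- c n))\<close>. It comes from a restricted eigenvalue inequality
  \<open>\<parallel>X \<delta>\<parallel> / \<surd>n \<ge> \<parallel>\<delta>\<parallel> / 4 - b \<parallel>\<delta>\<parallel>\<^sub>*\<close> that holds for all \<open>\<delta>\<close> at once: round \<open>\<delta>\<close> to a
  multiple of an integer vector, use a union bound over short integer vectors for the rounded part and a
  layer-cake decomposition into sign vectors for the remainder. With the tuning constant equal to \<open>b\<close>, the
  optimality of the estimator and this inequality already give \<open>\<parallel>\<delta>\<parallel> \<le> 16 \<sigma> \<parallel>\<xi>\<parallel> / \<surd>n\<close>.

  Conditionally on the first subsample put \<open>\<Delta> = (\<theta> - \<theta>') / \<sigma>\<close>, with \<open>\<theta>'\<close> the pilot, and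
  \<open>W\<^sub>k = X\<^sub>k (\<langle>X\<^sub>k, \<Delta>\<rangle> + \<xi>\<^sub>k) - \<Delta>\<close>, which is centered. Then
  \<open>Q - \<parallel>\<theta>\<parallel>\<^sup>2 = (2 \<sigma> / n) \<Sum>\<^sub>k \<langle>\<theta>, W\<^sub>k\<rangle> + \<sigma>\<^sup>2 / (n (n - 1)) \<Sum>\<^sub>k\<^sub>\<noteq>\<^sub>l \<langle>W\<^sub>k, W\<^sub>l\<rangle>\<close>.
  The \<open>q\<close>-th moment \<open>F\<close> of the off-diagonal sum is bounded by decoupling with random subsets \<open>H\<close>: it is
  controlled by moments of \<open>\<parallel>\<Sum>\<^sub>k\<^sub>\<in>\<^sub>H W\<^sub>k\<parallel>\<^sup>2\<close>, which is a diagonal sum plus again an off-diagonal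
  sum. This gives a self-bounding inequality \<open>F \<le> a (b + a / 2 + F / (2 a))\<close>, and Markov's inequality for
  \<open>q\<close> of order \<open>min v (min n p)\<close> concludes; larger \<open>v\<close> are absorbed since
  \<open>s ln (e p / s) \<le> p\<close>.
\<close>

section \<open>Moments of decoupled quadratic forms\<close>

lemma power_le_fact_exp:
  fixes x :: real
  assumes "0 \<le> x"
  shows "x ^ n \<le> fact n * exp x"
proof -
  have "(\<Sum>k\<in>{n}. x ^ k /\<^sub>R fact k) \<le> (\<Sum>k. x ^ k /\<^sub>R fact k)"
    using assms by (intro sum_le_suminf summable_exp_generic) auto
  then have "x ^ n / fact n \<le> exp x"
    by (simp add: exp_def scaleR_conv_of_real field_simps)
  then show ?thesis by (simp add: field_simps)
qed

lemma even_power_le_fact_exp: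
  fixes x :: real
  shows "x ^ (2 * n) \<le> fact (2 * n) * (exp x + exp (- x))"
proof -
  have "x ^ (2 * n) = \<bar>x\<bar> ^ (2 * n)" by (simp add: power_mult)
  also have "\<dots> \<le> fact (2 * n) * exp \<bar>x\<bar>" by (rule power_le_fact_exp) simp
  also have "\<dots> \<le> fact (2 * n) * (exp x + exp (- x))"
    by (intro mult_left_mono) (auto simp: abs_if)
  finally show ?thesis .
qed

lemma even_power_mean_le:
  fixes f :: "'a \<Rightarrow> real"
  assumes "finite A" "A \<noteq> {}"
  shows "((\<Sum>x\<in>A. f x) / real (card A)) ^ (2 * n) \<le> (\<Sum>x\<in>A. f x ^ (2 * n)) / real (card A)"
proof -
  have c: "convex_on UNIV (\<lambda>x::real. x ^ (2 * n))"
    by (rule convex_power_even) simp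
  have "(\<Sum>x\<in>A. (1 / real (card A)) *\<^sub>R f x) ^ (2 * n) \<le> (\<Sum>x\<in>A. (1 / real (card A)) * f x ^ (2 * n))"
    using assms by (intro convex_on_sum[OF _ _ c]) auto
  then show ?thesis
    by (simp add: sum_divide_distrib)
qed

text \<open>A uniformly random subset H contains k and misses l with probability 1/4 whenever k and
  l differ. The average over H therefore recovers a quarter of the off-diagonal sum from sums that
  pair an index in H with one outside, that is, from bilinear forms in two independent groups of
  vectors.\<close>

lemma sum_Pow_decoupling:
  fixes g :: "'a \<Rightarrow> 'a \<Rightarrow> real"
  assumes fin: "finite J"
  shows "4 * (\<Sum>H\<in>Pow J. \<Sum>k\<in>H. \<Sum>l\<in>J - H. g k l)
    = 2 ^ card J * (\<Sum>k\<in>J. \<Sum>l\<in>J - {k}. g k l)"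
proof -
  have cnt: "4 * real (card {H \<in> Pow J. k \<in> H \<and> l \<notin> H}) = (if k = l then 0 else 2 ^ card J)"
    if "k \<in> J" "l \<in> J" for k l
  proof (cases "k = l")
    case True
    then have "{H \<in> Pow J. k \<in> H \<and> l \<notin> H} = {}" by auto
    then show ?thesis using True by (metis card.empty mult_zero_right of_nat_0)
  next
    case False
    have eq: "{H \<in> Pow J. k \<in> H \<and> l \<notin> H} = insert k ` Pow (J - {k, l})"
    proof (intro set_eqI iffI)
      fix H assume H: "H \<in> {H \<in> Pow J. k \<in> H \<and> l \<notin> H}"
      then have "H = insert k (H - {k})" "H - {k} \<in> Pow (J - {k, l})" by auto
      then show "H \<in> insert k ` Pow (J - {k, l})" by (rule image_eqI)
    next
      fix H assume "H \<in> insert k ` Pow (J - {k, l})"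
      then show "H \<in> {H \<in> Pow J. k \<in> H \<and> l \<notin> H}" using that False by auto
    qed
    have inj: "inj_on (insert k) (Pow (J - {k, l}))"
      by (rule inj_onI) (auto simp: insert_eq_iff dest: insert_ident[THEN iffD1, rotated 2])
    have c2: "card J = card (J - {k, l}) + 2"
      using False that fin card_Diff_subset[of "{k, l}" J] card_mono[of J "{k, l}"] by auto
    show ?thesis
      unfolding eq card_image[OF inj] using fin c2 False by (simp add: card_Pow power_add)
  qed
  have "(\<Sum>H\<in>Pow J. \<Sum>k\<in>H. \<Sum>l\<in>J - H. g k l)
      = (\<Sum>H\<in>Pow J. \<Sum>k\<in>J. \<Sum>l\<in>J. if k \<in> H \<and> l \<notin> H then g k l else 0)"
  proof (rule sum.cong[OF refl])
    fix H assume "H \<in> Pow J"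
    then have H: "H \<subseteq> J" "finite H" using fin finite_subset by auto
    have "(\<Sum>k\<in>J. \<Sum>l\<in>J. if k \<in> H \<and> l \<notin> H then g k l else 0)
        = (\<Sum>k\<in>J. if k \<in> H then (\<Sum>l\<in>J. if l \<notin> H then g k l else 0) else 0)"
      by (intro sum.cong) auto
    also have "\<dots> = (\<Sum>k\<in>H. \<Sum>l\<in>J. if l \<notin> H then g k l else 0)"
      using fin H by (simp add: sum.If_cases Int_absorb1)
    also have "\<dots> = (\<Sum>k\<in>H. \<Sum>l\<in>J - H. g k l)"
      using fin by (intro sum.cong[OF refl] sum.mono_neutral_cong_right) auto
    finally show "(\<Sum>k\<in>H. \<Sum>l\<in>J - H. g k l)
      = (\<Sum>k\<in>J. \<Sum>l\<in>J. if k \<in> H \<and> l \<notin> H then g k l else 0)" by simp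
  qed
  also have "\<dots> = (\<Sum>k\<in>J. \<Sum>l\<in>J. \<Sum>H\<in>Pow J. if k \<in> H \<and> l \<notin> H then g k l else 0)"
    by (subst sum.swap, intro sum.cong refl sum.swap)
  also have "\<dots> = (\<Sum>k\<in>J. \<Sum>l\<in>J. real (card {H \<in> Pow J. k \<in> H \<and> l \<notin> H}) * g k l)"
    using fin by (intro sum.cong refl) (simp add: sum.If_cases Int_def)
  finally have "4 * (\<Sum>H\<in>Pow J. \<Sum>k\<in>H. \<Sum>l\<in>J - H. g k l)
      = (\<Sum>k\<in>J. \<Sum>l\<in>J. (4 * real (card {H \<in> Pow J. k \<in> H \<and> l \<notin> H})) * g k l)"
    by (simp add: sum_distrib_left mult_ac)
  also have "\<dots> = (\<Sum>k\<in>J. \<Sum>l\<in>J. (if k = l then 0 else 2 ^ card J) * g k l)"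
    by (intro sum.cong refl) (simp only: cnt)
  also have "\<dots> = (\<Sum>k\<in>J. \<Sum>l\<in>J - {k}. 2 ^ card J * g k l)"
  proof (rule sum.cong[OF refl])
    fix k assume "k \<in> J"
    show "(\<Sum>l\<in>J. (if k = l then 0 else 2 ^ card J) * g k l) = (\<Sum>l\<in>J - {k}. 2 ^ card J * g k l)"
      using fin \<open>k \<in> J\<close> by (subst sum.remove[of _ k]) (auto intro!: sum.cong split: if_splits)
  qed
  finally show ?thesis by (simp add: sum_distrib_left)
qed

section \<open>Independent random vectors and moments of their linear forms\<close>

locale indep_vectors =
  fixes I :: "nat set" and J :: "nat set" and \<nu> :: "nat \<Rightarrow> vec measure"
  assumes finI: "finite I" and finJ: "finite J"
    and prob_nu: "\<And>k. prob_space (\<nu> k)"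
    and sets_nu: "\<And>k. sets (\<nu> k) = sets (vec_space J)"
begin

sublocale product_prob_space \<nu>
  by (rule product_prob_spaceI) (rule prob_nu)

lemma coord_measurable [measurable]:
  "j \<in> J \<Longrightarrow> (\<lambda>w. w j) \<in> borel_measurable (\<nu> k)"
  using measurable_component_singleton[of j J "\<lambda>_. borel"]
  by (simp add: measurable_cong_sets[OF sets_nu refl] vec_space_def)

lemma coord2_measurable [measurable]:
  "k \<in> K \<Longrightarrow> j \<in> J \<Longrightarrow> (\<lambda>x. x k j) \<in> borel_measurable (PiM K \<nu>)"
  by (rule measurable_compose[OF measurable_component_singleton]) simp_all

definition ip :: "vec \<Rightarrow> vec \<Rightarrow> real" where
  "ip a b = (\<Sum>j\<in>J. a j * b j)"

lemma ip_commute: "ip a b = ip b a" by (simp add: ip_def mult.commute)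

lemma ip_scale: "ip (\<lambda>j. t * a j) b = t * ip a b" "ip a (\<lambda>j. t * b j) = t * ip a b"
  by (simp_all add: ip_def sum_distrib_left mult_ac)

lemma ip_sum: "ip a (\<lambda>j. \<Sum>k\<in>H. f k j) = (\<Sum>k\<in>H. ip a (f k))"
   "ip (\<lambda>j. \<Sum>k\<in>H. f k j) a = (\<Sum>k\<in>H. ip (f k) a)"
  unfolding ip_def by (simp_all add: sum_distrib_left sum_distrib_right sum.swap[of _ H])

lemma ip_self_nonneg: "0 \<le> ip a a"
  unfolding ip_def by (intro sum_nonneg) simp

lemma ip_measurable [measurable]: "ip a \<in> borel_measurable (\<nu> k)"
  unfolding ip_def[abs_def] by measurable

lemma ip_self_measurable [measurable]: "(\<lambda>w. ip w w) \<in> borel_measurable (\<nu> k)"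
  unfolding ip_def[abs_def] by measurable

lemma ip_measurable2 [measurable]: "k \<in> K \<Longrightarrow> (\<lambda>x. ip a (x k)) \<in> borel_measurable (PiM K \<nu>)"
  unfolding ip_def[abs_def] by measurable

lemma ip_measurable3 [measurable]:
  "k \<in> K \<Longrightarrow> l \<in> K \<Longrightarrow> (\<lambda>x. ip (x k) (x l)) \<in> borel_measurable (PiM K \<nu>)"
  unfolding ip_def[abs_def] by measurable

lemma nn_integral_exp_sum_le:
  assumes K: "K \<subseteq> I" and H: "H \<subseteq> K" and c: "0 \<le> c"
    and le: "\<And>k. k \<in> I \<Longrightarrow> (\<integral>\<^sup>+ w. ennreal (exp (ip a w)) \<partial>\<nu> k) \<le> ennreal (exp c)"
  shows "(\<integral>\<^sup>+ y. ennreal (exp (\<Sum>l\<in>H. ip a (y l))) \<partial>PiM K \<nu>) \<le> ennreal (exp (real (card I) * c))"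
proof -
  have fin: "finite K" "finite H" using K H finI by (auto dest: finite_subset)
  have "(\<integral>\<^sup>+ y. ennreal (exp (\<Sum>l\<in>H. ip a (y l))) \<partial>PiM K \<nu>)
      = (\<integral>\<^sup>+ y. (\<Prod>l\<in>K. ennreal (if l \<in> H then exp (ip a (y l)) else 1)) \<partial>PiM K \<nu>)"
    using fin H
    by (simp add: prod_ennreal exp_sum prod.If_cases Int_absorb1)
  also have "\<dots> = (\<Prod>l\<in>K. \<integral>\<^sup>+ w. ennreal (if l \<in> H then exp (ip a w) else 1) \<partial>\<nu> l)"
    by (rule product_nn_integral_prod) (use fin in auto)
  also have "\<dots> \<le> (\<Prod>l\<in>K. ennreal (exp c))"
  proof (rule prod_mono_ennreal)
    fix l assume "l \<in> K"
    then show "(\<integral>\<^sup>+ w. ennreal (if l \<in> H then exp (ip a w) else 1) \<partial>\<nu> l) \<le> ennreal (exp c)"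
      using le[of l] K c prob_space.emeasure_space_1[OF prob_nu, of l]
      by (cases "l \<in> H") auto
  qed
  also have "\<dots> = ennreal (exp (real (card K) * c))"
    by (simp add: ennreal_power exp_of_nat_mult)
  also have "\<dots> \<le> ennreal (exp (real (card I) * c))"
    using card_mono[OF finI K] c by (intro ennreal_leI) (simp add: mult_right_mono)
  finally show ?thesis .
qed

end

lemma fact_le_power2: "(fact (2 * r) :: real) \<le> ((real (2 * r))\<^sup>2) ^ r"
proof -
  have "fact (2 * r) \<le> (of_nat ((2 * r) ^ (2 * r)) :: real)" by (rule fact_le_power)
  then show ?thesis by (simp add: power_mult)
qed

text \<open>\<open>mgf\<close> is a Bernstein condition: linear forms have a Gaussian moment
  generating function within radius \<beta>. \<open>sq_moment\<close> compares the squared norm, up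
  to order \<open>R\<close>, with an exponential variable of mean \<open>D\<close>, whose moments
  are \<open>D ^ r * fact r\<close>.\<close>

locale subexp_vectors = indep_vectors +
  fixes \<beta> K1 D :: real and R :: nat
  assumes beta: "0 < \<beta>" and K1: "0 \<le> K1" and D: "0 \<le> D"
    and mgf: "\<And>k a. k \<in> I \<Longrightarrow> ip a a \<le> \<beta>\<^sup>2 \<Longrightarrow>
        (\<integral>\<^sup>+ w. ennreal (exp (ip a w)) \<partial>\<nu> k) \<le> ennreal (exp (K1 * ip a a))"
    and sq_moment: "\<And>k r. k \<in> I \<Longrightarrow> r \<le> R \<Longrightarrow>
        (\<integral>\<^sup>+ w. ennreal (ip w w ^ r) \<partial>\<nu> k) \<le> ennreal (D ^ r * fact r)"
begin

text \<open>Both factors come from \<open>linear_moment\<close>: 1 / \<beta>^2 from dividing by the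
  powers of the parameter \<tau>, and the exponential from the generating function, because exp (K1
  \<beta>^2 q) is the r-th power of exp (2 K1 \<beta>^2) for q = 2 r.\<close>

definition \<gamma> :: real where "\<gamma> = exp (2 * K1 * \<beta>\<^sup>2) / \<beta>\<^sup>2"

lemma gamma_pos: "0 < \<gamma>" using beta by (simp add: \<gamma>_def)

lemma linear_moment:
  assumes K: "K \<subseteq> I" and H: "H \<subseteq> K" and r: "1 \<le> r" "2 * r \<le> card I"
  shows "(\<integral>\<^sup>+ y. ennreal ((\<Sum>l\<in>H. ip a (y l)) ^ (2 * r)) \<partial>PiM K \<nu>)
    \<le> ennreal (2 * (\<gamma> * real (2 * r) * real (card I) * ip a a) ^ r)"
proof (cases "ip a a = 0")
  case True
  then have "\<forall>j\<in>J. a j = 0"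
    unfolding ip_def using finJ by (subst (asm) sum_nonneg_eq_0_iff) auto
  then have "ip a b = 0" for b unfolding ip_def by (intro sum.neutral) auto
  then show ?thesis using r by (simp add: power_0_left)
next
  case False
  then have a: "0 < ip a a" using ip_self_nonneg[of a] by linarith
  define n q where "n = real (card I)" and "q = real (2 * r)"
  have nq: "0 < q" "q \<le> n" using r by (auto simp: n_def q_def simp del: of_nat_mult)
  \<comment> \<open>The vector \<tau> a has squared length \<beta>^2 q / n. As q \<le> n it lies
    within the radius of \<open>mgf\<close>, and the n rows together contribute an exponent linear
    in q, which is harmless for a q-th moment.\<close>
  define \<tau> where "\<tau> = \<beta> * sqrt (q / n) / sqrt (ip a a)"
  have t: "0 < \<tau>" using beta nq a by (auto simp: \<tau>_def)
  have t2: "\<tau>\<^sup>2 * ip a a = \<beta>\<^sup>2 * (q / n)" using nq a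
    by (simp add: \<tau>_def power_divide power_mult_distrib)
  have sc: "ip (\<lambda>j. s * a j) (\<lambda>j. s * a j) = s\<^sup>2 * ip a a" for s
    by (simp add: ip_scale power2_eq_square)
  have mg: "(\<integral>\<^sup>+ y. ennreal (exp (\<Sum>l\<in>H. ip (\<lambda>j. s * a j) (y l))) \<partial>PiM K \<nu>) \<le> ennreal (exp (K1 * \<beta>\<^sup>2 * q))"
    if s: "s\<^sup>2 = \<tau>\<^sup>2" for s
  proof -
    have e: "ip (\<lambda>j. s * a j) (\<lambda>j. s * a j) = \<beta>\<^sup>2 * (q / n)" unfolding sc s t2 ..
    have "\<beta>\<^sup>2 * (q / n) \<le> \<beta>\<^sup>2 * 1" using nq by (intro mult_left_mono) auto
    then have "(\<integral>\<^sup>+ y. ennreal (exp (\<Sum>l\<in>H. ip (\<lambda>j. s * a j) (y l))) \<partial>PiM K \<nu>)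
       \<le> ennreal (exp (real (card I) * (K1 * (\<beta>\<^sup>2 * (q / n)))))"
      using mgf[of _ "\<lambda>j. s * a j"] e K1 nq by (intro nn_integral_exp_sum_le K H) auto
    also have "real (card I) * (K1 * (\<beta>\<^sup>2 * (q / n))) = K1 * \<beta>\<^sup>2 * q"
      using nq by (simp add: n_def)
    finally show ?thesis .
  qed
  let ?S = "\<lambda>y. \<Sum>l\<in>H. ip a (y l)"
  have S: "(\<Sum>l\<in>H. ip (\<lambda>j. s * a j) (y l)) = s * ?S y" for s y
    by (simp add: ip_scale sum_distrib_left)
  have meas[measurable]: "?S \<in> borel_measurable (PiM K \<nu>)"
    using H by (intro borel_measurable_sum ip_measurable2) auto
  define c where "c = fact (2 * r) / \<tau> ^ (2 * r)"
  have c0: "0 \<le> c" using t by (simp add: c_def)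
  have pt: "?S y ^ (2 * r) \<le> c * (exp (\<tau> * ?S y) + exp ((-\<tau>) * ?S y))" for y
    using even_power_le_fact_exp[of "\<tau> * ?S y" r] t
    by (simp add: c_def power_mult_distrib field_simps)
  have "(\<integral>\<^sup>+ y. ennreal (?S y ^ (2 * r)) \<partial>PiM K \<nu>)
      \<le> (\<integral>\<^sup>+ y. ennreal c * (ennreal (exp (\<tau> * ?S y)) + ennreal (exp ((-\<tau>) * ?S y))) \<partial>PiM K \<nu>)"
    using pt c0 by (intro nn_integral_mono) (simp flip: ennreal_plus ennreal_mult' add: ennreal_leI)
  also have "\<dots> = ennreal c * ((\<integral>\<^sup>+ y. ennreal (exp (\<tau> * ?S y)) \<partial>PiM K \<nu>) + (\<integral>\<^sup>+ y. ennreal (exp ((-\<tau>) * ?S y)) \<partial>PiM K \<nu>))"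
    by (subst nn_integral_cmult, measurable) (subst nn_integral_add, measurable)
  also have "\<dots> \<le> ennreal c * (ennreal (exp (K1 * \<beta>\<^sup>2 * q)) + ennreal (exp (K1 * \<beta>\<^sup>2 * q)))"
    using mg[of \<tau>] mg[of "-\<tau>"] unfolding S by (intro mult_left_mono add_mono) auto
  also have "\<dots> = ennreal (2 * (c * exp (K1 * \<beta>\<^sup>2 * q)))"
    using c0 by (simp flip: ennreal_plus ennreal_mult')
  also have "c * exp (K1 * \<beta>\<^sup>2 * q) \<le> (\<gamma> * q * n * ip a a) ^ r"
  proof -
    have e: "exp (K1 * \<beta>\<^sup>2 * q) = exp (2 * K1 * \<beta>\<^sup>2) ^ r"
      by (simp add: q_def flip: exp_of_nat_mult)
    have "\<tau>\<^sup>2 = \<beta>\<^sup>2 * (q / n) / ip a a" using t2 a by (metis less_numeral_extra(3) nonzero_mult_div_cancel_right)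
    then have "c = fact (2 * r) / (\<beta>\<^sup>2 * (q / n) / ip a a) ^ r"
      by (simp add: c_def power_mult)
    also have "\<dots> \<le> (q\<^sup>2) ^ r / (\<beta>\<^sup>2 * (q / n) / ip a a) ^ r"
      unfolding q_def using a by (intro divide_right_mono fact_le_power2 zero_le_power) (auto simp: n_def)
    also have "\<dots> = (q * n * ip a a / \<beta>\<^sup>2) ^ r"
      using nq a beta by (simp add: power_divide[symmetric] field_simps power2_eq_square)
    finally have "c * exp (K1 * \<beta>\<^sup>2 * q) \<le> (q * n * ip a a / \<beta>\<^sup>2) ^ r * exp (2 * K1 * \<beta>\<^sup>2) ^ r"
      unfolding e by (intro mult_right_mono) auto
    also have "\<dots> = (\<gamma> * q * n * ip a a) ^ r"
      by (simp add: \<gamma>_def power_mult_distrib[symmetric] mult_ac)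
    finally show ?thesis .
  qed
  finally show ?thesis unfolding n_def q_def by (simp add: ennreal_leI mult_left_mono)
qed

end

context subexp_vectors
begin

text \<open>A sum of independent exponential variables of mean \<open>D\<close> is Gamma
  distributed, and its r-th moment is \<open>D ^ r\<close> times a Pochhammer symbol. Adding one
  vector is the binomial convolution of Pochhammer symbols, with \<open>fact j\<close> read as
  \<open>pochhammer 1 j\<close>.\<close>

lemma sum_sq_moment:
  assumes "H \<subseteq> I" "r \<le> R"
  shows "(\<integral>\<^sup>+ x. ennreal ((\<Sum>k\<in>H. ip (x k) (x k)) ^ r) \<partial>PiM H \<nu>)
    \<le> ennreal (D ^ r * pochhammer (real (card H)) r)"
proof -
  have "finite H" using assms(1) finI finite_subset by auto
  then show ?thesis using assms
  proof (induction H arbitrary: r rule: finite_induct)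
    case empty
    have "space (PiM {} \<nu>) \<noteq> {}" by (simp add: space_PiM_empty)
    show ?case
      by (cases r) (simp_all add: prob_space.emeasure_space_1[OF prob_space_PiM[OF prob_nu]])
  next
    case (insert i H)
    let ?S = "\<lambda>x. \<Sum>k\<in>H. ip (x k) (x k)"
    let ?h = "real (card H)"
    have [measurable]: "?S \<in> borel_measurable (PiM H \<nu>)"
      by (intro borel_measurable_sum ip_measurable3) auto
    have S0: "0 \<le> ?S x" for x by (intro sum_nonneg ip_self_nonneg)
    have f: "(\<lambda>x. ennreal ((\<Sum>k\<in>insert i H. ip (x k) (x k)) ^ r)) \<in> borel_measurable (PiM (insert i H) \<nu>)"
      by (intro measurable_compose[OF _ measurable_ennreal] borel_measurable_power borel_measurable_sum ip_measurable3) auto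
    let ?c = "\<lambda>j. real (r choose j)"
    have ex: "ennreal ((\<Sum>k\<in>insert i H. ip ((x(i := y)) k) ((x(i := y)) k)) ^ r)
        = (\<Sum>j\<le>r. ennreal (?c j) * ennreal (?S x ^ (r - j)) * ennreal (ip y y ^ j))" for x y
    proof -
      have "(\<Sum>k\<in>insert i H. ip ((x(i := y)) k) ((x(i := y)) k)) = ip y y + ?S x"
        using insert.hyps by (auto intro!: sum.cong)
      then have "(\<Sum>k\<in>insert i H. ip ((x(i := y)) k) ((x(i := y)) k)) ^ r
          = (\<Sum>j\<le>r. ?c j * ?S x ^ (r - j) * ip y y ^ j)"
        by (simp add: binomial_ring mult_ac)
      then show ?thesis
        using S0 ip_self_nonneg
        by (subst sum_ennreal[symmetric] | simp add: ennreal_mult' zero_le_power)+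
    qed
    have "(\<integral>\<^sup>+ x. ennreal ((\<Sum>k\<in>insert i H. ip (x k) (x k)) ^ r) \<partial>PiM (insert i H) \<nu>)
       = (\<integral>\<^sup>+ x. (\<integral>\<^sup>+ y. (\<Sum>j\<le>r. ennreal (?c j) * ennreal (?S x ^ (r - j)) * ennreal (ip y y ^ j)) \<partial>\<nu> i) \<partial>PiM H \<nu>)"
      by (subst product_nn_integral_insert[OF insert.hyps f]) (simp only: ex)
    also have "\<dots> = (\<integral>\<^sup>+ x. (\<Sum>j\<le>r. ennreal (?c j) * ennreal (?S x ^ (r - j)) * (\<integral>\<^sup>+ y. ennreal (ip y y ^ j) \<partial>\<nu> i)) \<partial>PiM H \<nu>)"
      by (intro nn_integral_cong) (simp add: nn_integral_sum nn_integral_cmult)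
    also have "\<dots> \<le> (\<integral>\<^sup>+ x. (\<Sum>j\<le>r. ennreal (?c j) * ennreal (?S x ^ (r - j)) * ennreal (D ^ j * fact j)) \<partial>PiM H \<nu>)"
      using insert.prems by (intro nn_integral_mono sum_mono mult_left_mono sq_moment) auto
    also have "\<dots> = (\<Sum>j\<le>r. ennreal (?c j) * (\<integral>\<^sup>+ x. ennreal (?S x ^ (r - j)) \<partial>PiM H \<nu>) * ennreal (D ^ j * fact j))"
      by (simp add: nn_integral_sum nn_integral_cmult nn_integral_multc)
    also have "\<dots> \<le> (\<Sum>j\<le>r. ennreal (?c j) * ennreal (D ^ (r - j) * pochhammer ?h (r - j)) * ennreal (D ^ j * fact j))"
      using insert.prems by (intro sum_mono mult_right_mono mult_left_mono insert.IH) auto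
    also have "\<dots> = ennreal (\<Sum>j\<le>r. ?c j * (D ^ (r - j) * pochhammer ?h (r - j)) * (D ^ j * fact j))"
      using D by (simp flip: ennreal_mult' add: pochhammer_nonneg pochhammer_of_nat sum_nonneg)
    also have "(\<Sum>j\<le>r. ?c j * (D ^ (r - j) * pochhammer ?h (r - j)) * (D ^ j * fact j))
        = D ^ r * (\<Sum>j\<le>r. ?c j * pochhammer 1 j * pochhammer ?h (r - j))"
      unfolding sum_distrib_left
    proof (rule sum.cong[OF refl])
      fix j assume "j \<in> {..r}"
      then have "D ^ r = D ^ (r - j) * D ^ j" by (simp flip: power_add)
      then show "?c j * (D ^ (r - j) * pochhammer ?h (r - j)) * (D ^ j * fact j) =
           D ^ r * (?c j * pochhammer 1 j * pochhammer ?h (r - j))"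
        by (simp add: pochhammer_fact)
    qed
    also have "\<dots> = D ^ r * pochhammer (1 + ?h) r"
      by (simp add: pochhammer_binomial_sum)
    also have "1 + ?h = real (card (insert i H))" using insert.hyps by simp
    finally show ?case .
  qed
qed

section \<open>Self-bounding moments of off-diagonal sums\<close>

definition offdiag :: "nat set \<Rightarrow> (nat \<Rightarrow> vec) \<Rightarrow> real" where
  "offdiag H x = (\<Sum>k\<in>H. \<Sum>l\<in>H - {k}. ip (x k) (x l))"

definition total :: "nat set \<Rightarrow> (nat \<Rightarrow> vec) \<Rightarrow> vec" where
  "total H x = (\<lambda>j. \<Sum>k\<in>H. x k j)"

lemma offdiag_measurable [measurable]: "H \<subseteq> K \<Longrightarrow> offdiag H \<in> borel_measurable (PiM K \<nu>)"
  unfolding offdiag_def[abs_def] by (intro borel_measurable_sum ip_measurable3) auto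

lemma ip_total_total:
  assumes "finite H"
  shows "ip (total H x) (total H x) = (\<Sum>k\<in>H. ip (x k) (x k)) + offdiag H x"
proof -
  have "ip (total H x) (total H x) = (\<Sum>k\<in>H. \<Sum>l\<in>H. ip (x k) (x l))"
    unfolding total_def ip_sum by (simp add: ip_commute)
  also have "\<dots> = (\<Sum>k\<in>H. ip (x k) (x k) + (\<Sum>l\<in>H - {k}. ip (x k) (x l)))"
    using assms by (intro sum.cong refl) (simp add: sum.remove)
  finally show ?thesis by (simp add: sum.distrib offdiag_def)
qed

text \<open>A crude Cauchy-Schwarz bound. It serves to show that the moments of
  \<open>offdiag\<close> are finite before the self-bounding inequality is solved for them.\<close>

lemma ip_total_le:
  assumes "H \<subseteq> I"
  shows "ip (total H x) (total H x) \<le> real (card I) * (\<Sum>k\<in>I. ip (x k) (x k))"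
proof -
  have "ip (total H x) (total H x) = (\<Sum>j\<in>J. (\<Sum>k\<in>H. x k j)\<^sup>2)"
    by (simp add: ip_def total_def power2_eq_square)
  also have "\<dots> \<le> (\<Sum>j\<in>J. (\<Sum>k\<in>H. (x k j)\<^sup>2) * real (card H))"
    by (intro sum_mono sum_squared_le_sum_of_squares)
  also have "\<dots> = real (card H) * (\<Sum>k\<in>H. ip (x k) (x k))"
    unfolding sum_distrib_right[symmetric] by (subst sum.swap) (simp add: ip_def power2_eq_square)
  also have "\<dots> \<le> real (card I) * (\<Sum>k\<in>I. ip (x k) (x k))"
    using assms finI by (intro mult_mono sum_mono2 of_nat_mono card_mono sum_nonneg ip_self_nonneg) auto
  finally show ?thesis .
qed

lemma total_measurable [measurable]:
  "H \<subseteq> K \<Longrightarrow> (\<lambda>x. ip (total H x) (total H x)) \<in> borel_measurable (PiM K \<nu>)"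
  unfolding ip_def total_def
  by (intro borel_measurable_sum borel_measurable_times coord2_measurable) auto

text \<open>With the vectors in \<open>H\<close> frozen, the double sum is a linear form in the
  independent vectors outside \<open>H\<close>, with coefficient vector \<open>total H x\<close>. So
  \<open>linear_moment\<close> applies to the inner integral, and the squared length of
  \<open>total H x\<close> is what remains to be integrated.\<close>

lemma decoupled_moment:
  assumes G: "G \<subseteq> I" and H: "H \<subseteq> G" and r: "1 \<le> r" "2 * r \<le> card I"
  shows "(\<integral>\<^sup>+ x. ennreal ((\<Sum>k\<in>H. \<Sum>l\<in>G - H. ip (x k) (x l)) ^ (2 * r)) \<partial>PiM I \<nu>)
    \<le> ennreal (2 * (\<gamma> * real (2 * r) * real (card I)) ^ r) *
      (\<integral>\<^sup>+ x. ennreal (ip (total H x) (total H x) ^ r) \<partial>PiM I \<nu>)"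
proof -
  let ?c = "\<gamma> * real (2 * r) * real (card I)"
  have HI: "H \<subseteq> I" "H \<union> (I - H) = I" "H \<inter> (I - H) = {}" using G H by auto
  have fin: "finite H" "finite (I - H)" using HI(1) finI finite_subset by auto
  have c0: "0 \<le> ?c" using gamma_pos by simp
  note fold = product_nn_integral_fold[OF HI(3) fin, unfolded HI(2)]
  have m1: "(\<lambda>x. ennreal ((\<Sum>k\<in>H. \<Sum>l\<in>G - H. ip (x k) (x l)) ^ (2 * r))) \<in> borel_measurable (PiM I \<nu>)"
    using G H by (intro measurable_compose[OF _ measurable_ennreal] borel_measurable_power borel_measurable_sum ip_measurable3) auto
  have m2: "(\<lambda>x. ennreal (ip (total H x) (total H x) ^ r)) \<in> borel_measurable (PiM I \<nu>)"
    using HI by measurable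
  have m3: "(\<lambda>x. ennreal (ip (total H x) (total H x) ^ r)) \<in> borel_measurable (PiM H \<nu>)"
    by measurable
  have e1: "(\<Sum>k\<in>H. \<Sum>l\<in>G - H. ip (merge H (I - H) (x, y) k) (merge H (I - H) (x, y) l))
      = (\<Sum>l\<in>G - H. ip (total H x) (y l))" for x y
  proof -
    have "(\<Sum>k\<in>H. \<Sum>l\<in>G - H. ip (merge H (I - H) (x, y) k) (merge H (I - H) (x, y) l))
      = (\<Sum>k\<in>H. \<Sum>l\<in>G - H. ip (x k) (y l))"
      using G by (intro sum.cong refl arg_cong2[of _ _ _ _ ip]) (auto simp: merge_def)
    then show ?thesis by (subst (asm) sum.swap) (simp add: total_def ip_sum)
  qed
  have e2: "total H (merge H (I - H) (x, y)) = total H x" for x y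
    unfolding total_def by (intro ext sum.cong) (auto simp: merge_def)
  have "(\<integral>\<^sup>+ x. ennreal ((\<Sum>k\<in>H. \<Sum>l\<in>G - H. ip (x k) (x l)) ^ (2 * r)) \<partial>PiM I \<nu>)
      = (\<integral>\<^sup>+ x. (\<integral>\<^sup>+ y. ennreal ((\<Sum>l\<in>G - H. ip (total H x) (y l)) ^ (2 * r)) \<partial>PiM (I - H) \<nu>) \<partial>PiM H \<nu>)"
    unfolding fold[OF m1] e1 ..
  also have "\<dots> \<le> (\<integral>\<^sup>+ x. ennreal (2 * (?c * ip (total H x) (total H x)) ^ r) \<partial>PiM H \<nu>)"
    using G r by (intro nn_integral_mono linear_moment) auto
  also have "\<dots> = (\<integral>\<^sup>+ x. ennreal (2 * ?c ^ r) * ennreal (ip (total H x) (total H x) ^ r) \<partial>PiM H \<nu>)"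
    unfolding power_mult_distrib[of ?c] mult.assoc[symmetric] by (rule nn_integral_cong, rule ennreal_mult') (use c0 in simp)
  also have "\<dots> = ennreal (2 * ?c ^ r) * (\<integral>\<^sup>+ x. ennreal (ip (total H x) (total H x) ^ r) \<partial>PiM H \<nu>)"
    by (rule nn_integral_cmult[OF m3])
  also have "(\<integral>\<^sup>+ x. ennreal (ip (total H x) (total H x) ^ r) \<partial>PiM H \<nu>)
      = (\<integral>\<^sup>+ x. ennreal (ip (total H x) (total H x) ^ r) \<partial>PiM I \<nu>)"
    unfolding fold[OF m2] e2
    by (simp add: prob_space.emeasure_space_1[OF prob_space_PiM[OF prob_nu]])
  finally show ?thesis .
qed

text \<open>Jensen's inequality for the average over subsets \<open>H\<close>, followed by
  \<open>decoupled_moment\<close> for each of them. The 16 is the factor 4 of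
  \<open>sum_Pow_decoupling\<close>, raised to the power 2 r.\<close>

lemma offdiag_moment_step:
  assumes G: "G \<subseteq> I" and r: "1 \<le> r" "2 * r \<le> card I"
    and B: "\<And>H. H \<subseteq> G \<Longrightarrow> (\<integral>\<^sup>+ x. ennreal (ip (total H x) (total H x) ^ r) \<partial>PiM I \<nu>) \<le> ennreal B"
    and B0: "0 \<le> B"
  shows "(\<integral>\<^sup>+ x. ennreal (offdiag G x ^ (2 * r)) \<partial>PiM I \<nu>)
    \<le> ennreal (2 * (16 * \<gamma> * real (2 * r) * real (card I)) ^ r * B)"
proof -
  let ?S = "\<lambda>H x. \<Sum>k\<in>H. \<Sum>l\<in>G - H. ip (x k) (x l)"
  let ?c = "\<gamma> * real (2 * r) * real (card I)"
  have c0: "0 \<le> ?c" using gamma_pos by simp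
  have finG: "finite G" using G finI finite_subset by auto
  have m: "(\<lambda>x. ?S H x) \<in> borel_measurable (PiM I \<nu>)" if "H \<in> Pow G" for H
    using G that by (intro borel_measurable_sum ip_measurable3) auto
  have pt: "offdiag G x ^ (2 * r) \<le> (\<Sum>H\<in>Pow G. 16 ^ r / 2 ^ card G * ?S H x ^ (2 * r))" for x
  proof -
    have "offdiag G x = (\<Sum>H\<in>Pow G. 4 * ?S H x) / real (card (Pow G))"
      using sum_Pow_decoupling[OF finG, of "\<lambda>k l. ip (x k) (x l)"] finG
      by (simp add: offdiag_def card_Pow sum_distrib_left field_simps)
    then have "offdiag G x ^ (2 * r) \<le> (\<Sum>H\<in>Pow G. (4 * ?S H x) ^ (2 * r)) / real (card (Pow G))"
      using even_power_mean_le[of "Pow G" "\<lambda>H. 4 * ?S H x" r] finG by auto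
    also have "\<dots> = (\<Sum>H\<in>Pow G. 16 ^ r / 2 ^ card G * ?S H x ^ (2 * r))"
      using finG by (simp add: card_Pow sum_divide_distrib power_mult_distrib power_mult)
    finally show ?thesis .
  qed
  have "(\<integral>\<^sup>+ x. ennreal (offdiag G x ^ (2 * r)) \<partial>PiM I \<nu>)
      \<le> (\<integral>\<^sup>+ x. (\<Sum>H\<in>Pow G. ennreal (16 ^ r / 2 ^ card G) * ennreal (?S H x ^ (2 * r))) \<partial>PiM I \<nu>)"
  proof (rule nn_integral_mono)
    fix x
    have "ennreal (offdiag G x ^ (2 * r)) \<le> ennreal (\<Sum>H\<in>Pow G. 16 ^ r / 2 ^ card G * ?S H x ^ (2 * r))"
      by (rule ennreal_leI[OF pt])
    also have "\<dots> = (\<Sum>H\<in>Pow G. ennreal (16 ^ r / 2 ^ card G) * ennreal (?S H x ^ (2 * r)))"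
      by (subst sum_ennreal[symmetric]) (auto simp: power_mult simp flip: ennreal_mult')
    finally show "ennreal (offdiag G x ^ (2 * r)) \<le> \<dots>" .
  qed
  also have "\<dots> = (\<Sum>H\<in>Pow G. ennreal (16 ^ r / 2 ^ card G) * (\<integral>\<^sup>+ x. ennreal (?S H x ^ (2 * r)) \<partial>PiM I \<nu>))"
    using m by (subst nn_integral_sum) (auto intro!: sum.cong nn_integral_cmult)
  also have "\<dots> \<le> (\<Sum>H\<in>Pow G. ennreal (16 ^ r / 2 ^ card G) * (ennreal (2 * ?c ^ r) * ennreal B))"
  proof (intro sum_mono mult_left_mono)
    fix H assume "H \<in> Pow G"
    then have H: "H \<subseteq> G" by simp
    show "(\<integral>\<^sup>+ x. ennreal (?S H x ^ (2 * r)) \<partial>PiM I \<nu>) \<le> ennreal (2 * ?c ^ r) * ennreal B"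
      by (rule order_trans[OF decoupled_moment[OF G H r] mult_left_mono[OF B[OF H]]]) simp
  qed simp
  also have "\<dots> = (\<Sum>H\<in>Pow G. ennreal (16 ^ r / 2 ^ card G * (2 * ?c ^ r * B)))"
  proof -
    have "0 \<le> 2 * ?c ^ r" using c0 by simp
    then have "ennreal (16 ^ r / 2 ^ card G) * (ennreal (2 * ?c ^ r) * ennreal B)
      = ennreal (16 ^ r / 2 ^ card G * (2 * ?c ^ r * B))"
      by (subst (1 2) ennreal_mult') auto
    then show ?thesis by (simp only:)
  qed
  also have "\<dots> = ennreal (\<Sum>H\<in>Pow G. 16 ^ r / 2 ^ card G * (2 * ?c ^ r * B))"
    using c0 B0 by (intro sum_ennreal) simp
  also have "(\<Sum>H\<in>Pow G. 16 ^ r / 2 ^ card G * (2 * ?c ^ r * B)) = 2 * (16 * \<gamma> * real (2 * r) * real (card I)) ^ r * B"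
  proof -
    have "(16 * \<gamma> * real (2 * r) * real (card I)) ^ r = 16 ^ r * ?c ^ r"
      by (simp only: power_mult_distrib[symmetric] mult.assoc)
    then show ?thesis using finG by (simp only: sum_constant card_Pow) simp
  qed
  finally show ?thesis .
qed

lemma offdiag_moment:
  assumes r: "1 \<le> r" "2 * r \<le> card I" "r \<le> R"
  defines "a \<equiv> 2 * (32 * \<gamma> * real (2 * r) * real (card I)) ^ r"
  defines "b \<equiv> D ^ r * pochhammer (real (card I)) r"
  shows "(\<integral>\<^sup>+ x. ennreal (offdiag I x ^ (2 * r)) \<partial>PiM I \<nu>) \<le> ennreal (2 * a * b + a\<^sup>2)"
proof -
  let ?T = "\<lambda>x. \<Sum>k\<in>I. ip (x k) (x k)"
  define F where "F G = (\<integral>\<^sup>+ x. ennreal (offdiag G x ^ (2 * r)) \<partial>PiM I \<nu>)" for G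
  have apos: "0 < a" using r gamma_pos by (auto simp: a_def)
  have b0: "0 \<le> b" using D by (simp add: b_def pochhammer_nonneg pochhammer_of_nat)
  have T0: "0 \<le> ?T x" for x by (intro sum_nonneg ip_self_nonneg)
  have [measurable]: "?T \<in> borel_measurable (PiM I \<nu>)"
    by (intro borel_measurable_sum ip_measurable3) auto
  have T: "(\<integral>\<^sup>+ x. ennreal (?T x ^ r) \<partial>PiM I \<nu>) \<le> ennreal b"
    unfolding b_def by (rule sum_sq_moment) (use r in auto)
  \<comment> \<open>The argument ends by subtracting m / 2 from both sides of an inequality, which
    is sound only for finite moments.\<close>
  have "F G \<noteq> \<infinity>" if G: "G \<subseteq> I" for G
  proof -
    have "(\<integral>\<^sup>+ x. ennreal (ip (total H x) (total H x) ^ r) \<partial>PiM I \<nu>) \<le> ennreal (real (card I) ^ r * b)"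
      if "H \<subseteq> G" for H
    proof -
      have "(\<integral>\<^sup>+ x. ennreal (ip (total H x) (total H x) ^ r) \<partial>PiM I \<nu>)
          \<le> (\<integral>\<^sup>+ x. ennreal (real (card I) ^ r) * ennreal (?T x ^ r) \<partial>PiM I \<nu>)"
        using that G T0 ip_total_le[of H] ip_self_nonneg
        by (intro nn_integral_mono) (auto simp flip: ennreal_mult power_mult_distrib intro!: ennreal_leI power_mono)
      also have "\<dots> = ennreal (real (card I) ^ r) * (\<integral>\<^sup>+ x. ennreal (?T x ^ r) \<partial>PiM I \<nu>)"
        by (rule nn_integral_cmult) measurable
      also have "\<dots> \<le> ennreal (real (card I) ^ r) * ennreal b" by (intro mult_left_mono T) simp
      finally show ?thesis by (simp add: ennreal_mult')
    qed
    from offdiag_moment_step[OF G r(1,2) this] b0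
    have "F G \<le> ennreal (2 * (16 * \<gamma> * real (2 * r) * real (card I)) ^ r * (real (card I) ^ r * b))"
      by (simp add: F_def)
    then show ?thesis by (auto simp: top_unique)
  qed
  then have "\<exists>f. F G = ennreal f \<and> 0 \<le> f" if "G \<subseteq> I" for G
    using that by (cases "F G") auto
  then obtain f where f: "\<And>G. G \<subseteq> I \<Longrightarrow> F G = ennreal (f G)" "\<And>G. G \<subseteq> I \<Longrightarrow> 0 \<le> f G" by metis
  \<comment> \<open>The estimate for \<open>G\<close> involves the off-diagonal sums of all its
    subsets \<open>H\<close>. Taking the maximum over all subsets of \<open>I\<close> closes the
    recursion.\<close>
  define m where "m = Max (f ` Pow I)"
  have le_m: "f G \<le> m" if "G \<subseteq> I" for G
    unfolding m_def using that finI by (intro Max_ge) auto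
  have m0: "0 \<le> m" using le_m[of I] f(2)[of I] by simp
  have step: "f G \<le> a * (b + a / 2 + m / (2 * a))" if G: "G \<subseteq> I" for G
  proof -
    have "(\<integral>\<^sup>+ x. ennreal (ip (total H x) (total H x) ^ r) \<partial>PiM I \<nu>) \<le> ennreal (2 ^ r * (b + a / 2 + m / (2 * a)))"
      if H: "H \<subseteq> G" for H
    proof -
      have HI: "H \<subseteq> I" "finite H" using H G finI finite_subset[of H I] by auto
      have pt: "ip (total H x) (total H x) ^ r \<le> 2 ^ r * (?T x ^ r + a / 2 + offdiag H x ^ (2 * r) / (2 * a))" for x
      proof -
        let ?N = "offdiag H x"
        have "ip (total H x) (total H x) \<le> ?T x + \<bar>?N\<bar>"
          unfolding ip_total_total[OF HI(2)] using HI finI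
          by (intro add_mono sum_mono2 ip_self_nonneg) auto
        also have "\<dots> \<le> 2 * max (?T x) \<bar>?N\<bar>" by simp
        finally have "ip (total H x) (total H x) ^ r \<le> (2 * max (?T x) \<bar>?N\<bar>) ^ r"
          by (intro power_mono ip_self_nonneg)
        also have "\<dots> \<le> 2 ^ r * (?T x ^ r + \<bar>?N\<bar> ^ r)"
          using T0 by (auto simp: power_mult_distrib max_def)
        \<comment> \<open>AM-GM with weight \<open>a\<close>: after multiplication by the outer
          factor \<open>a\<close>, the coefficient of \<open>m\<close> is exactly 1 / 2, so that the
          term can be absorbed on the left.\<close>
        also have "\<bar>?N\<bar> ^ r \<le> a / 2 + ?N ^ (2 * r) / (2 * a)"
        proof -
          have "0 \<le> (\<bar>?N\<bar> ^ r - a)\<^sup>2" by simp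
          also have "(\<bar>?N\<bar> ^ r - a)\<^sup>2 = ?N ^ (2 * r) + a\<^sup>2 - 2 * a * \<bar>?N\<bar> ^ r"
            by (simp add: power2_diff power_mult[symmetric] mult.commute[of r 2] power_even_abs)
          finally show ?thesis using apos by (simp add: field_simps power2_eq_square)
        qed
        finally show ?thesis by (simp add: algebra_simps)
      qed
      have "(\<integral>\<^sup>+ x. ennreal (ip (total H x) (total H x) ^ r) \<partial>PiM I \<nu>)
          \<le> (\<integral>\<^sup>+ x. ennreal (2 ^ r) * (ennreal (?T x ^ r) + ennreal (a / 2) + ennreal (1 / (2 * a)) * ennreal (offdiag H x ^ (2 * r))) \<partial>PiM I \<nu>)"
        using pt T0 apos
        by (intro nn_integral_mono) (simp flip: ennreal_mult' ennreal_plus add: power_mult ennreal_leI)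
      also have "\<dots> = ennreal (2 ^ r) * ((\<integral>\<^sup>+ x. ennreal (?T x ^ r) \<partial>PiM I \<nu>) + ennreal (a / 2) + ennreal (1 / (2 * a)) * F H)"
        unfolding F_def using HI
        by (subst nn_integral_cmult, measurable)
           (subst nn_integral_add, measurable, subst nn_integral_add, measurable, subst nn_integral_cmult, measurable,
            simp add: prob_space.emeasure_space_1[OF prob_space_PiM[OF prob_nu]])
      also have "\<dots> \<le> ennreal (2 ^ r) * (ennreal b + ennreal (a / 2) + ennreal (1 / (2 * a)) * ennreal m)"
        using HI f le_m[of H] by (intro mult_left_mono add_mono T) (auto intro: ennreal_leI)
      also have "\<dots> = ennreal (2 ^ r * (b + a / 2 + m / (2 * a)))"
        using b0 apos m0 by (simp flip: ennreal_mult' ennreal_plus)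
      finally show ?thesis .
    qed
    from offdiag_moment_step[OF G r(1,2) this]
    have "ennreal (f G) \<le> ennreal (2 * (16 * \<gamma> * real (2 * r) * real (card I)) ^ r * (2 ^ r * (b + a / 2 + m / (2 * a))))"
      using apos b0 m0 f(1)[OF G] by (simp add: F_def)
    also have "2 * (16 * \<gamma> * real (2 * r) * real (card I)) ^ r * (2 ^ r * (b + a / 2 + m / (2 * a))) = a * (b + a / 2 + m / (2 * a))"
      by (simp add: a_def power_mult_distrib[symmetric] mult_ac)
    finally show ?thesis using apos b0 m0 by (simp add: ennreal_le_iff)
  qed
  have "m \<in> f ` Pow I" unfolding m_def using finI by (intro Max_in) auto
  then have "m \<le> a * (b + a / 2 + m / (2 * a))" using step by auto
  also have "\<dots> = a * b + a\<^sup>2 / 2 + m / 2" using apos by (simp add: field_simps power2_eq_square)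
  finally have "m \<le> 2 * a * b + a\<^sup>2" by simp
  then show ?thesis using f(1)[of I] le_m[of I] by (simp add: F_def ennreal_leI)
qed

end

section \<open>The slope norm\<close>

lemma norm2_eq_L2_set: "norm2 J x = L2_set x J"
  by (simp add: norm2_def L2_set_def)

lemma ex_decreasing_enum:
  fixes f :: "nat \<Rightarrow> real"
  assumes "finite A"
  obtains \<tau> where "bij_betw \<tau> {..<card A} A" "\<And>i j. i \<le> j \<Longrightarrow> j < card A \<Longrightarrow> f (\<tau> j) \<le> f (\<tau> i)"
proof -
  define zs where "zs = sort_key (\<lambda>i. - f i) (sorted_list_of_set A)"
  have zs: "distinct zs" "set zs = A" "length zs = card A" and srt: "sorted (map (\<lambda>i. - f i) zs)"
    using assms by (simp_all add: zs_def)
  have "bij_betw ((!) zs) {..<card A} A"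
    using zs by (intro bij_betw_nth) auto
  moreover have "f (zs ! j) \<le> f (zs ! i)" if "i \<le> j" "j < card A" for i j
    using sorted_nth_mono[of "map (\<lambda>i. - f i) zs" i j] srt that zs(3) by simp
  ultimately show ?thesis by (rule that)
qed

text \<open>An exchange argument: \<open>T - P\<close> and \<open>P - T\<close> have equally many
  elements, and the m-th largest value \<theta> lies above all values on the first and below all
  values on the second.\<close>

lemma sum_le_sum_largest:
  fixes x :: "nat \<Rightarrow> real"
  assumes bij: "bij_betw \<pi> {..<p} A" and dec: "\<And>i j. i \<le> j \<Longrightarrow> j < p \<Longrightarrow> x (\<pi> j) \<le> x (\<pi> i)"
    and T: "T \<subseteq> A" "card T = m"
  shows "sum x T \<le> (\<Sum>i<m. x (\<pi> i))"
proof (cases "m = 0")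
  case True
  have "finite A" using bij bij_betw_finite by blast
  then have "T = {}" using T True finite_subset by fastforce
  then show ?thesis using True by simp
next
  case False
  have finA: "finite A" using bij bij_betw_finite by blast
  have "card A = p" using bij_betw_same_card[OF bij] by simp
  then have mp: "m \<le> p" using card_mono[OF finA T(1)] T(2) by simp
  define P where "P = \<pi> ` {..<m}"
  have inj: "inj_on \<pi> {..<m}" using bij mp by (auto simp: bij_betw_def intro: inj_on_subset)
  have P: "finite P" "card P = m" "P \<subseteq> A"
    using inj bij mp by (auto simp: P_def card_image bij_betw_def)
  have finT: "finite T" using T finA finite_subset by auto
  define \<theta> where "\<theta> = x (\<pi> (m - 1))"
  have le: "x j \<le> \<theta>" if "j \<in> T - P" for j
  proof -
    from that T(1) have "j \<in> \<pi> ` {..<p}" using bij by (auto simp: bij_betw_def)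
    then obtain i where i: "j = \<pi> i" "i < p" by auto
    then have "m \<le> i" using that by (force simp: P_def)
    then show ?thesis using dec[of "m - 1" i] i by (simp add: \<theta>_def)
  qed
  have ge: "\<theta> \<le> x j" if "j \<in> P - T" for j
  proof -
    from that obtain i where i: "j = \<pi> i" "i < m" by (auto simp: P_def)
    then show ?thesis using dec[of i "m - 1"] mp by (auto simp: \<theta>_def)
  qed
  have cd: "card (T - P) = card (P - T)"
    using card_Diff_subset_Int[of T P] card_Diff_subset_Int[of P T] P T finT by (simp add: Int_commute)
  have "sum x T = sum x (T \<inter> P) + sum x (T - P)"
    by (rule sum.Int_Diff[OF finT])
  also have "sum x (T - P) \<le> real (card (T - P)) * \<theta>"
    by (rule sum_bounded_above) (rule le)
  also have "real (card (T - P)) * \<theta> = real (card (P - T)) * \<theta>" by (simp add: cd)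
  also have "\<dots> \<le> sum x (P - T)" by (rule sum_bounded_below) (rule ge)
  also have "sum x (T \<inter> P) + sum x (P - T) = sum x P"
    using sum.Int_Diff[OF P(1), of x T] by (simp add: Int_commute)
  also have "sum x P = (\<Sum>i<m. x (\<pi> i))"
    by (simp add: P_def sum.reindex[OF inj])
  finally show ?thesis by simp
qed

text \<open>Abel summation: a nonincreasing weight that ends nonnegative is a nonnegative
  combination of indicators of initial segments. The induction keeps the current weight in front of
  the partial sum of \<open>b i - a i\<close>.\<close>

lemma weighted_sum_mono:
  fixes w d :: "nat \<Rightarrow> real"
  assumes w: "\<And>m. w (Suc m) \<le> w m" and "0 \<le> w k"
    and D: "\<And>m. m \<le> k \<Longrightarrow> (\<Sum>i<m. a i) \<le> (\<Sum>i<m. b i)"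
  shows "(\<Sum>i<k. w i * a i) \<le> (\<Sum>i<k. w i * b i)"
proof -
  have "w m * (\<Sum>i<m. b i - a i) \<le> (\<Sum>i<m. w i * (b i - a i))" if "m \<le> k" for m
    using that
  proof (induction m)
    case (Suc m)
    have "w (Suc m) * (\<Sum>i<Suc m. b i - a i) \<le> w m * (\<Sum>i<Suc m. b i - a i)"
      using D[OF Suc.prems] by (intro mult_right_mono w) (simp add: sum_subtractf)
    also have "\<dots> = w m * (\<Sum>i<m. b i - a i) + w m * (b m - a m)" by (simp add: algebra_simps)
    also have "\<dots> \<le> (\<Sum>i<Suc m. w i * (b i - a i))" using Suc by simp
    finally show ?case .
  qed simp
  from this[of k] have "w k * (\<Sum>i<k. b i - a i) \<le> (\<Sum>i<k. w i * (b i - a i))" by simp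
  moreover have "0 \<le> w k * (\<Sum>i<k. b i - a i)"
    using D[of k] assms(2) by (simp add: sum_subtractf)
  ultimately show ?thesis by (simp add: right_diff_distrib sum_subtractf)
qed

section \<open>Rearrangement and the cone inequality for the slope norm\<close>

context
  fixes n p :: nat
  assumes n: "0 < n" and p: "0 < p"
begin

definition wt :: "nat \<Rightarrow> real" where "wt m = slope_weight 1 n p (Suc m)"

abbreviation "sn \<equiv> slope_norm 1 n p"

lemma wt_def': "wt m = sqrt (ln (2 * real p / real (Suc m)) / real n)"
  by (simp add: wt_def slope_weight_def)

lemma wt_antimono: "wt (Suc m) \<le> wt m"
  unfolding wt_def' using n p by (intro real_sqrt_le_mono divide_right_mono) (auto intro!: divide_left_mono)

text \<open>The range includes \<open>m = p\<close>, one past the last weight of the norm, because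
  \<open>weighted_sum_mono\<close> asks for the sign of the weight after the last term. There the
  ratio 2 p / (p + 1) is still at least 1.\<close>

lemma wt_nonneg: "m \<le> p \<Longrightarrow> 0 \<le> wt m"
  unfolding wt_def' using n p by (auto intro!: divide_nonneg_nonneg ln_ge_zero simp: field_simps)

lemma wt_sq: "m < p \<Longrightarrow> (wt m)\<^sup>2 = ln (2 * real p / real (Suc m)) / real n"
  unfolding wt_def' using n p by (intro real_sqrt_pow2) (auto intro!: divide_nonneg_nonneg ln_ge_zero simp: field_simps)

lemma slope_norm_scale: "slope_norm c n p t = c * sn t"
  by (simp add: slope_norm_def slope_weight_def sum_distrib_left mult_ac)

lemma slope_norm_sorted:
  assumes bij: "bij_betw \<tau> {..<p} {..<p}"
    and dec: "\<And>i j. i \<le> j \<Longrightarrow> j < p \<Longrightarrow> \<bar>t (\<tau> j)\<bar> \<le> \<bar>t (\<tau> i)\<bar>"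
  shows "sn t = (\<Sum>m<p. wt m * \<bar>t (\<tau> m)\<bar>)"
proof -
  define ys where "ys = rev (map (\<lambda>m. \<bar>t (\<tau> m)\<bar>) [0..<p])"
  have "sorted ys"
    unfolding ys_def sorted_iff_nth_mono by (auto simp: rev_nth intro!: dec)
  moreover have "mset ys = mset (map (\<lambda>i. \<bar>t i\<bar>) [0..<p])"
  proof -
    have "mset ys = image_mset (\<lambda>i. \<bar>t i\<bar>) (image_mset \<tau> (mset_set {..<p}))"
      by (simp add: ys_def image_mset.compositionality comp_def lessThan_atLeast0)
    also have "image_mset \<tau> (mset_set {..<p}) = mset_set {..<p}"
      using bij by (simp add: bij_betw_def image_mset_mset_set)
    finally show ?thesis by (simp add: lessThan_atLeast0)
  qed
  ultimately have s: "sort (map (\<lambda>i. \<bar>t i\<bar>) [0..<p]) = ys"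
    by (intro properties_for_sort) auto
  have "sn t = (\<Sum>i=1..p. slope_weight 1 n p i * ys ! (p - i))"
    unfolding slope_norm_def order_stat_def s by simp
  also have "\<dots> = (\<Sum>m<p. slope_weight 1 n p (Suc m) * ys ! (p - Suc m))"
    by (rule sum.reindex_bij_witness[of _ Suc "\<lambda>i. i - 1"]) auto
  also have "\<dots> = (\<Sum>m<p. wt m * \<bar>t (\<tau> m)\<bar>)"
    by (intro sum.cong refl) (auto simp: wt_def ys_def rev_nth)
  finally show ?thesis .
qed

lemma slope_norm_enum:
  obtains \<pi> where "bij_betw \<pi> {..<p} {..<p}"
    "\<forall>i j. i \<le> j \<longrightarrow> j < p \<longrightarrow> \<bar>t (\<pi> j)\<bar> \<le> \<bar>t (\<pi> i)\<bar>"
    "sn t = (\<Sum>m<p. wt m * \<bar>t (\<pi> m)\<bar>)"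
proof -
  obtain \<pi> where pi: "bij_betw \<pi> {..<card {..<p}} {..<p}"
    "\<And>i j. i \<le> j \<Longrightarrow> j < card {..<p} \<Longrightarrow> \<bar>t (\<pi> j)\<bar> \<le> \<bar>t (\<pi> i)\<bar>"
    using ex_decreasing_enum[of "{..<p}" "\<lambda>i. \<bar>t i\<bar>"] by auto
  then show ?thesis using that[of \<pi>] slope_norm_sorted[of \<pi> t] by simp
qed

text \<open>The rearrangement inequality: decreasing weights are best paired with decreasing moduli.
  Hence the slope norm is a maximum of weighted l1 norms over permutations, which yields its
  monotonicity and triangle inequality.\<close>

lemma perm_sum_le_slope_norm:
  assumes "bij_betw \<tau> {..<p} {..<p}"
  shows "(\<Sum>m<p. wt m * \<bar>t (\<tau> m)\<bar>) \<le> sn t"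
proof -
  obtain \<pi> where pi: "bij_betw \<pi> {..<p} {..<p}"
    "\<forall>i j. i \<le> j \<longrightarrow> j < p \<longrightarrow> \<bar>t (\<pi> j)\<bar> \<le> \<bar>t (\<pi> i)\<bar>"
    "sn t = (\<Sum>m<p. wt m * \<bar>t (\<pi> m)\<bar>)" by (rule slope_norm_enum[of t])
  show ?thesis unfolding pi(3)
  proof (rule weighted_sum_mono)
    fix m assume m: "m \<le> p"
    have inj: "inj_on \<tau> {..<m}" using assms m by (auto simp: bij_betw_def intro: inj_on_subset)
    have "(\<Sum>i\<in>\<tau> ` {..<m}. \<bar>t i\<bar>) \<le> (\<Sum>i<m. \<bar>t (\<pi> i)\<bar>)"
      using assms m using pi(2)
      by (intro sum_le_sum_largest[OF pi(1)]) (auto simp: card_image[OF inj] bij_betw_def)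
    then show "(\<Sum>i<m. \<bar>t (\<tau> i)\<bar>) \<le> (\<Sum>i<m. \<bar>t (\<pi> i)\<bar>)"
      by (simp add: sum.reindex[OF inj])
  qed (auto intro: wt_antimono wt_nonneg)
qed

lemma slope_norm_mono:
  assumes "\<And>j. j < p \<Longrightarrow> \<bar>a j\<bar> \<le> \<bar>b j\<bar>"
  shows "sn a \<le> sn b"
proof -
  obtain \<pi> where pi: "bij_betw \<pi> {..<p} {..<p}" "sn a = (\<Sum>m<p. wt m * \<bar>a (\<pi> m)\<bar>)"
    by (rule slope_norm_enum[of a])
  have "sn a \<le> (\<Sum>m<p. wt m * \<bar>b (\<pi> m)\<bar>)"
    unfolding pi(2) using pi(1) by (intro sum_mono mult_left_mono assms wt_nonneg) (auto simp: bij_betw_def)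
  also have "\<dots> \<le> sn b" by (rule perm_sum_le_slope_norm[OF pi(1)])
  finally show ?thesis .
qed

lemma slope_norm_nonneg: "0 \<le> sn a"
proof -
  obtain \<pi> where pi: "sn a = (\<Sum>m<p. wt m * \<bar>a (\<pi> m)\<bar>)" by (rule slope_norm_enum[of a])
  show ?thesis unfolding pi by (intro sum_nonneg mult_nonneg_nonneg wt_nonneg) auto
qed

lemma slope_norm_triangle: "sn (\<lambda>j. a j + b j) \<le> sn a + sn b"
proof -
  obtain \<pi> where pi: "bij_betw \<pi> {..<p} {..<p}" "sn (\<lambda>j. a j + b j) = (\<Sum>m<p. wt m * \<bar>a (\<pi> m) + b (\<pi> m)\<bar>)"
    by (rule slope_norm_enum[of "\<lambda>j. a j + b j"])
  have "sn (\<lambda>j. a j + b j) \<le> (\<Sum>m<p. wt m * (\<bar>a (\<pi> m)\<bar> + \<bar>b (\<pi> m)\<bar>))"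
    unfolding pi(2) by (intro sum_mono mult_left_mono wt_nonneg) auto
  also have "\<dots> \<le> sn a + sn b"
    using perm_sum_le_slope_norm[OF pi(1), of a] perm_sum_le_slope_norm[OF pi(1), of b]
    by (simp add: distrib_left sum.distrib)
  finally show ?thesis .
qed

lemma weighted_enum_le:
  assumes inj: "inj_on c {..<k}" and sub: "c ` {..<k} \<subseteq> {..<p}" and "k \<le> s"
  shows "(\<Sum>m<k. wt m * \<bar>\<delta> (c m)\<bar>) \<le> sqrt (\<Sum>m<s. (wt m)\<^sup>2) * L2_set \<delta> {..<p}"
proof -
  have "(\<Sum>m<k. wt m * \<bar>\<delta> (c m)\<bar>) \<le> (\<Sum>m<k. \<bar>wt m\<bar> * \<bar>\<delta> (c m)\<bar>)"
    by (intro sum_mono mult_right_mono) auto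
  also have "\<dots> \<le> L2_set wt {..<k} * L2_set (\<lambda>m. \<delta> (c m)) {..<k}" by (rule L2_set_mult_ineq)
  also have "\<dots> \<le> sqrt (\<Sum>m<s. (wt m)\<^sup>2) * L2_set \<delta> {..<p}"
  proof (rule mult_mono)
    show "L2_set wt {..<k} \<le> sqrt (\<Sum>m<s. (wt m)\<^sup>2)"
      unfolding L2_set_def using assms by (intro real_sqrt_le_mono sum_mono2) auto
    have "(\<Sum>m<k. (\<delta> (c m))\<^sup>2) = (\<Sum>j\<in>c ` {..<k}. (\<delta> j)\<^sup>2)" by (simp add: sum.reindex[OF inj])
    also have "\<dots> \<le> (\<Sum>j<p. (\<delta> j)\<^sup>2)" using sub by (intro sum_mono2) auto
    finally show "L2_set (\<lambda>m. \<delta> (c m)) {..<k} \<le> L2_set \<delta> {..<p}"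
      unfolding L2_set_def by (rule real_sqrt_le_mono)
  qed (auto intro: sum_nonneg)
  finally show ?thesis .
qed

lemma sum_split_at:
  fixes f :: "nat \<Rightarrow> real"
  assumes "k \<le> m"
  shows "(\<Sum>i<m. f i) = (\<Sum>i<k. f i) + (\<Sum>i<m - k. f (k + i))"
proof -
  have "(\<Sum>i<k + l. f i) = (\<Sum>i<k. f i) + (\<Sum>i<l. f (k + i))" for l
    by (induction l) (auto simp: add_ac)
  from this[of "m - k"] show ?thesis using assms by simp
qed

lemma bij_concat:
  fixes k m :: nat
  assumes a: "bij_betw a {..<k} S" and b: "bij_betw b {..<m} T" and "S \<inter> T = {}"
  shows "bij_betw (\<lambda>i. if i < k then a i else b (i - k)) {..<k + m} (S \<union> T)"
proof -
  have 1: "bij_betw (\<lambda>i. if i < k then a i else b (i - k)) {..<k} S"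
    using a by (rule bij_betw_cong[THEN iffD1, rotated]) auto
  have "bij_betw (\<lambda>i. i - k) {k..<k + m} {..<m}"
    by (rule bij_betw_byWitness[of _ "\<lambda>i. i + k"]) auto
  from bij_betw_trans[OF this b]
  have 2: "bij_betw (\<lambda>i. if i < k then a i else b (i - k)) {k..<k + m} T"
    by (rule bij_betw_cong[THEN iffD1, rotated]) auto
  have "{..<k + m} = {..<k} \<union> {k..<k + m}" by auto
  then show ?thesis using bij_betw_combine[OF 1 2 assms(3)] by simp
qed

text \<open>Listing \<open>S\<close> first, in the order of \<theta>, makes the norm of \<theta>
  exact and bounds the norm of \<theta> + \<delta> from below. The three copies of the bound are
  three blocks of at most \<open>s\<close> entries of \<delta>: on \<open>S\<close> in the order of
  \<theta>, on \<open>S\<close> in its own order, and the largest entries off \<open>S\<close>,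
  which pay for a shift of weights.\<close>

lemma slope_norm_cone:
  assumes S: "S \<subseteq> {..<p}" "card S \<le> s" and \<theta>: "\<And>j. j < p \<Longrightarrow> j \<notin> S \<Longrightarrow> \<theta> j = 0"
  shows "sn \<theta> - sn (\<lambda>j. \<theta> j + \<delta> j) + sn \<delta> \<le> 3 * (sqrt (\<Sum>m<s. (wt m)\<^sup>2) * L2_set \<delta> {..<p})"
proof -
  let ?C = "{..<p} - S"
  let ?B = "sqrt (\<Sum>m<s. (wt m)\<^sup>2) * L2_set \<delta> {..<p}"
  define k where "k = card S"
  define r where "r = p - k"
  have finS: "finite S" using S finite_subset by auto
  have kp: "k \<le> p" using card_mono[OF _ S(1)] by (simp add: k_def)
  have cC: "card ?C = r" using S finS by (simp add: card_Diff_subset k_def r_def)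
  have kr: "k + r = p" "r + k = p" using kp by (auto simp: r_def)
  have un: "S \<union> ?C = {..<p}" "?C \<union> S = {..<p}" and dj: "S \<inter> ?C = {}" "?C \<inter> S = {}" using S by auto
  obtain a where a: "bij_betw a {..<k} S" "\<And>i j. i \<le> j \<Longrightarrow> j < k \<Longrightarrow> \<bar>\<theta> (a j)\<bar> \<le> \<bar>\<theta> (a i)\<bar>"
    using ex_decreasing_enum[OF finS, of "\<lambda>j. \<bar>\<theta> j\<bar>"] by (auto simp: k_def)
  obtain a' where a': "bij_betw a' {..<k} S" "\<And>i j. i \<le> j \<Longrightarrow> j < k \<Longrightarrow> \<bar>\<delta> (a' j)\<bar> \<le> \<bar>\<delta> (a' i)\<bar>"
    using ex_decreasing_enum[OF finS, of "\<lambda>j. \<bar>\<delta> j\<bar>"] by (auto simp: k_def)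
  obtain b where b: "bij_betw b {..<r} ?C" "\<And>i j. i \<le> j \<Longrightarrow> j < r \<Longrightarrow> \<bar>\<delta> (b j)\<bar> \<le> \<bar>\<delta> (b i)\<bar>"
    using ex_decreasing_enum[of ?C "\<lambda>j. \<bar>\<delta> j\<bar>"] cC by auto
  have aS: "a i \<in> S" "a' i \<in> S" if "i < k" for i using a(1) a'(1) that by (auto simp: bij_betw_def)
  have bC: "b i < p" "b i \<notin> S" if "i < r" for i using b(1) that by (auto simp: bij_betw_def)
  define \<tau> where "\<tau> = (\<lambda>i. if i < k then a i else b (i - k))"
  have tau: "bij_betw \<tau> {..<p} {..<p}"
    using bij_concat[OF a(1) b(1) dj(1)] unfolding \<tau>_def kr un .
  define \<tau>' where "\<tau>' = (\<lambda>i. if i < k then a' i else b (i - k))"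
  have tau': "bij_betw \<tau>' {..<p} {..<p}"
    using bij_concat[OF a'(1) b(1) dj(1)] unfolding \<tau>'_def kr un .
  define \<rho> where "\<rho> = (\<lambda>i. if i < r then b i else a (i - r))"
  have rho: "bij_betw \<rho> {..<p} {..<p}"
    using bij_concat[OF b(1) a(1) dj(2)] unfolding \<rho>_def kr un .
  have th: "sn \<theta> = (\<Sum>m<k. wt m * \<bar>\<theta> (a m)\<bar>)"
  proof -
    have "sn \<theta> = (\<Sum>m<p. wt m * \<bar>\<theta> (\<tau> m)\<bar>)"
      using a(2) \<theta> bC kr by (intro slope_norm_sorted[OF tau]) (auto simp: \<tau>_def)
    also have "\<dots> = (\<Sum>m<k. wt m * \<bar>\<theta> (a m)\<bar>) + (\<Sum>m<r. wt (k + m) * \<bar>\<theta> (b m)\<bar>)"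
      by (simp add: sum_split_at[OF kp] \<tau>_def r_def)
    also have "(\<Sum>m<r. wt (k + m) * \<bar>\<theta> (b m)\<bar>) = 0" using \<theta> bC by (intro sum.neutral) auto
    finally show ?thesis by simp
  qed
  have td: "(\<Sum>m<k. wt m * \<bar>\<theta> (a m)\<bar>) - (\<Sum>m<k. wt m * \<bar>\<delta> (a m)\<bar>) + (\<Sum>m<r. wt (k + m) * \<bar>\<delta> (b m)\<bar>)
      \<le> sn (\<lambda>j. \<theta> j + \<delta> j)"
  proof -
    have "(\<Sum>m<k. wt m * \<bar>\<theta> (a m)\<bar>) - (\<Sum>m<k. wt m * \<bar>\<delta> (a m)\<bar>) \<le> (\<Sum>m<k. wt m * \<bar>\<theta> (a m) + \<delta> (a m)\<bar>)"
      unfolding sum_subtractf[symmetric] right_diff_distrib[symmetric] using kp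
      by (intro sum_mono mult_left_mono wt_nonneg) auto
    moreover have "(\<Sum>m<r. wt (k + m) * \<bar>\<delta> (b m)\<bar>) = (\<Sum>m<r. wt (k + m) * \<bar>\<theta> (b m) + \<delta> (b m)\<bar>)"
      using \<theta> bC by (intro sum.cong) auto
    moreover have "(\<Sum>m<k. wt m * \<bar>\<theta> (a m) + \<delta> (a m)\<bar>) + (\<Sum>m<r. wt (k + m) * \<bar>\<theta> (b m) + \<delta> (b m)\<bar>)
       = (\<Sum>m<p. wt m * \<bar>\<theta> (\<tau> m) + \<delta> (\<tau> m)\<bar>)"
      by (simp add: sum_split_at[OF kp] \<tau>_def r_def)
    moreover have "\<dots> \<le> sn (\<lambda>j. \<theta> j + \<delta> j)" by (rule perm_sum_le_slope_norm[OF tau])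
    ultimately show ?thesis by linarith
  qed
  define dS where "dS = (\<lambda>j. if j \<in> S then \<delta> j else 0)"
  define dC where "dC = (\<lambda>j. if j \<in> S then 0 else \<delta> j)"
  have dS: "sn dS = (\<Sum>m<k. wt m * \<bar>\<delta> (a' m)\<bar>)"
  proof -
    have "sn dS = (\<Sum>m<p. wt m * \<bar>dS (\<tau>' m)\<bar>)"
      using a'(2) bC kr aS by (intro slope_norm_sorted[OF tau']) (auto simp: \<tau>'_def dS_def)
    also have "\<dots> = (\<Sum>m<k. wt m * \<bar>dS (a' m)\<bar>) + (\<Sum>m<r. wt (k + m) * \<bar>dS (b m)\<bar>)"
      by (simp add: sum_split_at[OF kp] \<tau>'_def r_def)
    also have "(\<Sum>m<r. wt (k + m) * \<bar>dS (b m)\<bar>) = 0" using bC by (intro sum.neutral) (auto simp: dS_def)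
    also have "(\<Sum>m<k. wt m * \<bar>dS (a' m)\<bar>) = (\<Sum>m<k. wt m * \<bar>\<delta> (a' m)\<bar>)"
      using aS by (intro sum.cong) (auto simp: dS_def)
    finally show ?thesis by simp
  qed
  have dC: "sn dC = (\<Sum>m<r. wt m * \<bar>\<delta> (b m)\<bar>)"
  proof -
    have "sn dC = (\<Sum>m<p. wt m * \<bar>dC (\<rho> m)\<bar>)"
      using b(2) bC kr aS by (intro slope_norm_sorted[OF rho]) (auto simp: \<rho>_def dC_def)
    also have "\<dots> = (\<Sum>m<r. wt m * \<bar>dC (b m)\<bar>) + (\<Sum>m<p - r. wt (r + m) * \<bar>dC (a m)\<bar>)"
      using kr by (subst sum_split_at[of r p]) (auto simp: \<rho>_def)
    also have "(\<Sum>m<p - r. wt (r + m) * \<bar>dC (a m)\<bar>) = 0"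
      using aS kr by (intro sum.neutral) (auto simp: dC_def)
    also have "(\<Sum>m<r. wt m * \<bar>dC (b m)\<bar>) = (\<Sum>m<r. wt m * \<bar>\<delta> (b m)\<bar>)"
      using bC by (intro sum.cong) (auto simp: dC_def)
    finally show ?thesis by simp
  qed
  have tri: "sn \<delta> \<le> sn dS + sn dC"
  proof -
    have "(\<lambda>j. dS j + dC j) = \<delta>" by (auto simp: dS_def dC_def)
    then show ?thesis using slope_norm_triangle[of dS dC] by simp
  qed
  define k' where "k' = min k r"
  \<comment> \<open>Off \<open>S\<close> the lower bound for the norm of \<theta> + \<delta> starts
    with weight number k, while the norm of \<open>dC\<close> starts with weight 0. As the entries
    decrease along \<open>b\<close>, replacing entry k + m by entry m turns the one into the other
    at the price of the first k terms.\<close>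
  have shift: "(\<Sum>m<r. wt m * \<bar>\<delta> (b m)\<bar>) \<le> (\<Sum>m<k'. wt m * \<bar>\<delta> (b m)\<bar>) + (\<Sum>m<r. wt (k + m) * \<bar>\<delta> (b m)\<bar>)"
  proof (cases "k \<le> r")
    case True
    have "(\<Sum>m<r - k. wt (k + m) * \<bar>\<delta> (b (k + m))\<bar>) \<le> (\<Sum>m<r - k. wt (k + m) * \<bar>\<delta> (b m)\<bar>)"
      using kr by (intro sum_mono mult_left_mono b(2) wt_nonneg) auto
    also have "\<dots> \<le> (\<Sum>m<r. wt (k + m) * \<bar>\<delta> (b m)\<bar>)"
      using kr by (intro sum_mono2 mult_nonneg_nonneg wt_nonneg) auto
    finally show ?thesis using True by (simp add: sum_split_at[OF True] k'_def min_absorb1)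
  next
    case False
    have "0 \<le> (\<Sum>m<r. wt (k + m) * \<bar>\<delta> (b m)\<bar>)"
      using kr by (intro sum_nonneg mult_nonneg_nonneg wt_nonneg) auto
    then show ?thesis using False by (simp add: k'_def)
  qed
  have B1: "(\<Sum>m<k. wt m * \<bar>\<delta> (a m)\<bar>) \<le> ?B"
    using a(1) S by (intro weighted_enum_le) (auto simp: bij_betw_def k_def)
  have B2: "(\<Sum>m<k. wt m * \<bar>\<delta> (a' m)\<bar>) \<le> ?B"
    using a'(1) S by (intro weighted_enum_le) (auto simp: bij_betw_def k_def)
  have B3: "(\<Sum>m<k'. wt m * \<bar>\<delta> (b m)\<bar>) \<le> ?B"
  proof (rule weighted_enum_le)
    show "inj_on b {..<k'}" using b(1) by (auto simp: bij_betw_def k'_def intro: inj_on_subset)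
    show "b ` {..<k'} \<subseteq> {..<p}" using bC by (auto simp: k'_def)
    show "k' \<le> s" using S by (auto simp: k'_def k_def)
  qed
  show ?thesis using th td tri dS dC shift B1 B2 B3 by linarith
qed

text \<open>The logarithms add up to s ln (2 p) - ln (s!), and ln (s!) \<ge> s ln s - s because s^s
  / s! is a single term of the series of exp s.\<close>

lemma sum_wt_sq_le:
  assumes s: "1 \<le> s" "s \<le> p"
  shows "(\<Sum>m<s. (wt m)\<^sup>2) \<le> 2 * sparsity_rate p s / real n"
proof -
  have pw: "real s ^ s \<le> fact s * exp (real s)" by (rule power_le_fact_exp) simp
  have lf: "real s * ln (real s) - real s \<le> ln (fact s)"
  proof -
    have "ln (real s ^ s) \<le> ln (fact s * exp (real s))" using pw s by (subst ln_le_cancel_iff) auto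
    then show ?thesis using s by (simp add: ln_mult ln_realpow)
  qed
  have "(\<Sum>m<s. (wt m)\<^sup>2) = (\<Sum>m<s. ln (2 * real p / real (Suc m)) / real n)"
    using s by (intro sum.cong refl wt_sq) auto
  also have "\<dots> = (\<Sum>m<s. ln (2 * real p) - ln (real (Suc m))) / real n"
    using p by (simp add: sum_divide_distrib ln_div)
  also have "(\<Sum>m<s. ln (2 * real p) - ln (real (Suc m))) = real s * ln (2 * real p) - ln (fact s)"
  proof -
    have "(\<Sum>m<s. ln (real (Suc m))) = ln (fact s)"
      by (induction s) (auto simp: ln_mult)
    then show ?thesis by (simp add: sum_subtractf)
  qed
  also have "\<dots> \<le> 2 * sparsity_rate p s"
  proof -
    have "ln (2::real) \<le> 1" using ln_2_less_1 by simp
    moreover have "0 \<le> ln (real p / real s)" using s by (intro ln_ge_zero) auto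
    then have "ln (real s) \<le> ln (real p)" using s p by (simp add: ln_div)
    moreover have "sparsity_rate p s = real s * (1 + ln (real p) - ln (real s))"
      using s p by (simp add: sparsity_rate_def ln_div ln_mult)
    ultimately have "real s * ln (2 * real p) - ln (fact s) \<le> real s * (1 + ln (real p)) - (real s * ln (real s) - real s)"
      using lf p s by (intro diff_mono mult_left_mono) (auto simp: ln_mult)
    also have "\<dots> = real s * (2 + ln (real p) - ln (real s))" by (simp add: algebra_simps)
    also have "\<dots> \<le> real s * (2 * (1 + ln (real p) - ln (real s)))"
      using \<open>ln (real s) \<le> ln (real p)\<close> by (intro mult_left_mono) auto
    also have "\<dots> = 2 * sparsity_rate p s" using \<open>sparsity_rate p s = _\<close> by simp
    finally show ?thesis .
  qed
  finally show ?thesis by (simp add: divide_right_mono)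
qed

end

section \<open>The restricted eigenvalue inequality\<close>

definition mnorm :: "nat set \<Rightarrow> nat \<Rightarrow> (nat \<Rightarrow> nat \<Rightarrow> real) \<Rightarrow> vec \<Rightarrow> real" where
  "mnorm K p A x = L2_set (\<lambda>k. \<Sum>j<p. A k j * x j) K"

lemma mnorm_nonneg: "0 \<le> mnorm K p A x"
  by (simp add: mnorm_def)

lemma mnorm_triangle: "mnorm K p A (\<lambda>j. x j + y j) \<le> mnorm K p A x + mnorm K p A y"
  unfolding mnorm_def by (rule order_trans[OF _ L2_set_triangle_ineq]) (simp add: distrib_left sum.distrib)

lemma mnorm_scale: "mnorm K p A (\<lambda>j. c * x j) = \<bar>c\<bar> * mnorm K p A x"
proof -
  have "mnorm K p A (\<lambda>j. c * x j) = L2_set (\<lambda>k. c * (\<Sum>j<p. A k j * x j)) K"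
    by (simp add: mnorm_def sum_distrib_left mult_ac)
  also have "\<dots> = L2_set (\<lambda>k. \<bar>c\<bar> * (\<Sum>j<p. A k j * x j)) K"
    by (simp add: L2_set_def power_mult_distrib)
  also have "\<dots> = \<bar>c\<bar> * mnorm K p A x"
    by (simp add: mnorm_def L2_set_right_distrib)
  finally show ?thesis .
qed

lemma mnorm_cong: "(\<And>j. j < p \<Longrightarrow> x j = y j) \<Longrightarrow> mnorm K p A x = mnorm K p A y"
  unfolding mnorm_def by (intro L2_set_cong refl sum.cong) auto

lemma mnorm_sum: "mnorm K p A (\<lambda>j. \<Sum>i<(q::nat). f i j) \<le> (\<Sum>i<q. mnorm K p A (f i))"
proof (induction q)
  case 0
  show ?case by (simp add: mnorm_def L2_set_0')
next
  case (Suc q)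
  then show ?case using mnorm_triangle[of K p A "\<lambda>j. \<Sum>i<q. f i j" "f q"] by simp
qed

text \<open>With the identity matrix, \<open>mnorm_layer_cake\<close> bounds Euclidean norms as
  well.\<close>

lemma mnorm_id: "mnorm {..<p} p (\<lambda>k j. if k = j then 1 else 0) x = L2_set x {..<p}"
  unfolding mnorm_def by (intro L2_set_cong refl) (simp add: if_distrib[of "\<lambda>a. a * _"] sum.delta cong: if_cong)

definition sign_vec :: "nat \<Rightarrow> nat \<Rightarrow> vec \<Rightarrow> bool" where
  "sign_vec p m e \<longleftrightarrow> (\<forall>j<p. e j \<in> {-1, 0, 1}) \<and> card {j. j < p \<and> e j \<noteq> 0} = m"

lemma abel_summation:
  fixes \<zeta> G :: "nat \<Rightarrow> real"
  shows "(\<Sum>m<p. (\<zeta> m - \<zeta> (Suc m)) * G (Suc m)) = (\<Sum>m<p. \<zeta> m * (G (Suc m) - G m)) - \<zeta> p * G p + \<zeta> 0 * G 0"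
  by (induction p) (auto simp: algebra_simps)

text \<open>The vector z is a combination of the sign vectors of its m largest entries, weighted by
  the gaps between consecutive moduli. The triangle inequality bounds the norm by gaps times
  \<open>G\<close>, and Abel summation moves the difference from the moduli to
  \<open>G\<close>.\<close>

lemma mnorm_layer_cake:
  assumes bij: "bij_betw \<pi> {..<p} {..<p}"
    and dec: "\<forall>i j. i \<le> j \<longrightarrow> j < p \<longrightarrow> \<bar>z (\<pi> j)\<bar> \<le> \<bar>z (\<pi> i)\<bar>"
    and G: "\<And>m e. 1 \<le> m \<Longrightarrow> m \<le> p \<Longrightarrow> sign_vec p m e \<Longrightarrow> mnorm K p A e \<le> G m" and G0: "G 0 = 0"
  shows "mnorm K p A z \<le> (\<Sum>m<p. \<bar>z (\<pi> m)\<bar> * (G (Suc m) - G m))"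
proof -
  define sg :: "real \<Rightarrow> real" where "sg a = (if a < 0 then -1 else 1)" for a
  \<comment> \<open>The value 0 at index p makes the gaps telescope to the full modulus and removes
    the boundary term of the Abel summation.\<close>
  define \<zeta> where "\<zeta> m = (if m < p then \<bar>z (\<pi> m)\<bar> else 0)" for m
  define e where "e m j = (if j \<in> \<pi> ` {..<m} then sg (z j) else 0)" for m j
  have inj: "inj_on \<pi> {..<p}" using bij by (simp add: bij_betw_def)
  have lt: "\<pi> i < p" if "i < p" for i using bij that by (auto simp: bij_betw_def)
  have z: "z j = (\<Sum>m<p. (\<zeta> m - \<zeta> (Suc m)) * e (Suc m) j)" if "j < p" for j
  proof -
    have "j \<in> \<pi> ` {..<p}" using bij that by (simp add: bij_betw_def)
    then obtain i where i: "j = \<pi> i" "i < p" by auto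
    have mem: "j \<in> \<pi> ` {..<Suc m} \<longleftrightarrow> i \<le> m" if "m < p" for m
    proof
      assume "j \<in> \<pi> ` {..<Suc m}"
      then obtain x where x: "j = \<pi> x" "x < Suc m" by auto
      have "\<pi> x = \<pi> i" using i(1) x(1) by metis
      moreover have "x < p" using x(2) that by linarith
      ultimately have "x = i" using inj_onD[OF inj, of x i] i(2) by blast
      then show "i \<le> m" using x(2) by linarith
    next
      assume "i \<le> m"
      then show "j \<in> \<pi> ` {..<Suc m}" unfolding i(1) by (intro imageI) simp
    qed
    have "(\<Sum>m<p. (\<zeta> m - \<zeta> (Suc m)) * e (Suc m) j) = (\<Sum>m<p. if i \<le> m then (\<zeta> m - \<zeta> (Suc m)) * sg (z j) else 0)"
      by (intro sum.cong refl) (use mem in \<open>auto simp: e_def\<close>)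
    also have "\<dots> = (\<Sum>m\<in>{i..<p}. (\<zeta> m - \<zeta> (Suc m)) * sg (z j))"
      by (rule sum.mono_neutral_cong_right) auto
    also have "\<dots> = (\<zeta> i - \<zeta> p) * sg (z j)"
      unfolding sum_distrib_right[symmetric] using sum_Suc_diff'[of i p "\<lambda>m. - \<zeta> m"] i by simp
    also have "\<dots> = z j" using i by (simp add: \<zeta>_def sg_def)
    finally show ?thesis by simp
  qed
  have sv: "sign_vec p (Suc m) (e (Suc m))" if "m < p" for m
  proof -
    have "{j. j < p \<and> e (Suc m) j \<noteq> 0} = \<pi> ` {..<Suc m}"
      using lt that by (auto simp: e_def sg_def)
    moreover have "card (\<pi> ` {..<Suc m}) = Suc m"
      using inj_on_subset[OF inj, of "{..<Suc m}"] that by (subst card_image) auto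
    ultimately show ?thesis by (auto simp: sign_vec_def e_def sg_def)
  qed
  have zmono: "0 \<le> \<zeta> m - \<zeta> (Suc m)" if "m < p" for m using dec that by (auto simp: \<zeta>_def)
  have "mnorm K p A z = mnorm K p A (\<lambda>j. \<Sum>m<p. (\<zeta> m - \<zeta> (Suc m)) * e (Suc m) j)"
    by (rule mnorm_cong) (rule z)
  also have "\<dots> \<le> (\<Sum>m<p. mnorm K p A (\<lambda>j. (\<zeta> m - \<zeta> (Suc m)) * e (Suc m) j))"
    by (rule mnorm_sum)
  also have "\<dots> = (\<Sum>m<p. (\<zeta> m - \<zeta> (Suc m)) * mnorm K p A (e (Suc m)))"
    using zmono by (intro sum.cong refl) (simp add: mnorm_scale)
  also have "\<dots> \<le> (\<Sum>m<p. (\<zeta> m - \<zeta> (Suc m)) * G (Suc m))"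
    using zmono sv by (intro sum_mono mult_left_mono G) auto
  also have "\<dots> = (\<Sum>m<p. \<zeta> m * (G (Suc m) - G m))"
    unfolding abel_summation G0 by (simp add: \<zeta>_def)
  also have "\<dots> = (\<Sum>m<p. \<bar>z (\<pi> m)\<bar> * (G (Suc m) - G m))"
    by (intro sum.cong) (auto simp: \<zeta>_def)
  finally show ?thesis .
qed

lemma sqrt_Suc_diff: "sqrt (real (Suc m)) - sqrt (real m) \<le> 1 / sqrt (real (Suc m))"
proof -
  have "sqrt (real (Suc m)) * sqrt (real m) \<ge> sqrt (real m) * sqrt (real m)"
    by (intro mult_right_mono real_sqrt_le_mono) auto
  then have "sqrt (real (Suc m)) * (sqrt (real (Suc m)) - sqrt (real m)) \<le> 1"
    by (simp add: right_diff_distrib)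
  then show ?thesis by (simp add: field_simps)
qed

lemma sum_inverse_sqrt_le: "(\<Sum>m<k. 1 / sqrt (real (Suc m))) \<le> 2 * sqrt (real k)"
proof (induction k)
  case (Suc k)
  have "1 \<le> sqrt (real (Suc k)) * (2 * (sqrt (real (Suc k)) - sqrt (real k)))"
  proof -
    have "0 \<le> (sqrt (real (Suc k)) - sqrt (real k))\<^sup>2" by simp
    then show ?thesis by (simp add: power2_diff algebra_simps)
  qed
  then have "1 / sqrt (real (Suc k)) \<le> 2 * (sqrt (real (Suc k)) - sqrt (real k))"
    by (simp add: field_simps)
  then show ?case using Suc by simp
qed simp

text \<open>The inequality ln t \<le> t - 1 at t = j / i replaces a derivative. The extreme cases i
  = 1 and j = p bound the sparsity rate from below by ln (e p) and from above by p.\<close>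

lemma log_ratio_mono:
  assumes "1 \<le> i" "i \<le> j" "j \<le> p"
  shows "real i * ln (exp 1 * real p / real i) \<le> real j * ln (exp 1 * real p / real j)"
proof -
  have e: "ln (exp 1 * real p / real k) = 1 + ln (real p / real k)" if "1 \<le> k" "k \<le> p" for k
    using that by (simp add: ln_div ln_mult)
  have pos: "0 < i" "0 < j" "0 < p" using assms by auto
  have "ln (real j / real i) \<le> real j / real i - 1" using pos by (intro ln_le_minus_one) auto
  then have "real i * ln (real j / real i) \<le> real i * (real j / real i - 1)" by (rule mult_left_mono) simp
  also have "\<dots> = real j - real i" using pos by (simp add: field_simps)
  finally have 1: "real i * ln (real j / real i) \<le> real j - real i" .
  have 2: "ln (real p / real i) = ln (real p / real j) + ln (real j / real i)"
    using pos by (simp add: ln_div)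
  have "0 \<le> (real j - real i) * ln (real p / real j)"
    using assms by (intro mult_nonneg_nonneg ln_ge_zero) auto
  with 1 have "real i * (1 + ln (real p / real i)) \<le> real j * (1 + ln (real p / real j))"
    by (simp only: 2) (simp add: algebra_simps)
  then show ?thesis
    unfolding e[OF assms(1) order_trans[OF assms(2,3)]] e[OF order_trans[OF assms(1,2)] assms(3)] .
qed

text \<open>The level \<open>m0\<close> separates two regimes for the remainder of the rounding. Its
  \<open>m0\<close> largest entries are controlled by the mesh of the grid; from there on,
  \<open>large\<close> makes the slope weights dominate 1 / sqrt m, so that the slope norm takes
  over.\<close>

lemma restricted_eigenvalue:
  fixes A \<kappa> :: real and X :: "nat \<Rightarrow> nat \<Rightarrow> real"
  assumes n: "0 < n" and p: "0 < p" and A: "0 \<le> A" and \<kappa>: "0 < \<kappa>"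
    and m0: "1 \<le> m0"
    and large: "\<And>m. m0 < m \<Longrightarrow> m \<le> p \<Longrightarrow> \<kappa> * real n \<le> real m * ln (exp 1 * real p / real m)"
    and E1: "\<And>m e. 1 \<le> m \<Longrightarrow> m \<le> p \<Longrightarrow> sign_vec p m e \<Longrightarrow>
       mnorm K p X e \<le> A * (sqrt (real m * real n) + real m * sqrt (ln (exp 1 * real p / real m)))"
    and E2: "\<And>w :: nat \<Rightarrow> int. (\<Sum>j<p. (real_of_int (w j))\<^sup>2) \<le> real m0 * (8 * (1 + A))\<^sup>2 \<Longrightarrow>
       sqrt (real n / 2) * L2_set (\<lambda>j. real_of_int (w j)) {..<p} \<le> mnorm K p X (\<lambda>j. real_of_int (w j))"
  shows "L2_set \<delta> {..<p} / 4 - ((1 + A) * sqrt (2 / \<kappa>) + 2 * A) * slope_norm 1 n p \<delta> \<le> mnorm K p X \<delta> / sqrt (real n)"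
proof (cases "L2_set \<delta> {..<p} = 0")
  case True
  have "0 \<le> ((1 + A) * sqrt (2 / \<kappa>) + 2 * A) * slope_norm 1 n p \<delta>"
    using slope_norm_nonneg[OF n p] A \<kappa> by (intro mult_nonneg_nonneg) auto
  moreover have "0 \<le> mnorm K p X \<delta> / sqrt (real n)" by (simp add: mnorm_nonneg)
  ultimately show ?thesis using True by linarith
next
  case False
  let ?d = "L2_set \<delta> {..<p}"
  let ?l = "\<lambda>m. ln (exp 1 * real p / real (Suc m))"
  let ?w = "wt n p"
  let ?sn = "slope_norm 1 n p"
  have d: "0 < ?d" using False L2_set_nonneg[of \<delta> "{..<p}"] by linarith
  \<comment> \<open>Chosen so that (1 + A) * 2 \<epsilon> d = d / 4: the rounding error costs half
    of the d / 2 that \<open>E2\<close> leaves.\<close>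
  define \<epsilon> where "\<epsilon> = 1 / (8 * (1 + A))"
  have eps: "0 < \<epsilon>" using A by (simp add: \<epsilon>_def)
  \<comment> \<open>The mesh at which \<open>m0\<close> entries of size h have Euclidean norm
    \<epsilon> d. In units of h the squared norm of \<delta> is \<open>m0\<close> / \<epsilon>^2,
    the radius allowed in \<open>E2\<close>.\<close>
  define h where "h = \<epsilon> * ?d / sqrt (real m0)"
  have h: "0 < h" using eps d m0 by (simp add: h_def)
  \<comment> \<open>Rounding is towards zero, so that neither the rounded part nor the remainder
    exceeds \<delta> in any entry; the slope norm of the remainder is then at most that of
    \<delta>.\<close>
  define w :: "nat \<Rightarrow> int" where "w j = (if 0 \<le> \<delta> j then \<lfloor>\<delta> j / h\<rfloor> else - \<lfloor>- \<delta> j / h\<rfloor>)" for j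
  define y where "y j = h * real_of_int (w j)" for j
  define z where "z j = \<delta> j - y j" for j
  have fl: "0 \<le> h * real_of_int \<lfloor>a / h\<rfloor> \<and> h * real_of_int \<lfloor>a / h\<rfloor> \<le> a \<and> a - h \<le> h * real_of_int \<lfloor>a / h\<rfloor>"
    if "0 \<le> a" for a
  proof -
    have 1: "real_of_int \<lfloor>a / h\<rfloor> \<le> a / h" "a / h \<le> real_of_int \<lfloor>a / h\<rfloor> + 1" "0 \<le> real_of_int \<lfloor>a / h\<rfloor>"
      using that h by (auto simp: of_int_floor_le less_imp_le)
    have "h * (a / h) = a" using h by simp
    then show ?thesis
      using mult_left_mono[OF 1(1) less_imp_le[OF h]] mult_left_mono[OF 1(2) less_imp_le[OF h]]
        mult_nonneg_nonneg[OF less_imp_le[OF h] 1(3)]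
      by (simp only: distrib_left mult_1_right simp_thms)
  qed
  have yz: "\<bar>y j\<bar> \<le> \<bar>\<delta> j\<bar> \<and> \<bar>z j\<bar> \<le> h \<and> \<bar>z j\<bar> \<le> \<bar>\<delta> j\<bar>" for j
  proof (cases "0 \<le> \<delta> j")
    case True
    then have "y j = h * real_of_int \<lfloor>\<delta> j / h\<rfloor>" by (simp add: y_def w_def)
    with fl[OF True] have "0 \<le> y j" "y j \<le> \<delta> j" "\<delta> j - h \<le> y j" by simp_all
    then show ?thesis using True unfolding z_def by linarith
  next
    case False
    then have y: "y j = - (h * real_of_int \<lfloor>- \<delta> j / h\<rfloor>)" by (simp add: y_def w_def)
    have "0 \<le> - y j" "- y j \<le> - \<delta> j" "- \<delta> j - h \<le> - y j"
      using fl[of "- \<delta> j"] False unfolding y by simp_all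
    then show ?thesis using False unfolding z_def by linarith
  qed
  have dec: "\<delta> = (\<lambda>j. y j + z j)" by (auto simp: z_def)
  have wy: "(\<Sum>j<p. (real_of_int (w j))\<^sup>2) \<le> real m0 * (8 * (1 + A))\<^sup>2"
  proof -
    have "h\<^sup>2 * (\<Sum>j<p. (real_of_int (w j))\<^sup>2) = (\<Sum>j<p. (y j)\<^sup>2)"
      by (simp add: y_def power_mult_distrib sum_distrib_left)
    also have "\<dots> \<le> (\<Sum>j<p. (\<delta> j)\<^sup>2)" using yz by (intro sum_mono abs_le_square_iff[THEN iffD1]) blast
    also have "\<dots> = ?d\<^sup>2" by (simp add: L2_set_def sum_nonneg)
    also have "\<dots> = h\<^sup>2 * (real m0 * (8 * (1 + A))\<^sup>2)"
      using A m0 by (simp add: h_def \<epsilon>_def power_divide power_mult_distrib)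
    finally show ?thesis using h by simp
  qed
  have Xy: "sqrt (real n / 2) * L2_set y {..<p} \<le> mnorm K p X y"
  proof -
    have 1: "L2_set y {..<p} = h * L2_set (\<lambda>j. real_of_int (w j)) {..<p}"
      using h by (simp add: y_def[abs_def] L2_set_right_distrib)
    have 2: "mnorm K p X y = h * mnorm K p X (\<lambda>j. real_of_int (w j))"
      using h mnorm_scale[of K p X h "\<lambda>j. real_of_int (w j)"] by (simp add: y_def[abs_def])
    show ?thesis using mult_left_mono[OF E2[OF wy], of h] h unfolding 1 2 by (simp add: mult_ac)
  qed
  obtain \<pi> where pi: "bij_betw \<pi> {..<p} {..<p}"
    "\<forall>i j. i \<le> j \<longrightarrow> j < p \<longrightarrow> \<bar>z (\<pi> j)\<bar> \<le> \<bar>z (\<pi> i)\<bar>"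
    "?sn z = (\<Sum>m<p. ?w m * \<bar>z (\<pi> m)\<bar>)"
    by (rule slope_norm_enum[OF n p, of z])
  \<comment> \<open>The Lorentz (2,1) norm of z. The layer-cake bound controls by it both the
    Euclidean norm of z and the sqrt n part of the norm of X z.\<close>
  define T where "T = (\<Sum>m<p. \<bar>z (\<pi> m)\<bar> * (1 / sqrt (real (Suc m))))"
  \<comment> \<open>The hypotheses have e under the logarithm, the slope weights have 2. Since 2 ln
    2 \<ge> 1, the change costs a factor 2.\<close>
  have lw: "?l m \<le> 2 * real n * (?w m)\<^sup>2" if "m < p" for m
  proof -
    have "1 \<le> 2 * ln (2::real)"
    proof -
      have "ln (exp 1) \<le> ln (4::real)" using exp_le by (subst ln_le_cancel_iff) auto
      also have "(4::real) = 2 ^ 2" by simp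
      also have "ln \<dots> = 2 * ln (2::real)" by (subst ln_realpow) auto
      finally show ?thesis by simp
    qed
    moreover have "0 \<le> ln (real p / real (Suc m))" using that by (intro ln_ge_zero) auto
    ultimately have "1 + ln (real p / real (Suc m)) \<le> 2 * (ln 2 + ln (real p / real (Suc m)))" by simp
    moreover have "?l m = 1 + ln (real p / real (Suc m))"
      using p by (simp add: ln_div ln_mult)
    moreover have "ln (2 * real p / real (Suc m)) = ln 2 + ln (real p / real (Suc m))"
      using p by (simp add: ln_div ln_mult)
    ultimately show ?thesis using n by (simp only: wt_sq[OF n p that]) simp
  qed
  have lw': "sqrt (?l m) \<le> 2 * sqrt (real n) * ?w m" if "m < p" for m
  proof -
    have "sqrt (?l m) \<le> sqrt (2 * real n * (?w m)\<^sup>2)" using lw[OF that] by (rule real_sqrt_le_mono)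
    also have "\<dots> = sqrt 2 * sqrt (real n) * ?w m"
      using wt_nonneg[OF n p, of m] that by (simp add: real_sqrt_mult)
    also have "\<dots> \<le> 2 * sqrt (real n) * ?w m"
      using wt_nonneg[OF n p, of m] that less_imp_le[OF sqrt2_less_2] by (intro mult_right_mono) auto
    finally show ?thesis .
  qed
  \<comment> \<open>For m < \<open>m0\<close> each entry is at most h, and the inverse square roots
    add up to at most 2 sqrt \<open>m0\<close>. For larger m, \<open>large\<close> at m + 1 gives 1
    / sqrt (m + 1) \<le> sqrt (2 / \<kappa>) * \<open>wt m\<close>.\<close>
  have T: "T \<le> 2 * \<epsilon> * ?d + sqrt (2 / \<kappa>) * ?sn \<delta>"
  proof -
    have "\<bar>z (\<pi> m)\<bar> * (1 / sqrt (real (Suc m)))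
      \<le> (if m < m0 then h * (1 / sqrt (real (Suc m))) else 0) + sqrt (2 / \<kappa>) * (?w m * \<bar>z (\<pi> m)\<bar>)" if m: "m < p" for m
    proof (cases "m < m0")
      case True
      have "\<bar>z (\<pi> m)\<bar> * (1 / sqrt (real (Suc m))) \<le> h * (1 / sqrt (real (Suc m)))"
        using yz by (intro mult_right_mono) auto
      moreover have "0 \<le> sqrt (2 / \<kappa>) * (?w m * \<bar>z (\<pi> m)\<bar>)"
        using wt_nonneg[OF n p, of m] m \<kappa> by simp
      ultimately show ?thesis using True by simp
    next
      case False
      have "\<kappa> * real n \<le> real (Suc m) * ?l m" using large[of "Suc m"] False m by simp
      also have "\<dots> \<le> real (Suc m) * (2 * real n * (?w m)\<^sup>2)" by (intro mult_left_mono lw m) simp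
      finally have "real n * \<kappa> \<le> real n * (real (Suc m) * (2 * (?w m)\<^sup>2))" by (simp add: algebra_simps)
      then have "\<kappa> \<le> real (Suc m) * (2 * (?w m)\<^sup>2)" using n by simp
      then have "1 / real (Suc m) \<le> 2 / \<kappa> * (?w m)\<^sup>2" using \<kappa> by (simp add: field_simps)
      then have "sqrt (1 / real (Suc m)) \<le> sqrt (2 / \<kappa> * (?w m)\<^sup>2)" by (rule real_sqrt_le_mono)
      then have "1 / sqrt (real (Suc m)) \<le> sqrt (2 / \<kappa>) * ?w m"
        using wt_nonneg[OF n p, of m] m by (simp only: real_sqrt_mult real_sqrt_divide[of 1]) simp
      then have "\<bar>z (\<pi> m)\<bar> * (1 / sqrt (real (Suc m))) \<le> \<bar>z (\<pi> m)\<bar> * (sqrt (2 / \<kappa>) * ?w m)"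
        by (rule mult_left_mono) simp
      then show ?thesis using False by (simp add: mult_ac)
    qed
    then have "T \<le> (\<Sum>m<p. (if m < m0 then h * (1 / sqrt (real (Suc m))) else 0) + sqrt (2 / \<kappa>) * (?w m * \<bar>z (\<pi> m)\<bar>))"
      unfolding T_def by (intro sum_mono) auto
    also have "\<dots> = (\<Sum>m<p. if m < m0 then h * (1 / sqrt (real (Suc m))) else 0) + sqrt (2 / \<kappa>) * ?sn z"
      by (simp add: sum.distrib pi(3) sum_distrib_left)
    also have "(\<Sum>m<p. if m < m0 then h * (1 / sqrt (real (Suc m))) else 0) = (\<Sum>m\<in>{..<p} \<inter> {..<m0}. h * (1 / sqrt (real (Suc m))))"
      by (rule sum.mono_neutral_cong_right) auto
    also have "\<dots> \<le> (\<Sum>m<m0. h * (1 / sqrt (real (Suc m))))" using h by (intro sum_mono2) auto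
    also have "\<dots> \<le> h * (2 * sqrt (real m0))"
      unfolding sum_distrib_left[symmetric] using h sum_inverse_sqrt_le by (intro mult_left_mono) auto
    also have "h * (2 * sqrt (real m0)) = 2 * \<epsilon> * ?d" using m0 by (simp add: h_def)
    also have "?sn z \<le> ?sn \<delta>" using yz by (intro slope_norm_mono[OF n p]) auto
    finally show ?thesis using \<kappa> by (simp add: mult_left_mono)
  qed
  have z2: "L2_set z {..<p} \<le> T"
  proof -
    have sv: "L2_set e {..<p} = sqrt (real m)" if "sign_vec p m e" for e m
    proof -
      have "(\<Sum>j<p. (e j)\<^sup>2) = (\<Sum>j<p. if e j \<noteq> 0 then 1 else 0)"
        using that by (intro sum.cong) (auto simp: sign_vec_def)
      also have "\<dots> = real (card {j. j < p \<and> e j \<noteq> 0})"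
        by (simp add: sum.If_cases Int_def)
      finally show ?thesis using that by (simp add: L2_set_def sign_vec_def)
    qed
    have "mnorm {..<p} p (\<lambda>k j. if k = j then 1 else 0) z
        \<le> (\<Sum>m<p. \<bar>z (\<pi> m)\<bar> * (sqrt (real (Suc m)) - sqrt (real m)))"
      by (rule mnorm_layer_cake[OF pi(1,2), where G = "\<lambda>m. sqrt (real m)"]) (auto simp: mnorm_id sv)
    also have "\<dots> \<le> T"
      unfolding T_def by (intro sum_mono mult_left_mono sqrt_Suc_diff) auto
    finally show ?thesis by (simp add: mnorm_id)
  qed
  have Xz: "mnorm K p X z \<le> A * (sqrt (real n) * T + 2 * sqrt (real n) * ?sn \<delta>)"
  proof -
    \<comment> \<open>At m = 0 the logarithm takes a default value, but the factor
      \<open>real m\<close> annihilates it, so \<open>?G 0 = 0\<close> as the layer cake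
      requires.\<close>
    let ?G = "\<lambda>m. A * (sqrt (real m * real n) + real m * sqrt (ln (exp 1 * real p / real m)))"
    have "mnorm K p X z \<le> (\<Sum>m<p. \<bar>z (\<pi> m)\<bar> * (?G (Suc m) - ?G m))"
      by (rule mnorm_layer_cake[OF pi(1,2) E1]) auto
    also have "\<dots> \<le> (\<Sum>m<p. \<bar>z (\<pi> m)\<bar> * (A * (sqrt (real n) * (1 / sqrt (real (Suc m))) + 2 * sqrt (real n) * ?w m)))"
    proof (intro sum_mono mult_left_mono)
      fix m assume "m \<in> {..<p}"
      then have m: "m < p" by simp
      \<comment> \<open>The logarithm decreases in m, so going from m to m + 1 increases m sqrt (ln
        (e p / m)) by no more than the square root at the new level.\<close>
      have "real m * sqrt (?l m) \<le> real m * sqrt (ln (exp 1 * real p / real m))"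
        using p by (cases "m = 0") (auto intro!: mult_left_mono real_sqrt_le_mono divide_left_mono)
      then have "real (Suc m) * sqrt (?l m) - real m * sqrt (ln (exp 1 * real p / real m)) \<le> sqrt (?l m)"
        by (simp add: algebra_simps)
      also have "\<dots> \<le> 2 * sqrt (real n) * ?w m" by (rule lw'[OF m])
      finally have 1: "real (Suc m) * sqrt (?l m) - real m * sqrt (ln (exp 1 * real p / real m)) \<le> 2 * sqrt (real n) * ?w m" .
      have "sqrt (real n) * (sqrt (real (Suc m)) - sqrt (real m)) \<le> sqrt (real n) * (1 / sqrt (real (Suc m)))"
        by (intro mult_left_mono sqrt_Suc_diff) simp
      then have 2: "sqrt (real (Suc m) * real n) - sqrt (real m * real n) \<le> sqrt (real n) * (1 / sqrt (real (Suc m)))"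
        by (simp only: real_sqrt_mult right_diff_distrib mult.commute)
      have "?G (Suc m) - ?G m = A * ((sqrt (real (Suc m) * real n) - sqrt (real m * real n))
          + (real (Suc m) * sqrt (?l m) - real m * sqrt (ln (exp 1 * real p / real m))))"
        by (simp add: algebra_simps)
      also have "\<dots> \<le> A * (sqrt (real n) * (1 / sqrt (real (Suc m))) + 2 * sqrt (real n) * ?w m)"
        by (intro mult_left_mono add_mono 1 2 A)
      finally show "?G (Suc m) - ?G m \<le> A * (sqrt (real n) * (1 / sqrt (real (Suc m))) + 2 * sqrt (real n) * ?w m)" .
    qed simp
    also have "\<dots> = A * (sqrt (real n) * T + 2 * sqrt (real n) * ?sn z)"
      unfolding T_def pi(3) sum_distrib_left sum.distrib[symmetric]
      by (intro sum.cong refl) (simp add: algebra_simps)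
    also have "\<dots> \<le> A * (sqrt (real n) * T + 2 * sqrt (real n) * ?sn \<delta>)"
      using yz by (intro mult_left_mono add_mono slope_norm_mono[OF n p] A) auto
    finally show ?thesis .
  qed
  have "mnorm K p X y \<le> mnorm K p X \<delta> + mnorm K p X z"
  proof -
    have "mnorm K p X y = mnorm K p X (\<lambda>j. \<delta> j + (-1) * z j)" by (rule mnorm_cong) (simp add: z_def)
    also have "\<dots> \<le> mnorm K p X \<delta> + mnorm K p X z"
      using mnorm_triangle[of K p X \<delta> "\<lambda>j. (-1) * z j"] mnorm_scale[of K p X "-1" z] by simp
    finally show ?thesis .
  qed
  moreover have "?d \<le> L2_set y {..<p} + L2_set z {..<p}"
    by (subst dec) (rule L2_set_triangle_ineq)
  then have "sqrt (real n) * (?d / 2 - T) \<le> sqrt (real n / 2) * L2_set y {..<p}"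
  proof -
    have s2: "1 / 2 \<le> sqrt (1 / 2)" by (rule real_le_rsqrt) (simp add: power2_eq_square)
    have s2': "sqrt (1 / 2) \<le> 1" by simp
    have "?d / 2 - T \<le> sqrt (1 / 2) * (?d - L2_set z {..<p})"
    proof -
      have "1 / 2 * ?d \<le> sqrt (1 / 2) * ?d" using s2 by (intro mult_right_mono) auto
      moreover have "sqrt (1 / 2) * L2_set z {..<p} \<le> 1 * L2_set z {..<p}" using s2' by (intro mult_right_mono) auto
      ultimately show ?thesis using z2 by (simp add: right_diff_distrib)
    qed
    also have "\<dots> \<le> sqrt (1 / 2) * L2_set y {..<p}"
      using \<open>?d \<le> _\<close> by (intro mult_left_mono) auto
    finally have "sqrt (real n) * (?d / 2 - T) \<le> sqrt (real n) * (sqrt (1 / 2) * L2_set y {..<p})"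
      by (rule mult_left_mono) simp
    also have "\<dots> = sqrt (real n / 2) * L2_set y {..<p}"
      by (simp add: real_sqrt_divide)
    finally show ?thesis .
  qed
  ultimately have "sqrt (real n) * (?d / 2 - T) \<le> mnorm K p X \<delta> + A * (sqrt (real n) * T + 2 * sqrt (real n) * ?sn \<delta>)"
    using Xy Xz by linarith
  then have "sqrt (real n) * (?d / 2 - T - A * T - 2 * A * ?sn \<delta>) \<le> mnorm K p X \<delta>"
    by (simp add: algebra_simps)
  then have "?d / 2 - T - A * T - 2 * A * ?sn \<delta> \<le> mnorm K p X \<delta> / sqrt (real n)"
    using n by (simp add: field_simps)
  moreover have "(1 + A) * T \<le> (1 + A) * (2 * \<epsilon> * ?d + sqrt (2 / \<kappa>) * ?sn \<delta>)"
    using A by (intro mult_left_mono T) auto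
  moreover have "(1 + A) * (2 * \<epsilon> * ?d) = ?d / 4"
    using A by (simp add: \<epsilon>_def field_simps)
  ultimately show ?thesis by (simp add: algebra_simps)
qed

text \<open>No control of the noise correlation is needed: the restricted eigenvalue inequality holds for
  every vector, and the slope penalty absorbs its error term.\<close>
lemma slope_pilot_bound:
  fixes b r0 :: real
  assumes n: "0 < n" and p: "0 < p" and s: "1 \<le> s" "s \<le> p" and b: "0 < b"
    and RE: "L2_set (\<lambda>j. t j - \<theta> j) {..<p} / 4 - b * slope_norm 1 n p (\<lambda>j. t j - \<theta> j)
        \<le> mnorm I p X (\<lambda>j. t j - \<theta> j) / sqrt (real n)"
    and \<theta>: "card {j \<in> {..<p}. \<theta> j \<noteq> 0} \<le> s"
    and small: "48 * b * sqrt (sparsity_rate p s / (2 * real n)) \<le> 1"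
    and cI: "card I = n"
    and Y: "\<And>k. k \<in> I \<Longrightarrow> snd d k = (\<Sum>j<p. fst d (k, j) * \<theta> j) + \<eta> k"
    and X: "\<And>k j. k \<in> I \<Longrightarrow> j < p \<Longrightarrow> fst d (k, j) = X k j"
    and opt: "srs_objective b I p d t \<le> srs_objective b I p d \<theta>"
  shows "L2_set (\<lambda>j. t j - \<theta> j) {..<p} \<le> 16 * (L2_set \<eta> I / sqrt (real n))"
proof -
  define \<delta> where "\<delta> = (\<lambda>j. t j - \<theta> j)"
  let ?sn = "slope_norm 1 n p"
  let ?r0 = "L2_set \<eta> I / sqrt (real n)"
  let ?d = "L2_set \<delta> {..<p}"
  have sn: "0 < sqrt (real n)" using n by simp
  have o1: "srs_objective b I p d \<theta> = ?r0 + b * ?sn \<theta>"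
  proof -
    have "L2_set (resid p d \<theta>) I = L2_set \<eta> I"
      using Y by (intro L2_set_cong refl) (auto simp: resid_def)
    then show ?thesis
      unfolding srs_objective_def norm2_eq_L2_set cI slope_norm_scale[OF n p, of b \<theta>] by simp
  qed
  have o2: "mnorm I p X \<delta> / sqrt (real n) - ?r0 + b * ?sn (\<lambda>j. \<theta> j + \<delta> j) \<le> srs_objective b I p d t"
  proof -
    have "mnorm I p X \<delta> = L2_set (\<lambda>k. - resid p d t k + \<eta> k) I"
      unfolding mnorm_def
    proof (intro L2_set_cong refl)
      fix k assume k: "k \<in> I"
      show "(\<Sum>j<p. X k j * \<delta> j) = - resid p d t k + \<eta> k"
        using k X[OF k] by (simp add: resid_def Y \<delta>_def right_diff_distrib sum_subtractf)
    qed
    also have "\<dots> \<le> L2_set (\<lambda>k. - resid p d t k) I + L2_set \<eta> I" by (rule L2_set_triangle_ineq)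
    also have "L2_set (\<lambda>k. - resid p d t k) I = norm2 I (resid p d t)" by (simp add: norm2_def L2_set_def)
    finally have "(mnorm I p X \<delta> - L2_set \<eta> I) / sqrt (real n) \<le> norm2 I (resid p d t) / sqrt (real n)"
      by (intro divide_right_mono) auto
    moreover have "(\<lambda>j. \<theta> j + \<delta> j) = t" by (simp add: \<delta>_def)
    ultimately show ?thesis
      unfolding srs_objective_def cI slope_norm_scale[OF n p, of b t] by (simp add: diff_divide_distrib)
  qed
  have cone: "?sn \<theta> - ?sn (\<lambda>j. \<theta> j + \<delta> j) + ?sn \<delta> \<le> 3 * (sqrt (\<Sum>m<s. (wt n p m)\<^sup>2) * ?d)"
    by (rule slope_norm_cone[OF n p _ \<theta>]) auto
  have q: "sqrt (\<Sum>m<s. (wt n p m)\<^sup>2) \<le> 2 * sqrt (sparsity_rate p s / (2 * real n))"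
  proof -
    have "sqrt (\<Sum>m<s. (wt n p m)\<^sup>2) \<le> sqrt (2 * sparsity_rate p s / real n)"
      by (rule real_sqrt_le_mono[OF sum_wt_sq_le[OF n p s]])
    also have "2 * sparsity_rate p s / real n = 4 * (sparsity_rate p s / (2 * real n))" by simp
    also have "sqrt \<dots> = 2 * sqrt (sparsity_rate p s / (2 * real n))" by (subst real_sqrt_mult) simp
    finally show ?thesis .
  qed
  \<comment> \<open>The 48 of \<open>small\<close> is 3 * 2 * 8: the cone inequality, the bound on
    the weights, and the wish to spend only d / 8 of the d / 4 in the restricted eigenvalue
    inequality.\<close>
  have "b * (?sn \<theta> - ?sn (\<lambda>j. \<theta> j + \<delta> j) + ?sn \<delta>) \<le> b * (3 * (2 * sqrt (sparsity_rate p s / (2 * real n)) * ?d))"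
    using b q by (intro mult_left_mono order_trans[OF cone] mult_right_mono) auto
  also have "\<dots> = (48 * b * sqrt (sparsity_rate p s / (2 * real n))) * (?d / 8)" by simp
  also have "\<dots> \<le> 1 * (?d / 8)" by (intro mult_right_mono small) simp
  finally have "b * ?sn \<theta> - b * ?sn (\<lambda>j. \<theta> j + \<delta> j) + b * ?sn \<delta> \<le> ?d / 8" by (simp add: algebra_simps)
  moreover have "?d / 4 - b * ?sn \<delta> \<le> mnorm I p X \<delta> / sqrt (real n)" using RE by (simp add: \<delta>_def)
  \<comment> \<open>The noise norm enters twice, through the objective at \<theta> and through the
    triangle inequality for the residual. The terms b \<open>?sn\<close> \<delta> of the cone bound
    and of \<open>RE\<close> cancel, as the two coefficients agree.\<close>
  ultimately have "?d / 8 \<le> 2 * ?r0" using o1 o2 opt by linarith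
  then show ?thesis by (simp add: \<delta>_def)
qed

section \<open>Counting integer vectors\<close>

text \<open>As z^2 \<ge> \<bar>z\<bar>, the terms with z \<noteq> 0 are dominated by a geometric
  series of ratio exp (- t) \<le> 1 / 2, taken twice for the two signs. The induction carries the
  exact partial geometric sum.\<close>

lemma theta_sum_le:
  fixes t :: real
  assumes t: "1 \<le> t"
  shows "(\<Sum>z\<in>{- int N..int N}. exp (- t * (real_of_int z)\<^sup>2)) \<le> 1 + 4 * exp (- t)"
proof -
  have "(\<Sum>z\<in>{- int N..int N}. exp (- t * (real_of_int z)\<^sup>2)) \<le> 1 + 4 * exp (- t) * (1 - (1 / 2) ^ N)"
  proof (induction N)
    case (Suc N)
    have h: "exp (- t) \<le> 1 / 2"
    proof -
      have "exp (- t) \<le> exp (- 1)" using t by simp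
      also have "exp (- 1) \<le> 1 / (2::real)"
        using exp_ge_add_one_self[of 1] by (simp add: exp_minus field_simps)
      finally show ?thesis .
    qed
    have "exp (- t * (real (Suc N))\<^sup>2) \<le> exp (- t * (1 + real N))"
      using t by (simp add: power2_eq_square)
    also have "\<dots> = exp (- t) * exp (- t) ^ N"
      by (simp add: exp_of_nat_mult[symmetric] exp_add[symmetric] algebra_simps)
    also have "\<dots> \<le> exp (- t) * (1 / 2) ^ N"
      using h by (intro mult_left_mono power_mono) auto
    finally have b: "exp (- t * (real (Suc N))\<^sup>2) \<le> exp (- t) * (1 / 2) ^ N" .
    have s: "{- int (Suc N)..int (Suc N)} = insert (- int (Suc N)) (insert (int (Suc N)) {- int N..int N})"
      by auto
    have "(\<Sum>z\<in>{- int (Suc N)..int (Suc N)}. exp (- t * (real_of_int z)\<^sup>2))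
        = 2 * exp (- t * (real (Suc N))\<^sup>2) + (\<Sum>z\<in>{- int N..int N}. exp (- t * (real_of_int z)\<^sup>2))"
      unfolding s by (simp del: of_nat_Suc)
    also have "\<dots> \<le> 2 * (exp (- t) * (1 / 2) ^ N) + (1 + 4 * exp (- t) * (1 - (1 / 2) ^ N))"
      using Suc b by linarith
    also have "\<dots> = 1 + 4 * exp (- t) * (1 - (1 / 2) ^ Suc N)"
      by (simp add: field_simps)
    finally show ?case .
  qed simp
  also have "\<dots> \<le> 1 + 4 * exp (- t)" by (simp add: mult_left_le)
  finally show ?thesis .
qed

text \<open>Values at indices from p on do not affect the norm; \<open>extensional\<close> fixes
  them, since otherwise the set would be infinite.\<close>

definition int_ball :: "nat \<Rightarrow> real \<Rightarrow> (nat \<Rightarrow> int) set" where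
  "int_ball p R = {w \<in> extensional {..<p}. (\<Sum>j<p. (real_of_int (w j))\<^sup>2) \<le> R}"

text \<open>The cardinality is bounded by an exponential generating function with weight
  \<open>exp (- t z\<^sup>2)\<close> per coordinate.\<close>
lemma int_ball_card:
  assumes t: "1 \<le> t"
  shows "finite (int_ball p R)" "real (card (int_ball p R)) \<le> exp (t * R + 4 * real p * exp (- t))"
proof -
  define N where "N = nat \<lceil>R\<rceil>"
  let ?P = "PiE {..<p} (\<lambda>_. {- int N..int N})"
  \<comment> \<open>Integers satisfy \<bar>z\<bar> \<le> z^2, so every coordinate is bounded by the
    squared radius. The finite box lets the sum of products over all its vectors factor over
    coordinates.\<close>
  have sub: "int_ball p R \<subseteq> ?P"
  proof
    fix w assume w: "w \<in> int_ball p R"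
    have "w j \<in> {- int N..int N}" if "j < p" for j
    proof -
      have "(real_of_int (w j))\<^sup>2 \<le> (\<Sum>j<p. (real_of_int (w j))\<^sup>2)"
        using that by (intro member_le_sum) auto
      also have "\<dots> \<le> R" using w by (simp add: int_ball_def)
      also have "\<dots> \<le> real N" unfolding N_def by (rule real_nat_ceiling_ge)
      finally have "real_of_int ((w j)\<^sup>2) \<le> real_of_int (int N)" by simp
      then have "(w j)\<^sup>2 \<le> int N" by (simp only: of_int_le_iff)
      moreover have "\<bar>w j\<bar> \<le> (w j)\<^sup>2"
      proof (cases "w j = 0")
        case False
        then have "\<bar>w j\<bar> * 1 \<le> \<bar>w j\<bar> * \<bar>w j\<bar>" by (intro mult_left_mono) auto
        then show ?thesis by (simp add: power2_eq_square)
      qed simp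
      ultimately show ?thesis by auto
    qed
    then show "w \<in> ?P" using w by (auto simp: int_ball_def PiE_def)
  qed
  have finP: "finite ?P" by (intro finite_PiE) auto
  show fin: "finite (int_ball p R)" using sub finP by (rule finite_subset)
  have "real (card (int_ball p R)) = (\<Sum>w\<in>int_ball p R. 1)" by simp
  also have "\<dots> \<le> (\<Sum>w\<in>int_ball p R. exp (t * R) * (\<Prod>j<p. exp (- t * (real_of_int (w j))\<^sup>2)))"
  proof (rule sum_mono)
    fix w assume "w \<in> int_ball p R"
    then have "(\<Sum>j<p. (real_of_int (w j))\<^sup>2) \<le> R" by (simp add: int_ball_def)
    then have "t * (\<Sum>j<p. (real_of_int (w j))\<^sup>2) \<le> t * R" using t by (intro mult_left_mono) auto
    then have "0 \<le> t * R + (\<Sum>j<p. - t * (real_of_int (w j))\<^sup>2)"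
      unfolding sum_distrib_left[symmetric] by simp
    then have "1 \<le> exp (t * R + (\<Sum>j<p. - t * (real_of_int (w j))\<^sup>2))" by simp
    then show "1 \<le> exp (t * R) * (\<Prod>j<p. exp (- t * (real_of_int (w j))\<^sup>2))"
      unfolding exp_add by (simp only: exp_sum finite_lessThan)
  qed
  also have "\<dots> \<le> (\<Sum>w\<in>?P. exp (t * R) * (\<Prod>j<p. exp (- t * (real_of_int (w j))\<^sup>2)))"
    by (rule sum_mono2[OF finP sub]) (intro mult_nonneg_nonneg prod_nonneg ballI exp_ge_zero)
  also have "\<dots> = exp (t * R) * (\<Prod>j<p. \<Sum>z\<in>{- int N..int N}. exp (- t * (real_of_int z)\<^sup>2))"
    unfolding sum_distrib_left[symmetric] by (subst prod_sum_PiE) auto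
  also have "\<dots> \<le> exp (t * R) * (\<Prod>j<p. exp (4 * exp (- t)))"
  proof (intro mult_left_mono prod_mono conjI)
    show "(\<Sum>z\<in>{- int N..int N}. exp (- t * (real_of_int z)\<^sup>2)) \<le> exp (4 * exp (- t))"
      using theta_sum_le[OF t, of N] exp_ge_add_one_self[of "4 * exp (- t)"] by linarith
  qed (auto intro: sum_nonneg)
  also have "\<dots> = exp (t * R + 4 * real p * exp (- t))"
  proof -
    have "(\<Prod>j<p. exp (4 * exp (- t))) = exp (real p * (4 * exp (- t)))"
      by (simp only: prod_constant card_lessThan exp_of_nat_mult)
    also have "real p * (4 * exp (- t)) = 4 * real p * exp (- t)" by simp
    finally show ?thesis by (simp only: exp_add)
  qed
  finally show "real (card (int_ball p R)) \<le> exp (t * R + 4 * real p * exp (- t))" .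
qed

section \<open>Reindexing independent families, and exponential moments of squares\<close>

context prob_space
begin

lemma indep_vars_reindex:
  assumes inj: "inj_on f J" and ind: "indep_vars (\<lambda>_. N) X (f ` J)"
  shows "indep_vars (\<lambda>_. N) (\<lambda>i. X (f i)) J"
proof -
  let ?F = "\<lambda>i. {X i -` A \<inter> space M |A. A \<in> sets N}"
  from ind have rv: "\<And>i. i \<in> J \<Longrightarrow> random_variable N (X (f i))" and F: "indep_sets ?F (f ` J)"
    by (auto simp: indep_vars_def2)
  have "indep_sets (\<lambda>i. ?F (f i)) J"
  proof (rule indep_setsI)
    show "?F (f i) \<subseteq> events" if "i \<in> J" for i using F that by (auto simp: indep_sets_def)
    fix A K assume K: "K \<noteq> {}" "K \<subseteq> J" "finite K" "\<forall>j\<in>K. A j \<in> ?F (f j)"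
    define A' where "A' i = A (inv_into K f i)" for i
    have injK: "inj_on f K" using inj K(2) by (rule inj_on_subset)
    have A': "A' (f j) = A j" if "j \<in> K" for j using injK that by (simp add: A'_def)
    have "prob (\<Inter>j\<in>f ` K. A' j) = (\<Prod>j\<in>f ` K. prob (A' j))"
      using K A' by (intro indep_setsD[OF F]) auto
    then show "prob (\<Inter>j\<in>K. A j) = (\<Prod>j\<in>K. prob (A j))"
      using A' by (simp add: prod.reindex[OF injK] cong: INF_cong prod.cong)
  qed
  with rv show ?thesis by (simp add: indep_vars_def2)
qed

text \<open>Gaussian linearization: \<open>exp (l y\<^sup>2)\<close> is the mean of \<open>exp (sqrt (2 l) y g)\<close> over a standard
  normal \<open>g\<close>.\<close>
lemma exp_square_moment_le:
  fixes Y :: "'a \<Rightarrow> real"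
  assumes [measurable]: "random_variable borel Y"
    and mgf: "\<And>t. (\<integral>\<^sup>+ x. ennreal (exp (t * Y x)) \<partial>M) \<le> ennreal (exp (s\<^sup>2 * t\<^sup>2 / 2))"
    and l: "0 \<le> l" "4 * l * s\<^sup>2 \<le> 1"
  shows "(\<integral>\<^sup>+ x. ennreal (exp (l * (Y x)\<^sup>2)) \<partial>M) \<le> 2"
proof -
  have dens: "(\<integral>\<^sup>+ g. ennreal (normal_density \<mu> \<sigma> g) \<partial>lborel) = 1" if "0 < \<sigma>" for \<mu> \<sigma>
    using prob_space.emeasure_space_1[OF prob_space_normal_density[OF that, of \<mu>]]
    by (simp add: emeasure_density)
  have lin: "ennreal (exp (l * y\<^sup>2)) = (\<integral>\<^sup>+ g. ennreal (std_normal_density g * exp (sqrt (2 * l) * y * g)) \<partial>lborel)" for y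
  proof -
    let ?a = "sqrt (2 * l) * y"
    have "std_normal_density g * exp (?a * g) = exp (l * y\<^sup>2) * normal_density ?a 1 g" for g
    proof -
      have "?a\<^sup>2 = 2 * l * y\<^sup>2" using l by (simp add: power_mult_distrib)
      then have "- g\<^sup>2 / 2 + ?a * g = l * y\<^sup>2 + - (g - ?a)\<^sup>2 / 2"
        by (simp add: power2_diff field_simps)
      then have "exp (- g\<^sup>2 / 2) * exp (?a * g) = exp (l * y\<^sup>2) * exp (- (g - ?a)\<^sup>2 / 2)"
        by (simp only: exp_add[symmetric])
      then show ?thesis by (simp add: normal_density_def)
    qed
    then have "(\<integral>\<^sup>+ g. ennreal (std_normal_density g * exp (?a * g)) \<partial>lborel)
        = (\<integral>\<^sup>+ g. ennreal (exp (l * y\<^sup>2)) * ennreal (normal_density ?a 1 g) \<partial>lborel)"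
      by (simp add: ennreal_mult')
    also have "\<dots> = ennreal (exp (l * y\<^sup>2))"
      by (simp add: nn_integral_cmult dens)
    finally show ?thesis by simp
  qed
  interpret L: pair_sigma_finite M "lborel :: real measure"
    by (intro pair_sigma_finite.intro sigma_finite_measure_axioms lborel.sigma_finite_measure_axioms)
  have "(\<integral>\<^sup>+ x. ennreal (exp (l * (Y x)\<^sup>2)) \<partial>M)
      = (\<integral>\<^sup>+ x. (\<integral>\<^sup>+ g. ennreal (std_normal_density g * exp (sqrt (2 * l) * Y x * g)) \<partial>lborel) \<partial>M)"
    by (simp add: lin)
  also have "\<dots> = (\<integral>\<^sup>+ g. (\<integral>\<^sup>+ x. ennreal (std_normal_density g * exp (sqrt (2 * l) * Y x * g)) \<partial>M) \<partial>lborel)"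
    by (rule L.Fubini'[symmetric]) measurable
  \<comment> \<open>The condition 4 l s^2 \<le> 1 leaves at least exp (- g^2 / 4) of the Gaussian
    decay. This is the profile of variance 2, and its total mass relative to the standard
    normalization is sqrt 2.\<close>
  also have "\<dots> \<le> (\<integral>\<^sup>+ g. ennreal (sqrt 2) * ennreal (normal_density 0 (sqrt 2) g) \<partial>lborel)"
  proof (rule nn_integral_mono)
    fix g :: real
    have "(\<integral>\<^sup>+ x. ennreal (std_normal_density g * exp (sqrt (2 * l) * Y x * g)) \<partial>M)
        = ennreal (std_normal_density g) * (\<integral>\<^sup>+ x. ennreal (exp ((sqrt (2 * l) * g) * Y x)) \<partial>M)"
      by (simp add: ennreal_mult' nn_integral_cmult mult_ac)
    also have "\<dots> \<le> ennreal (std_normal_density g) * ennreal (exp (s\<^sup>2 * (sqrt (2 * l) * g)\<^sup>2 / 2))"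
      by (intro mult_left_mono mgf) simp
    also have "\<dots> = ennreal (std_normal_density g * exp (s\<^sup>2 * (sqrt (2 * l) * g)\<^sup>2 / 2))"
      by (simp add: ennreal_mult')
    also have "\<dots> \<le> ennreal (std_normal_density g * exp (g\<^sup>2 / 4))"
    proof (intro ennreal_leI mult_left_mono)
      have "s\<^sup>2 * (sqrt (2 * l) * g)\<^sup>2 / 2 = (4 * l * s\<^sup>2) * g\<^sup>2 / 4" using l by (simp add: power_mult_distrib)
      also have "\<dots> \<le> g\<^sup>2 / 4" using mult_right_mono[OF l(2), of "g\<^sup>2"] by simp
      finally show "exp (s\<^sup>2 * (sqrt (2 * l) * g)\<^sup>2 / 2) \<le> exp (g\<^sup>2 / 4)" by simp
    qed simp
    also have "std_normal_density g * exp (g\<^sup>2 / 4) = sqrt 2 * normal_density 0 (sqrt 2) g"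
    proof -
      have "exp (- g\<^sup>2 / 2) * exp (g\<^sup>2 / 4) = exp (- g\<^sup>2 / 4)" by (simp add: exp_add[symmetric])
      then show ?thesis by (simp add: normal_density_def real_sqrt_mult field_simps)
    qed
    also have "ennreal (sqrt 2 * normal_density 0 (sqrt 2) g) = ennreal (sqrt 2) * ennreal (normal_density 0 (sqrt 2) g)"
      by (simp add: ennreal_mult')
    finally show "(\<integral>\<^sup>+ x. ennreal (std_normal_density g * exp (sqrt (2 * l) * Y x * g)) \<partial>M)
       \<le> ennreal (sqrt 2) * ennreal (normal_density 0 (sqrt 2) g)" .
  qed
  also have "\<dots> = ennreal (sqrt 2)" by (simp add: nn_integral_cmult dens)
  also have "\<dots> \<le> 2" using sqrt2_less_2 by (simp add: ennreal_le_iff[of 2, simplified] less_imp_le flip: ennreal_numeral)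
  finally show ?thesis .
qed

end

section \<open>Subgaussian designs\<close>

lemma (in prob_space) nn_integral_le_imp_integrable:
  fixes f :: "'a \<Rightarrow> real"
  assumes [measurable]: "random_variable borel f" and nn: "\<And>x. 0 \<le> f x"
    and le: "(\<integral>\<^sup>+ x. ennreal (f x) \<partial>M) \<le> ennreal B" and B: "0 \<le> B"
  shows "integrable M f" "expectation f \<le> B"
proof -
  show i: "integrable M f"
    using nn le by (intro integrableI_nonneg) (auto simp: less_top[symmetric] top_unique)
  have "ennreal (expectation f) \<le> ennreal B"
    using le nn i by (simp add: nn_integral_eq_integral)
  then show "expectation f \<le> B" using B by (simp add: ennreal_le_iff)
qed

text \<open>Row \<open>k\<close> of the design carries \<open>X\<^bsub>kj\<^esub>\<close> in the coordinates \<open>j < p\<close> and the noise \<open>\<xi>\<^bsub>k\<^esub>\<close> in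
  coordinate \<open>p\<close>.\<close>
locale design = prob_space +
  fixes Z :: "nat \<times> nat \<Rightarrow> 'a \<Rightarrow> real" and I :: "nat set" and p :: nat and K :: real
  assumes finI: "finite I" and K: "0 < K"
    and indep: "indep_vars (\<lambda>_. borel) Z (I \<times> {..p})"
    and std: "\<And>k j. k \<in> I \<Longrightarrow> j \<le> p \<Longrightarrow> standardized M (Z (k, j))"
    and subg: "\<And>k j. k \<in> I \<Longrightarrow> j \<le> p \<Longrightarrow> subgaussian M K (Z (k, j))"
begin

definition lin :: "nat \<Rightarrow> vec \<Rightarrow> 'a \<Rightarrow> real" where
  "lin k a x = (\<Sum>j\<le>p. a j * Z (k, j) x)"

definition sq :: "vec \<Rightarrow> real" where "sq a = (\<Sum>j\<le>p. (a j)\<^sup>2)"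

lemma sq_nonneg: "0 \<le> sq a" by (simp add: sq_def sum_nonneg)

lemma Z_measurable [measurable]: "k \<in> I \<Longrightarrow> j \<le> p \<Longrightarrow> Z (k, j) \<in> borel_measurable M"
  using indep by (auto simp: indep_vars_def)

lemma lin_measurable [measurable]: "k \<in> I \<Longrightarrow> lin k a \<in> borel_measurable M"
  unfolding lin_def[abs_def] by measurable

lemma indep_row: "k \<in> I \<Longrightarrow> indep_vars (\<lambda>_. borel) (\<lambda>j. Z (k, j)) {..p}"
  by (rule indep_vars_reindex) (auto intro: inj_onI indep_vars_subset[OF indep])

lemma indep_blocks:
  assumes F: "\<And>k. k \<in> I \<Longrightarrow> f k \<in> PiM ({k} \<times> {..p}) (\<lambda>_. borel) \<rightarrow>\<^sub>M N"
    and eq: "\<And>k x. k \<in> I \<Longrightarrow> g k x = f k (restrict (\<lambda>i. Z i x) ({k} \<times> {..p}))"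
  shows "indep_vars (\<lambda>_. N) g I"
proof -
  have "indep_vars (\<lambda>k. PiM ({k} \<times> {..p}) (\<lambda>_. borel)) (\<lambda>k x. restrict (\<lambda>i. Z i x) ({k} \<times> {..p})) I"
    by (rule indep_vars_restrict[OF indep]) (auto simp: disjoint_family_on_def)
  from indep_vars_compose2[OF this, of f "\<lambda>_. N"] F
  have "indep_vars (\<lambda>_. N) (\<lambda>k x. f k (restrict (\<lambda>i. Z i x) ({k} \<times> {..p}))) I" by simp
  moreover have "indep_vars (\<lambda>_. N) (\<lambda>k x. f k (restrict (\<lambda>i. Z i x) ({k} \<times> {..p}))) I \<longleftrightarrow> indep_vars (\<lambda>_. N) g I"
    using eq by (intro indep_vars_cong refl) (auto simp: fun_eq_iff)
  ultimately show ?thesis by simp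
qed

lemma indep_lin: "indep_vars (\<lambda>_. borel) (\<lambda>k. lin k a) I"
  by (rule indep_blocks[where f = "\<lambda>k x. \<Sum>j\<le>p. a j * x (k, j)"])
     (auto simp: lin_def intro!: sum.cong borel_measurable_sum borel_measurable_times measurable_component_singleton)

lemma rows_nn_integral:
  assumes f: "f \<in> borel_measurable borel"
  shows "(\<integral>\<^sup>+ x. (\<Prod>k\<in>I. f (lin k a x)) \<partial>M) = (\<Prod>k\<in>I. \<integral>\<^sup>+ x. (f (lin k a x) :: ennreal) \<partial>M)"
  by (rule indep_vars_nn_integral[OF finI indep_vars_compose2[OF indep_lin]]) (use f in auto)

lemma mgf_lin:
  assumes k: "k \<in> I"
  shows "(\<integral>\<^sup>+ x. ennreal (exp (t * lin k a x)) \<partial>M) \<le> ennreal (exp ((K * sqrt (sq a))\<^sup>2 * t\<^sup>2 / 2))"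
proof -
  have "(\<integral>\<^sup>+ x. ennreal (exp (t * lin k a x)) \<partial>M) = (\<integral>\<^sup>+ x. (\<Prod>j\<in>{..p}. ennreal (exp (t * a j * Z (k, j) x))) \<partial>M)"
    by (simp add: lin_def sum_distrib_left exp_sum prod_ennreal mult_ac)
  also have "\<dots> = (\<Prod>j\<in>{..p}. \<integral>\<^sup>+ x. ennreal (exp (t * a j * Z (k, j) x)) \<partial>M)"
    by (rule indep_vars_nn_integral[OF _ indep_vars_compose2[OF indep_row[OF k]]]) auto
  also have "\<dots> \<le> (\<Prod>j\<in>{..p}. ennreal (exp (K\<^sup>2 * (t * a j)\<^sup>2 / 2)))"
  proof (rule prod_mono_ennreal)
    fix j assume "j \<in> {..p}"
    then have s: "integrable M (\<lambda>x. exp (t * a j * Z (k, j) x))"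
       "(\<integral>x. exp (t * a j * Z (k, j) x) \<partial>M) \<le> exp (K\<^sup>2 * (t * a j)\<^sup>2 / 2)"
      using subg[OF k, of j] by (auto simp: subgaussian_def)
    then show "(\<integral>\<^sup>+ x. ennreal (exp (t * a j * Z (k, j) x)) \<partial>M) \<le> ennreal (exp (K\<^sup>2 * (t * a j)\<^sup>2 / 2))"
      by (subst nn_integral_eq_integral) (auto intro: ennreal_leI)
  qed
  also have "\<dots> = ennreal (exp (\<Sum>j\<le>p. K\<^sup>2 * (t * a j)\<^sup>2 / 2))"
    by (simp add: prod_ennreal exp_sum)
  also have "(\<Sum>j\<le>p. K\<^sup>2 * (t * a j)\<^sup>2 / 2) = (K * sqrt (sq a))\<^sup>2 * t\<^sup>2 / 2"
    using sq_nonneg[of a]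
    by (simp add: power_mult_distrib) (simp add: sq_def sum_distrib_left sum_distrib_right sum_divide_distrib mult_ac)
  finally show ?thesis .
qed

lemma exp_sq_lin:
  assumes "k \<in> I" "0 \<le> l" "4 * l * (K\<^sup>2 * sq a) \<le> 1"
  shows "(\<integral>\<^sup>+ x. ennreal (exp (l * (lin k a x)\<^sup>2)) \<partial>M) \<le> 2"
  by (rule exp_square_moment_le[where s = "K * sqrt (sq a)"])
     (use assms mgf_lin sq_nonneg in \<open>auto simp: power_mult_distrib\<close>)

lemma sum_sq_upper_tail:
  assumes l: "0 < l" "4 * l * (K\<^sup>2 * sq a) \<le> 1"
  shows "prob {x \<in> space M. u \<le> (\<Sum>k\<in>I. (lin k a x)\<^sup>2)} \<le> 2 ^ card I * exp (- l * u)"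
proof -
  have "emeasure M {x \<in> space M. u \<le> (\<Sum>k\<in>I. (lin k a x)\<^sup>2)}
      \<le> ennreal (exp (- l * u)) * (\<integral>\<^sup>+ x. ennreal (exp (l * (\<Sum>k\<in>I. (lin k a x)\<^sup>2))) * indicator (space M) x \<partial>M)"
    using l by (intro Chernoff_ineq_nn_integral_ge) auto
  also have "(\<integral>\<^sup>+ x. ennreal (exp (l * (\<Sum>k\<in>I. (lin k a x)\<^sup>2))) * indicator (space M) x \<partial>M)
      = (\<integral>\<^sup>+ x. (\<Prod>k\<in>I. ennreal (exp (l * (lin k a x)\<^sup>2))) \<partial>M)"
    using finI by (intro nn_integral_cong) (simp add: sum_distrib_left exp_sum prod_ennreal)
  also have "\<dots> = (\<Prod>k\<in>I. \<integral>\<^sup>+ x. ennreal (exp (l * (lin k a x)\<^sup>2)) \<partial>M)"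
    by (rule rows_nn_integral) simp
  also have "\<dots> \<le> (\<Prod>k\<in>I. ennreal 2)"
    using l exp_sq_lin by (intro prod_mono_ennreal) auto
  also have "\<dots> = ennreal (2 ^ card I)" by (simp only: prod_constant ennreal_power)
  finally have "emeasure M {x \<in> space M. u \<le> (\<Sum>k\<in>I. (lin k a x)\<^sup>2)} \<le> ennreal (exp (- l * u)) * ennreal (2 ^ card I)"
    by (simp add: mult_left_mono)
  also have "\<dots> = ennreal (2 ^ card I * exp (- l * u))"
    by (subst ennreal_mult'[symmetric]) (simp_all add: mult.commute)
  finally show ?thesis by (simp add: emeasure_eq_measure ennreal_le_iff)
qed

lemma Z_moments:
  assumes "k \<in> I" "i \<le> p" "j \<le> p"
  shows "integrable M (\<lambda>x. Z (k, i) x * Z (k, j) x)"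
    and "expectation (\<lambda>x. Z (k, i) x * Z (k, j) x) = (if i = j then 1 else 0)"
proof -
  have s: "integrable M (Z (k, i))" "expectation (Z (k, i)) = 0" "integrable M (\<lambda>x. (Z (k, i) x)\<^sup>2)"
    "expectation (\<lambda>x. (Z (k, i) x)\<^sup>2) = 1" if "i \<le> p" for i
    using std[OF assms(1) that] by (auto simp: standardized_def)
  have "integrable M (\<lambda>x. Z (k, i) x * Z (k, j) x) \<and>
    expectation (\<lambda>x. Z (k, i) x * Z (k, j) x) = (if i = j then 1 else 0)"
  proof (cases "i = j")
    case True
    then show ?thesis using s[OF assms(2)] by (simp add: power2_eq_square)
  next
    case False
    have iv: "indep_vars (\<lambda>_. borel) (\<lambda>j. Z (k, j)) {i, j}"
      using assms by (intro indep_vars_subset[OF indep_row[OF assms(1)]]) auto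
    have ii: "\<And>m. m \<in> {i, j} \<Longrightarrow> integrable M (Z (k, m))" using s assms by auto
    show ?thesis
      using indep_vars_lebesgue_integral[OF _ iv ii] indep_vars_integrable[OF _ iv ii] False s[OF assms(2)] s[OF assms(3)]
      by simp
  qed
  then show "integrable M (\<lambda>x. Z (k, i) x * Z (k, j) x)"
    and "expectation (\<lambda>x. Z (k, i) x * Z (k, j) x) = (if i = j then 1 else 0)" by auto
qed

lemma lin_cov:
  assumes k: "k \<in> I"
  shows "integrable M (\<lambda>x. lin k a x * lin k b x)"
    and "expectation (\<lambda>x. lin k a x * lin k b x) = (\<Sum>j\<le>p. a j * b j)"
proof -
  have e: "(\<lambda>x. lin k a x * lin k b x) = (\<lambda>x. \<Sum>i\<le>p. \<Sum>j\<le>p. a i * b j * (Z (k, i) x * Z (k, j) x))"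
    by (simp add: lin_def sum_product mult_ac)
  show "integrable M (\<lambda>x. lin k a x * lin k b x)"
    unfolding e using Z_moments(1)[OF k] by (intro Bochner_Integration.integrable_sum integrable_mult_right) auto
  have "expectation (\<lambda>x. lin k a x * lin k b x) = (\<Sum>i\<le>p. \<Sum>j\<le>p. a i * b j * (if i = j then 1 else 0))"
    unfolding e using Z_moments[OF k]
    by (subst Bochner_Integration.integral_sum, (intro Bochner_Integration.integrable_sum integrable_mult_right, auto)[1],
        intro sum.cong refl, subst Bochner_Integration.integral_sum, (intro integrable_mult_right, auto)[1], intro sum.cong refl, simp)
  also have "\<dots> = (\<Sum>j\<le>p. a j * b j)"
    by (intro sum.cong refl) (simp add: if_distrib[of "\<lambda>c. _ * c"] sum.delta cong: if_cong)
  finally show "expectation (\<lambda>x. lin k a x * lin k b x) = (\<Sum>j\<le>p. a j * b j)" .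
qed

lemma lin_fourth_moment:
  assumes k: "k \<in> I" and a: "0 < sq a"
  shows "(\<integral>\<^sup>+ x. ennreal ((lin k a x) ^ 4) \<partial>M) \<le> ennreal (96 * K ^ 4 * (sq a)\<^sup>2)"
proof -
  define s where "s = K * sqrt (sq a)"
  have s: "0 < s" "s\<^sup>2 = K\<^sup>2 * sq a" using K a by (auto simp: s_def power_mult_distrib)
  let ?Y = "lin k a"
  \<comment> \<open>At \<plusminus> 1 / s the bound on the generating function is exp (1 / 2) \<le>
    2. This gives 96 = 4! * 2 * 2.\<close>
  have pt: "(?Y x) ^ 4 \<le> 24 * s ^ 4 * (exp (1 / s * ?Y x) + exp ((- 1 / s) * ?Y x))" for x
    using even_power_le_fact_exp[of "1 / s * ?Y x" 2] s(1)
    by (simp add: power_divide field_simps fact_numeral)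
  have "(\<integral>\<^sup>+ x. ennreal ((?Y x) ^ 4) \<partial>M)
      \<le> (\<integral>\<^sup>+ x. ennreal (24 * s ^ 4) * (ennreal (exp (1 / s * ?Y x)) + ennreal (exp ((- 1 / s) * ?Y x))) \<partial>M)"
    using pt by (intro nn_integral_mono) (simp flip: ennreal_mult' ennreal_plus add: ennreal_leI)
  also have "\<dots> = ennreal (24 * s ^ 4) * ((\<integral>\<^sup>+ x. ennreal (exp (1 / s * ?Y x)) \<partial>M) + (\<integral>\<^sup>+ x. ennreal (exp ((- 1 / s) * ?Y x)) \<partial>M))"
    using k by (subst nn_integral_cmult, measurable) (subst nn_integral_add, measurable)
  also have "\<dots> \<le> ennreal (24 * s ^ 4) * (ennreal (exp (1 / 2)) + ennreal (exp (1 / 2)))"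
    using mgf_lin[OF k, of "1 / s" a] mgf_lin[OF k, of "- 1 / s" a] s(1)
    by (intro mult_left_mono add_mono) (auto simp: s_def[symmetric] power_divide)
  also have "\<dots> = ennreal (24 * s ^ 4 * (2 * exp (1 / 2)))"
    by (simp flip: ennreal_mult' ennreal_plus)
  also have "\<dots> \<le> ennreal (24 * s ^ 4 * (2 * 2))"
  proof (intro ennreal_leI mult_left_mono)
    have "exp (1 / 2 :: real) \<le> 1 + 1 / 2 + (1 / 2)\<^sup>2" by (rule exp_bound) auto
    then show "exp (1 / 2 :: real) \<le> 2" by (simp add: power2_eq_square)
  qed auto
  also have "24 * s ^ 4 * (2 * 2) = 96 * K ^ 4 * (sq a)\<^sup>2"
  proof -
    have "s ^ 4 = (s\<^sup>2)\<^sup>2" by simp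
    then show ?thesis unfolding s(2) by (simp add: power_mult_distrib)
  qed
  finally show ?thesis .
qed

text \<open>For nonnegative summands the lower tail requires only two moments of the squares, since
  exp (- u) \<le> 1 - u + u^2 / 2 for u \<ge> 0. The fourth moment is comparable to the squared
  variance, so the rate does not depend on \<open>a\<close>.\<close>

lemma sum_sq_lower_tail:
  assumes a: "0 < sq a"
  shows "prob {x \<in> space M. (\<Sum>k\<in>I. (lin k a x)\<^sup>2) \<le> real (card I) * sq a / 2} \<le> exp (- real (card I) / (768 * K ^ 4))"
proof -
  define B where "B = 96 * K ^ 4"
  define V where "V = sq a"
  have B: "0 < B" using K by (simp add: B_def)
  have V: "0 < V" using a by (simp add: V_def)
  \<comment> \<open>The minimizer of - l V / 2 + l^2 B V^2 / 2, the exponent per row. The minimum is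
    - 1 / (8 B), and 8 * 96 = 768.\<close>
  define l where "l = 1 / (2 * B * V)"
  have l: "0 < l" using B V by (simp add: l_def)
  have one: "(\<integral>\<^sup>+ x. ennreal (exp (- l * (lin k a x)\<^sup>2)) \<partial>M) \<le> ennreal (exp (- l * V + l\<^sup>2 * (B * V\<^sup>2) / 2))"
    if k: "k \<in> I" for k
  proof -
    let ?Y = "lin k a"
    have i4: "integrable M (\<lambda>x. (?Y x) ^ 4)" "expectation (\<lambda>x. (?Y x) ^ 4) \<le> B * V\<^sup>2"
      using nn_integral_le_imp_integrable[of "\<lambda>x. (?Y x) ^ 4" "B * V\<^sup>2"] lin_fourth_moment[OF k a] k B
      by (auto simp: B_def V_def)
    have i2: "integrable M (\<lambda>x. (?Y x)\<^sup>2)" "expectation (\<lambda>x. (?Y x)\<^sup>2) = V"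
      using lin_cov[OF k, of a a] by (simp_all add: power2_eq_square V_def sq_def)
    have ie: "integrable M (\<lambda>x. exp (- l * (?Y x)\<^sup>2))"
      using k l by (intro integrable_const_bound[of _ 1]) auto
    have pt: "exp (- l * (?Y x)\<^sup>2) \<le> 1 - l * (?Y x)\<^sup>2 + l\<^sup>2 / 2 * (?Y x) ^ 4" for x
    proof -
      have e: "exp (- u) \<le> 1 - u + u\<^sup>2 / 2" if "0 \<le> u" for u :: real
      proof -
        have "\<exists>t. \<bar>t\<bar> \<le> \<bar>- u\<bar> \<and> exp (- u) = (\<Sum>m<3. (- u) ^ m / fact m) + exp t / fact 3 * (- u) ^ 3"
          by (rule Maclaurin_exp_le)
        then obtain t where "exp (- u) = (\<Sum>m<3. (- u) ^ m / fact m) + exp t / fact 3 * (- u) ^ 3" by blast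
        moreover have "exp t / fact 3 * (- u) ^ 3 \<le> 0"
          using that by (intro mult_nonneg_nonpos) (auto simp: power_minus_odd)
        ultimately show ?thesis by (simp add: eval_nat_numeral fact_numeral)
      qed
      show ?thesis using e[of "l * (?Y x)\<^sup>2"] l by (simp add: power_mult_distrib)
    qed
    have "expectation (\<lambda>x. exp (- l * (?Y x)\<^sup>2)) \<le> expectation (\<lambda>x. 1 - l * (?Y x)\<^sup>2 + l\<^sup>2 / 2 * (?Y x) ^ 4)"
      using i4 i2 ie pt by (intro integral_mono) auto
    also have "\<dots> = 1 - l * V + l\<^sup>2 / 2 * expectation (\<lambda>x. (?Y x) ^ 4)"
      using i4 i2 by (simp add: prob_space)
    also have "\<dots> \<le> 1 + (- l * V + l\<^sup>2 * (B * V\<^sup>2) / 2)"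
      using mult_left_mono[OF i4(2), of "l\<^sup>2 / 2"] by simp
    also have "\<dots> \<le> exp (- l * V + l\<^sup>2 * (B * V\<^sup>2) / 2)" by (rule exp_ge_add_one_self)
    finally show ?thesis using ie by (subst nn_integral_eq_integral) (auto intro: ennreal_leI)
  qed
  let ?n = "real (card I)"
  have "emeasure M {x \<in> space M. (\<Sum>k\<in>I. (lin k a x)\<^sup>2) \<le> ?n * V / 2}
      \<le> ennreal (exp (l * (?n * V / 2))) * (\<integral>\<^sup>+ x. ennreal (exp (- l * (\<Sum>k\<in>I. (lin k a x)\<^sup>2))) * indicator (space M) x \<partial>M)"
    using l by (intro Chernoff_ineq_nn_integral_le) auto
  also have "(\<integral>\<^sup>+ x. ennreal (exp (- l * (\<Sum>k\<in>I. (lin k a x)\<^sup>2))) * indicator (space M) x \<partial>M)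
      = (\<integral>\<^sup>+ x. (\<Prod>k\<in>I. ennreal (exp (- l * (lin k a x)\<^sup>2))) \<partial>M)"
    using finI by (intro nn_integral_cong) (simp add: sum_distrib_left exp_sum[symmetric] prod_ennreal sum_negf)
  also have "\<dots> = (\<Prod>k\<in>I. \<integral>\<^sup>+ x. ennreal (exp (- l * (lin k a x)\<^sup>2)) \<partial>M)"
    by (rule rows_nn_integral) simp
  also have "\<dots> \<le> (\<Prod>k\<in>I. ennreal (exp (- l * V + l\<^sup>2 * (B * V\<^sup>2) / 2)))"
    using one by (intro prod_mono_ennreal) auto
  also have "\<dots> = ennreal (exp (?n * (- l * V + l\<^sup>2 * (B * V\<^sup>2) / 2)))"
    by (simp only: prod_constant ennreal_power exp_of_nat_mult exp_ge_zero)
  also have "ennreal (exp (l * (?n * V / 2))) * ennreal (exp (?n * (- l * V + l\<^sup>2 * (B * V\<^sup>2) / 2)))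
      = ennreal (exp (l * (?n * V / 2) + ?n * (- l * V + l\<^sup>2 * (B * V\<^sup>2) / 2)))"
    by (simp add: ennreal_mult'[symmetric] exp_add)
  also have "l * (?n * V / 2) + ?n * (- l * V + l\<^sup>2 * (B * V\<^sup>2) / 2) = - ?n / (8 * B)"
    using B V by (simp add: l_def field_simps power2_eq_square)
  finally have "emeasure M {x \<in> space M. (\<Sum>k\<in>I. (lin k a x)\<^sup>2) \<le> ?n * V / 2} \<le> ennreal (exp (- ?n / (8 * B)))"
    by (simp add: mult_left_mono)
  then show ?thesis by (simp add: emeasure_eq_measure ennreal_le_iff B_def V_def)
qed

end

text \<open>The lattice ball in the union bound for the lower tails has log-cardinality at most
  \<kappa> n (64 (1 + 4 K)^2 + 2). This value of \<kappa> makes it half of the exponent n / (768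
  K^4) of \<open>sum_sq_lower_tail\<close>; the other half survives.\<close>

definition re_kappa :: "real \<Rightarrow> real" where
  "re_kappa K = 1 / (1536 * K ^ 4 * (64 * (1 + 4 * K)\<^sup>2 + 2))"

text \<open>The coefficient of the slope norm in \<open>restricted_eigenvalue\<close> for A = 4 K,
  the constant that the upper tail gives for sign vectors. It later serves as the tuning
  constant.\<close>

definition re_const :: "real \<Rightarrow> real" where
  "re_const K = (1 + 4 * K) * sqrt (2 / re_kappa K) + 2 * (4 * K)"

lemma re_kappa_pos: "0 < K \<Longrightarrow> 0 < re_kappa K"
  by (auto simp: re_kappa_def intro!: divide_pos_pos mult_pos_pos add_nonneg_pos)

lemma re_const_pos: "0 < K \<Longrightarrow> 0 < re_const K"
  using re_kappa_pos[of K] by (auto simp: re_const_def intro!: add_nonneg_pos)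

lemma sum_exp_neg_le: "(\<Sum>m=1..p. exp (- real m)) \<le> 1"
proof -
  have h: "exp (- 1) \<le> 1 / (2::real)"
    using exp_ge_add_one_self[of 1] by (simp add: exp_minus field_simps)
  have "(\<Sum>m=1..p. exp (- real m)) \<le> 1 - (1 / 2) ^ p"
  proof (induction p)
    case (Suc p)
    have "exp (- real (Suc p)) = exp (- 1) ^ Suc p"
      unfolding exp_of_nat_mult[symmetric] by simp
    also have "\<dots> \<le> (1 / 2) ^ Suc p" by (intro power_mono h) simp
    finally show ?case using Suc by simp
  qed simp
  also have "\<dots> \<le> 1" by simp
  finally show ?thesis .
qed

context design
begin

definition emb :: "(nat \<Rightarrow> int) \<Rightarrow> vec" where
  "emb w = (\<lambda>j. if j < p then real_of_int (w j) else 0)"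

lemma sq_emb: "sq (emb w) = (\<Sum>j<p. (real_of_int (w j))\<^sup>2)"
  unfolding sq_def lessThan_Suc_atMost[symmetric] by (simp add: emb_def)

lemma lin_emb: "lin k (emb w) x = (\<Sum>j<p. Z (k, j) x * real_of_int (w j))"
  unfolding lin_def lessThan_Suc_atMost[symmetric] by (simp add: emb_def mult.commute)

lemma mnorm_emb: "mnorm I p (\<lambda>k j. Z (k, j) x) (\<lambda>j. real_of_int (w j)) = sqrt (\<Sum>k\<in>I. (lin k (emb w) x)\<^sup>2)"
  by (simp add: mnorm_def L2_set_def lin_emb)

lemma two_power_le_exp: "(2::real) ^ n \<le> exp (real n)"
proof -
  have "(2::real) ^ n \<le> exp 1 ^ n" using exp_ge_add_one_self[of 1] by (intro power_mono) auto
  then show ?thesis by (simp add: exp_of_nat_mult[symmetric])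
qed

lemma noise_tail:
  "prob {x \<in> space M. 8 * K\<^sup>2 * real (card I) \<le> (\<Sum>k\<in>I. (Z (k, p) x)\<^sup>2)} \<le> exp (- real (card I))"
proof -
  define a :: vec where "a = (\<lambda>j. if j = p then 1 else 0)"
  have l: "lin k a x = Z (k, p) x" for k x
    by (simp add: lin_def a_def if_distrib[of "\<lambda>c. c * _"] sum.delta cong: if_cong)
  have s: "sq a = 1" by (simp add: sq_def a_def if_distrib[of "\<lambda>c. c\<^sup>2"] sum.delta cong: if_cong)
  \<comment> \<open>At the parameter 1 / (4 K^2) the threshold contributes exp (- 2 n), which beats
    the factor 2^n \<le> exp n.\<close>
  have "prob {x \<in> space M. 8 * K\<^sup>2 * real (card I) \<le> (\<Sum>k\<in>I. (lin k a x)\<^sup>2)}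
      \<le> 2 ^ card I * exp (- (1 / (4 * K\<^sup>2)) * (8 * K\<^sup>2 * real (card I)))"
    using K by (intro sum_sq_upper_tail) (auto simp: s)
  also have "\<dots> \<le> exp (real (card I)) * exp (- (1 / (4 * K\<^sup>2)) * (8 * K\<^sup>2 * real (card I)))"
    by (intro mult_right_mono two_power_le_exp) simp
  also have "\<dots> = exp (- real (card I))"
    using K unfolding exp_add[symmetric] by (simp add: field_simps)
  finally show ?thesis by (simp add: l)
qed

lemma log_rate_ge_one: "1 \<le> m \<Longrightarrow> m \<le> p \<Longrightarrow> 1 \<le> ln (exp 1 * real p / real m)"
  by (subst ln_ge_iff) (auto simp: field_simps)

lemma restricted_eigenvalue_event:
  assumes p: "0 < p" and n: "0 < card I" and logp: "ln (exp 1 * real p) \<le> re_kappa K * real (card I)"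
  obtains Bad where "Bad \<in> events"
    "prob Bad \<le> exp (- real (card I)) + exp (- real (card I) / (1536 * K ^ 4))"
    "\<And>x \<delta>. x \<in> space M - Bad \<Longrightarrow>
       L2_set \<delta> {..<p} / 4 - re_const K * slope_norm 1 (card I) p \<delta>
         \<le> mnorm I p (\<lambda>k j. Z (k, j) x) \<delta> / sqrt (real (card I))"
proof -
  let ?n = "real (card I)"
  let ?l = "\<lambda>m::nat. ln (exp 1 * real p / real m)"
  \<comment> \<open>At Chernoff parameter 1 / (4 K^2 m) this threshold yields the exponent 4 (n + m
    ln (e p / m)). It pays for the 2^n, for a lattice ball of log-cardinality at most 3 m ln (e p /
    m), and still leaves n + m to sum over all m.\<close>
  define u where "u m = 16 * K\<^sup>2 * real m * (?n + real m * ?l m)" for m :: nat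
  define E where "E m w = {x \<in> space M. u m \<le> (\<Sum>k\<in>I. (lin k (emb w) x)\<^sup>2)}" for m w
  have [measurable]: "(\<lambda>x. \<Sum>k\<in>I. (lin k a x)\<^sup>2) \<in> borel_measurable M" for a
    by (intro borel_measurable_sum borel_measurable_power lin_measurable)
  have Eev: "E m w \<in> events" for m w unfolding E_def by measurable
  \<comment> \<open>With t = ln (e p / m) in \<open>int_ball_card\<close> its second term becomes 4
    m / e \<le> 2 m, no larger in order than the first.\<close>
  have t: "exp (- ?l m) = real m / (exp 1 * real p)" if "1 \<le> m" for m
    using that p by (simp add: exp_minus)
  have fin: "finite (int_ball p R)" for R by (rule int_ball_card(1)[OF order_refl])
  define Bad1 where "Bad1 = (\<Union>m\<in>{1..p}. \<Union>w\<in>int_ball p (real m). E m w)"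
  have m1: "real m / exp 1 \<le> real m / 2" for m :: nat
    using exp_ge_add_one_self[of 1] by (intro divide_left_mono) auto
  have Em: "prob (\<Union>w\<in>int_ball p (real m). E m w) \<le> exp (- ?n) * exp (- real m)" if m: "1 \<le> m" "m \<le> p" for m
  proof -
    have one: "prob (E m w) \<le> exp ?n * exp (- (4 * (?n + real m * ?l m)))" if "w \<in> int_ball p (real m)" for w
    proof -
      have "4 * (1 / (4 * K\<^sup>2 * real m)) * (K\<^sup>2 * sq (emb w)) = sq (emb w) / real m"
        using K m by simp
      also have "\<dots> \<le> 1" using that m by (simp add: sq_emb int_ball_def)
      finally have c: "4 * (1 / (4 * K\<^sup>2 * real m)) * (K\<^sup>2 * sq (emb w)) \<le> 1" .
      have "prob (E m w) \<le> 2 ^ card I * exp (- (1 / (4 * K\<^sup>2 * real m)) * u m)"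
        unfolding E_def using K m c by (intro sum_sq_upper_tail) auto
      also have "- (1 / (4 * K\<^sup>2 * real m)) * u m = - (4 * (?n + real m * ?l m))"
        using K m by (simp add: u_def add_divide_distrib)
      also have "2 ^ card I * exp (- (4 * (?n + real m * ?l m))) \<le> exp ?n * exp (- (4 * (?n + real m * ?l m)))"
        by (intro mult_right_mono two_power_le_exp) simp
      finally show ?thesis .
    qed
    have "prob (\<Union>w\<in>int_ball p (real m). E m w) \<le> (\<Sum>w\<in>int_ball p (real m). prob (E m w))"
      using Eev fin by (intro finite_measure_subadditive_finite) auto
    also have "\<dots> \<le> (\<Sum>w\<in>int_ball p (real m). exp ?n * exp (- (4 * (?n + real m * ?l m))))"
      by (intro sum_mono one)
    also have "\<dots> = real (card (int_ball p (real m))) * (exp ?n * exp (- (4 * (?n + real m * ?l m))))" by simp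
    also have "\<dots> \<le> exp (?l m * real m + 4 * real p * exp (- ?l m)) * (exp ?n * exp (- (4 * (?n + real m * ?l m))))"
      by (intro mult_right_mono int_ball_card(2) log_rate_ge_one m) simp
    also have "\<dots> = exp (?l m * real m + 4 * real p * exp (- ?l m) + (?n + - (4 * (?n + real m * ?l m))))"
      by (simp only: exp_add)
    also have "\<dots> \<le> exp (- ?n + - real m)"
    proof (subst exp_le_cancel_iff)
      have "4 * real p * exp (- ?l m) = 4 * (real m / exp 1)" using p by (simp add: t[OF m(1)])
      also have "\<dots> \<le> 2 * real m" using m1[of m] by simp
      finally have "4 * real p * exp (- ?l m) \<le> 2 * real m" .
      moreover have "real m * 1 \<le> real m * ?l m" using m by (intro mult_left_mono log_rate_ge_one) auto
      ultimately show "?l m * real m + 4 * real p * exp (- ?l m) + (?n + - (4 * (?n + real m * ?l m))) \<le> - ?n + - real m"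
        by (simp add: algebra_simps)
    qed
    finally show ?thesis by (simp only: exp_add)
  qed
  have Bad1: "Bad1 \<in> events" "prob Bad1 \<le> exp (- ?n)"
  proof -
    have U: "(\<Union>w\<in>int_ball p (real m). E m w) \<in> events" for m
      by (intro sets.finite_UN fin Eev)
    show "Bad1 \<in> events" unfolding Bad1_def by (intro sets.finite_UN U) simp
    have "prob Bad1 \<le> (\<Sum>m\<in>{1..p}. prob (\<Union>w\<in>int_ball p (real m). E m w))"
      unfolding Bad1_def using U by (intro finite_measure_subadditive_finite) auto
    also have "\<dots> \<le> (\<Sum>m\<in>{1..p}. exp (- ?n) * exp (- real m))" by (intro sum_mono Em) auto
    also have "\<dots> \<le> exp (- ?n) * 1"
      unfolding sum_distrib_left[symmetric] by (intro mult_left_mono sum_exp_neg_le) simp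
    finally show "prob Bad1 \<le> exp (- ?n)" by simp
  qed
  define \<kappa> where "\<kappa> = re_kappa K"
  have kap: "0 < \<kappa>" using K re_kappa_pos by (simp add: \<kappa>_def)
  let ?Ms = "{m \<in> {1..p}. real m * ?l m \<le> \<kappa> * ?n}"
  \<comment> \<open>The largest level at which the union bound over lattice points is affordable.
    Level 1 qualifies by \<open>logp\<close>, so the maximum exists.\<close>
  define m0 where "m0 = Max ?Ms"
  have "1 \<in> ?Ms" using p logp by (simp add: \<kappa>_def)
  then have "m0 \<in> ?Ms" unfolding m0_def by (intro Max_in) auto
  then have m0: "1 \<le> m0" "m0 \<le> p" "real m0 * ?l m0 \<le> \<kappa> * ?n" by auto
  have large: "\<kappa> * ?n \<le> real m * ?l m" if "m0 < m" "m \<le> p" for m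
  proof (rule ccontr)
    assume "\<not> \<kappa> * ?n \<le> real m * ?l m"
    then have "m \<in> ?Ms" using that by auto
    then have "m \<le> m0" unfolding m0_def by (intro Max_ge) auto
    then show False using that by simp
  qed
  define R where "R = real m0 * (8 * (1 + 4 * K))\<^sup>2"
  define F where "F w = {x \<in> space M. (\<Sum>k\<in>I. (lin k (emb w) x)\<^sup>2) \<le> ?n * sq (emb w) / 2}" for w
  have Fev: "F w \<in> events" for w unfolding F_def by measurable
  define Bad2 where "Bad2 = (\<Union>w\<in>{w \<in> int_ball p R. 0 < sq (emb w)}. F w)"
  have Bad2: "Bad2 \<in> events" "prob Bad2 \<le> exp (- ?n / (1536 * K ^ 4))"
  proof -
    show "Bad2 \<in> events" unfolding Bad2_def using fin by (intro sets.finite_UN Fev) auto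
    have "prob Bad2 \<le> (\<Sum>w\<in>{w \<in> int_ball p R. 0 < sq (emb w)}. prob (F w))"
      unfolding Bad2_def using Fev fin by (intro finite_measure_subadditive_finite) auto
    also have "\<dots> \<le> (\<Sum>w\<in>{w \<in> int_ball p R. 0 < sq (emb w)}. exp (- ?n / (768 * K ^ 4)))"
      unfolding F_def by (intro sum_mono sum_sq_lower_tail) auto
    also have "\<dots> \<le> (\<Sum>w\<in>int_ball p R. exp (- ?n / (768 * K ^ 4)))"
      using fin by (intro sum_mono2) auto
    also have "\<dots> = real (card (int_ball p R)) * exp (- ?n / (768 * K ^ 4))" by simp
    also have "\<dots> \<le> exp (?l m0 * R + 4 * real p * exp (- ?l m0)) * exp (- ?n / (768 * K ^ 4))"
      by (intro mult_right_mono int_ball_card(2) log_rate_ge_one m0) simp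
    also have "\<dots> = exp (?l m0 * R + 4 * real p * exp (- ?l m0) + - ?n / (768 * K ^ 4))" by (simp only: exp_add)
    also have "\<dots> \<le> exp (- ?n / (1536 * K ^ 4))"
    proof (subst exp_le_cancel_iff)
      have "4 * real p * exp (- ?l m0) = 4 * (real m0 / exp 1)" using p by (simp add: t[OF m0(1)])
      also have "\<dots> \<le> 2 * (real m0 * 1)" using m1[of m0] by simp
      also have "\<dots> \<le> 2 * (real m0 * ?l m0)" using m0 by (intro mult_left_mono log_rate_ge_one) auto
      finally have "?l m0 * R + 4 * real p * exp (- ?l m0) \<le> (real m0 * ?l m0) * ((8 * (1 + 4 * K))\<^sup>2 + 2)"
        by (simp add: R_def algebra_simps)
      also have "\<dots> \<le> (\<kappa> * ?n) * ((8 * (1 + 4 * K))\<^sup>2 + 2)" by (intro mult_right_mono m0) simp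
      also have "\<dots> = ?n / (1536 * K ^ 4)"
      proof -
        have "(8 * (1 + 4 * K))\<^sup>2 + 2 = 64 * (1 + 4 * K)\<^sup>2 + 2" by (simp only: power_mult_distrib) simp
        moreover have "64 * (1 + 4 * K)\<^sup>2 + 2 \<noteq> 0" by (smt (verit) zero_le_power2)
        ultimately show ?thesis unfolding \<kappa>_def re_kappa_def by simp
      qed
      finally show "?l m0 * R + 4 * real p * exp (- ?l m0) + - ?n / (768 * K ^ 4) \<le> - ?n / (1536 * K ^ 4)"
        by (simp add: field_simps)
    qed
    finally show "prob Bad2 \<le> exp (- ?n / (1536 * K ^ 4))" .
  qed
  have good: "L2_set \<delta> {..<p} / 4 - re_const K * slope_norm 1 (card I) p \<delta>
         \<le> mnorm I p (\<lambda>k j. Z (k, j) x) \<delta> / sqrt ?n" if x: "x \<in> space M - (Bad1 \<union> Bad2)" for x \<delta>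
    unfolding re_const_def \<kappa>_def[symmetric]
  proof (rule restricted_eigenvalue[OF n p _ kap m0(1) large])
    show "0 \<le> 4 * K" using K by simp
    fix m e assume m: "1 \<le> m" "m \<le> p" and e: "sign_vec p m e"
    define w :: "nat \<Rightarrow> int" where "w = restrict (\<lambda>j. \<lfloor>e j\<rfloor>) {..<p}"
    have we: "real_of_int (w j) = e j" if "j < p" for j
    proof -
      have "e j = -1 \<or> e j = 0 \<or> e j = 1" using e that by (simp add: sign_vec_def)
      then show ?thesis using that by (elim disjE) (simp_all add: w_def)
    qed
    have "(\<Sum>j<p. (real_of_int (w j))\<^sup>2) = (\<Sum>j<p. if e j \<noteq> 0 then 1 else 0)"
      using e we by (intro sum.cong) (auto simp: sign_vec_def)
    also have "\<dots> = real (card {j. j < p \<and> e j \<noteq> 0})" by (simp add: sum.If_cases Int_def)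
    also have "\<dots> = real m" using e by (simp add: sign_vec_def)
    finally have "w \<in> int_ball p (real m)" by (simp add: int_ball_def w_def)
    then have "x \<notin> E m w" using x m by (auto simp: Bad1_def)
    then have "(\<Sum>k\<in>I. (lin k (emb w) x)\<^sup>2) \<le> u m" using x by (auto simp: E_def)
    then have "sqrt (\<Sum>k\<in>I. (lin k (emb w) x)\<^sup>2) \<le> sqrt (u m)" by (rule real_sqrt_le_mono)
    also have "sqrt (\<Sum>k\<in>I. (lin k (emb w) x)\<^sup>2) = mnorm I p (\<lambda>k j. Z (k, j) x) e"
      unfolding mnorm_emb[symmetric] using we by (intro mnorm_cong) auto
    also have "sqrt (u m) = 4 * K * sqrt (real m * ?n + (real m)\<^sup>2 * ?l m)"
    proof -
      have "u m = (4 * K)\<^sup>2 * (real m * ?n + (real m)\<^sup>2 * ?l m)"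
        by (simp add: u_def power2_eq_square algebra_simps)
      then show ?thesis using K by (simp add: real_sqrt_mult)
    qed
    also have "\<dots> \<le> 4 * K * (sqrt (real m * ?n) + real m * sqrt (?l m))"
    proof -
      have "sqrt (real m * ?n + (real m)\<^sup>2 * ?l m) \<le> sqrt (real m * ?n) + sqrt ((real m)\<^sup>2 * ?l m)"
        using log_rate_ge_one[OF m] by (intro sqrt_add_le_add_sqrt) auto
      then show ?thesis using K by (simp add: real_sqrt_mult)
    qed
    finally show "mnorm I p (\<lambda>k j. Z (k, j) x) e \<le> 4 * K * (sqrt (real m * ?n) + real m * sqrt (?l m))" .
  next
    fix w :: "nat \<Rightarrow> int" assume w: "(\<Sum>j<p. (real_of_int (w j))\<^sup>2) \<le> real m0 * (8 * (1 + 4 * K))\<^sup>2"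
    define w' where "w' = restrict w {..<p}"
    have s: "sq (emb w') = (\<Sum>j<p. (real_of_int (w j))\<^sup>2)" by (simp add: sq_emb w'_def)
    have L: "L2_set (\<lambda>j. real_of_int (w j)) {..<p} = sqrt (sq (emb w'))" by (simp add: L2_set_def s)
    have Mn: "mnorm I p (\<lambda>k j. Z (k, j) x) (\<lambda>j. real_of_int (w j)) = sqrt (\<Sum>k\<in>I. (lin k (emb w') x)\<^sup>2)"
      unfolding mnorm_emb[symmetric] by (intro mnorm_cong) (simp add: w'_def)
    have "?n / 2 * sq (emb w') \<le> (\<Sum>k\<in>I. (lin k (emb w') x)\<^sup>2)"
    proof (cases "0 < sq (emb w')")
      case True
      have "w' \<in> int_ball p R" using w by (simp add: int_ball_def w'_def R_def)
      then have "x \<notin> F w'" using x True by (auto simp: Bad2_def)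
      then show ?thesis using x by (auto simp: F_def)
    next
      case False
      then have "sq (emb w') = 0" using sq_nonneg[of "emb w'"] by linarith
      then show ?thesis by (simp add: sum_nonneg)
    qed
    from real_sqrt_le_mono[OF this]
    show "sqrt (?n / 2) * L2_set (\<lambda>j. real_of_int (w j)) {..<p} \<le> mnorm I p (\<lambda>k j. Z (k, j) x) (\<lambda>j. real_of_int (w j))"
      unfolding L Mn real_sqrt_mult .
  qed
  show ?thesis
  proof (rule that[of "Bad1 \<union> Bad2"])
    show "Bad1 \<union> Bad2 \<in> events" using Bad1 Bad2 by auto
    show "prob (Bad1 \<union> Bad2) \<le> exp (- ?n) + exp (- ?n / (1536 * K ^ 4))"
      using measure_Un_le[OF Bad1(1) Bad2(1)] Bad1(2) Bad2(2) by linarith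
  qed (rule good)
qed

end

section \<open>The debiased vectors\<close>

lemma fact_double_le: "(fact (2 * r) :: real) \<le> 4 ^ r * (fact r)\<^sup>2"
proof (induction r)
  case (Suc r)
  have "(fact (2 * Suc r) :: real) = (2 * real r + 2) * (2 * real r + 1) * fact (2 * r)"
    by (simp add: algebra_simps)
  also have "\<dots> \<le> (4 * (real r + 1)\<^sup>2) * (4 ^ r * (fact r)\<^sup>2)"
  proof (rule mult_mono)
    show "(2 * real r + 2) * (2 * real r + 1) \<le> 4 * (real r + 1)\<^sup>2"
      by (simp add: power2_eq_square algebra_simps)
  qed (use Suc in auto)
  also have "\<dots> = 4 ^ Suc r * (fact (Suc r))\<^sup>2"
  proof -
    have "(fact (Suc r) :: real) = (real r + 1) * fact r" by (simp add: algebra_simps)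
    then show ?thesis by (simp only: power_mult_distrib power_Suc mult_ac)
  qed
  finally show ?case .
qed simp

lemma exp_le_quadratic:
  fixes x :: real
  shows "exp x \<le> 1 + x + x\<^sup>2 / 2 * exp \<bar>x\<bar>"
proof -
  have "\<exists>t. \<bar>t\<bar> \<le> \<bar>x\<bar> \<and> exp x = (\<Sum>m<2. x ^ m / fact m) + exp t / fact 2 * x ^ 2"
    by (rule Maclaurin_exp_le)
  then obtain t where t: "\<bar>t\<bar> \<le> \<bar>x\<bar>" "exp x = 1 + x + exp t / 2 * x\<^sup>2"
    by (auto simp: numeral_2_eq_2)
  have "exp t * x\<^sup>2 \<le> exp \<bar>x\<bar> * x\<^sup>2" using t(1) by (intro mult_right_mono) auto
  then show ?thesis using t(2) by (simp add: mult.commute)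
qed

lemma power_sum_le:
  fixes a b :: real
  assumes "0 \<le> a" "0 \<le> b"
  shows "(a + b) ^ r \<le> 2 ^ r * (a ^ r + b ^ r)"
proof -
  have "(a + b) ^ r \<le> (2 * max a b) ^ r" using assms by (intro power_mono) auto
  also have "\<dots> \<le> 2 ^ r * (a ^ r + b ^ r)" using assms by (auto simp: power_mult_distrib max_def)
  finally show ?thesis .
qed

lemma sum_power_le:
  fixes a b :: real
  assumes "0 \<le> a" "0 \<le> b" "1 \<le> r"
  shows "a ^ r + b ^ r \<le> (a + b) ^ r"
proof -
  obtain q where r: "r = Suc q" using assms(3) by (cases r) auto
  have "a * a ^ q + b * b ^ q \<le> a * (a + b) ^ q + b * (a + b) ^ q"
    using assms by (intro add_mono mult_left_mono power_mono) auto
  then show ?thesis by (simp add: r algebra_simps)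
qed

text \<open>Markov's inequality for the r-th power of Y^2. Of the threshold factor 2 e^2, the part
  e^2 produces exp (- 2 r), while 2^r absorbs the leading 2 of the moment bound. The case B = 0 is
  apart because the proof divides by the threshold.\<close>

lemma (in prob_space) even_moment_tail:
  fixes Y :: "'a \<Rightarrow> real"
  assumes [measurable]: "random_variable borel Y" and r: "1 \<le> r" and B: "0 \<le> B"
    and mom: "(\<integral>\<^sup>+ x. ennreal (Y x ^ (2 * r)) \<partial>M) \<le> ennreal (2 * B ^ r)"
  shows "prob {x \<in> space M. 2 * exp 2 * B < (Y x)\<^sup>2} \<le> exp (- real (2 * r))"
proof (cases "B = 0")
  case True
  then have "(\<integral>\<^sup>+ x. ennreal (Y x ^ (2 * r)) \<partial>M) = 0" using mom r by (simp add: power_0_left)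
  then have "AE x in M. ennreal (Y x ^ (2 * r)) = 0" by (subst (asm) nn_integral_0_iff_AE) auto
  then have "AE x in M. \<not> 2 * exp 2 * B < (Y x)\<^sup>2"
    by eventually_elim (auto simp: True ennreal_eq_0_iff power_mult power_le_zero_eq)
  then have "prob {x \<in> space M. 2 * exp 2 * B < (Y x)\<^sup>2} = 0"
    by (subst prob_eq_0) auto
  then show ?thesis by simp
next
  case False
  define T where "T = 2 * exp 2 * B"
  have T: "0 < T" using False B by (simp add: T_def)
  have "emeasure M {x \<in> space M. 1 \<le> ennreal (1 / T ^ r) * ennreal (Y x ^ (2 * r))}
     \<le> ennreal (1 / T ^ r) * (\<integral>\<^sup>+ x. ennreal (Y x ^ (2 * r)) * indicator (space M) x \<partial>M)"
    by (rule nn_integral_Markov_inequality) auto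
  also have "(\<integral>\<^sup>+ x. ennreal (Y x ^ (2 * r)) * indicator (space M) x \<partial>M) = (\<integral>\<^sup>+ x. ennreal (Y x ^ (2 * r)) \<partial>M)"
    by (intro nn_integral_cong) auto
  also have "ennreal (1 / T ^ r) * \<dots> \<le> ennreal (1 / T ^ r) * ennreal (2 * B ^ r)"
    by (intro mult_left_mono mom) simp
  also have "\<dots> = ennreal (1 / T ^ r * (2 * B ^ r))" using T by (intro ennreal_mult'[symmetric]) simp
  finally have "emeasure M {x \<in> space M. 1 \<le> ennreal (1 / T ^ r) * ennreal (Y x ^ (2 * r))} \<le> ennreal (1 / T ^ r * (2 * B ^ r))"
    by (simp add: mult_left_mono)
  then have "prob {x \<in> space M. 1 \<le> ennreal (1 / T ^ r) * ennreal (Y x ^ (2 * r))} \<le> 1 / T ^ r * (2 * B ^ r)"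
    using T B by (simp add: emeasure_eq_measure ennreal_le_iff)
  moreover have "prob {x \<in> space M. T < (Y x)\<^sup>2} \<le> prob {x \<in> space M. 1 \<le> ennreal (1 / T ^ r) * ennreal (Y x ^ (2 * r))}"
  proof (rule finite_measure_mono)
    show "{x \<in> space M. T < (Y x)\<^sup>2} \<subseteq> {x \<in> space M. 1 \<le> ennreal (1 / T ^ r) * ennreal (Y x ^ (2 * r))}"
    proof safe
      fix x assume x: "T < (Y x)\<^sup>2"
      have "T ^ r \<le> ((Y x)\<^sup>2) ^ r" using x T by (intro power_mono) auto
      then have "1 \<le> 1 / T ^ r * Y x ^ (2 * r)" using T unfolding power_mult[of "Y x" 2 r] by (simp add: field_simps del: power_mult)
      then show "1 \<le> ennreal (1 / T ^ r) * ennreal (Y x ^ (2 * r))"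
        using T by (subst ennreal_mult'[symmetric]) (auto simp flip: ennreal_1 intro: ennreal_leI)
    qed
  qed measurable
  moreover have "1 / T ^ r * (2 * B ^ r) \<le> exp (- real (2 * r))"
  proof -
    have "T ^ r = 2 ^ r * exp 2 ^ r * B ^ r" by (simp add: T_def power_mult_distrib)
    then have "1 / T ^ r * (2 * B ^ r) = 2 / 2 ^ r * (1 / exp 2 ^ r)" using False B by simp
    also have "\<dots> \<le> 1 * (1 / exp 2 ^ r)"
    proof (rule mult_right_mono)
      have "(2::real) ^ 1 \<le> 2 ^ r" using r by (intro power_increasing) auto
      then show "2 / 2 ^ r \<le> (1::real)" by simp
    qed simp
    also have "\<dots> = exp (- real (2 * r))" by (simp add: exp_minus exp_of_nat_mult[symmetric] field_simps)
    finally show ?thesis .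
  qed
  ultimately show ?thesis unfolding T_def by linarith
qed

section \<open>Exponential moments of linear forms in the debiased vectors\<close>

context design
begin

text \<open>Coordinate p holds the noise: \<open>lin k (comb \<Delta> 1)\<close> is the residual of
  row k in units of \<sigma>, and \<open>lin k (comb a 0)\<close> is a pure design form.\<close>

definition comb :: "vec \<Rightarrow> real \<Rightarrow> vec" where
  "comb a c = (\<lambda>j. if j < p then a j else c)"

lemma sq_comb: "sq (comb a c) = (\<Sum>j<p. (a j)\<^sup>2) + c\<^sup>2"
  unfolding sq_def lessThan_Suc_atMost[symmetric] by (simp add: comb_def)

lemma lin_comb: "lin k (comb a c) x = (\<Sum>j<p. a j * Z (k, j) x) + c * Z (k, p) x"
  unfolding lin_def lessThan_Suc_atMost[symmetric] by (simp add: comb_def)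

lemma lin_comb_cov:
  assumes "k \<in> I"
  shows "expectation (\<lambda>x. lin k (comb a c) x * lin k (comb b d) x) = (\<Sum>j<p. a j * b j) + c * d"
  unfolding lin_cov(2)[OF assms] lessThan_Suc_atMost[symmetric] by (simp add: comb_def)

definition wvec :: "vec \<Rightarrow> nat \<Rightarrow> 'a \<Rightarrow> vec" where
  "wvec \<Delta> k x = (\<lambda>j\<in>{..<p}. Z (k, j) x * lin k (comb \<Delta> 1) x - \<Delta> j)"

lemma inner_wvec:
  "(\<Sum>j<p. a j * wvec \<Delta> k x j) = lin k (comb a 0) x * lin k (comb \<Delta> 1) x - (\<Sum>j<p. a j * \<Delta> j)"
  by (simp add: wvec_def lin_comb[of k a] right_diff_distrib sum_subtractf sum_distrib_right mult.assoc)

lemma wvec_measurable: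
  assumes k: "k \<in> I"
  shows "wvec \<Delta> k \<in> M \<rightarrow>\<^sub>M vec_space {..<p}"
  unfolding wvec_def vec_space_def using k by (intro measurable_restrict) auto

lemma wvec_indep: "indep_vars (\<lambda>_. vec_space {..<p}) (wvec \<Delta>) I"
proof (rule indep_blocks[where f = "\<lambda>k y. \<lambda>j\<in>{..<p}. y (k, j) * (\<Sum>i\<le>p. comb \<Delta> 1 i * y (k, i)) - \<Delta> j"])
  fix k assume "k \<in> I"
  show "(\<lambda>y. \<lambda>j\<in>{..<p}. y (k, j) * (\<Sum>i\<le>p. comb \<Delta> 1 i * y (k, i)) - \<Delta> j)
      \<in> PiM ({k} \<times> {..p}) (\<lambda>_. borel) \<rightarrow>\<^sub>M vec_space {..<p}"
    unfolding vec_space_def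
    by (intro measurable_restrict borel_measurable_diff borel_measurable_times borel_measurable_sum
          measurable_component_singleton borel_measurable_const) auto
next
  fix k x assume "k \<in> I"
  show "wvec \<Delta> k x = (\<lambda>j\<in>{..<p}. (\<lambda>i\<in>{k} \<times> {..p}. Z i x) (k, j) *
      (\<Sum>i\<le>p. comb \<Delta> 1 i * (\<lambda>i\<in>{k} \<times> {..p}. Z i x) (k, i)) - \<Delta> j)"
    by (auto simp: wvec_def lin_def intro!: restrict_ext)
qed

context
  fixes C0 :: real and \<Delta> :: vec
  assumes C0: "0 \<le> C0" and Del: "(\<Sum>j<p. (\<Delta> j)\<^sup>2) \<le> C0\<^sup>2"
begin

text \<open>The largest exponent at which \<open>exp_sq_lin\<close> covers every form with
  \<open>sq a\<close> up to C0^2 + 1. Both the residual \<open>comb \<Delta> 1\<close> and all unit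
  vectors are of this kind.\<close>

definition lam :: real where "lam = 1 / (4 * K\<^sup>2 * (C0\<^sup>2 + 1))"

lemma C0_pos: "0 < C0\<^sup>2 + 1" by (intro add_nonneg_pos) auto

lemma lam_pos: "0 < lam" using K C0_pos by (simp add: lam_def)

lemma lam_le: "sq a \<le> C0\<^sup>2 + 1 \<Longrightarrow> 4 * lam * (K\<^sup>2 * sq a) \<le> 1"
  using K C0_pos by (simp add: lam_def)

text \<open>In a unit direction the form is A B - E (A B) with two subgaussian factors, and \<bar>A
  B\<bar> \<le> (A^2 + B^2) / 2 gives it an exponential moment. In the second-order expansion of the
  exponential the linear term vanishes by centering, which makes the bound quadratic in the length
  of \<open>a\<close>.\<close>

lemma wvec_mgf:
  assumes k: "k \<in> I" and a: "(\<Sum>j<p. (a j)\<^sup>2) \<le> (lam / 2)\<^sup>2"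
  shows "(\<integral>\<^sup>+ x. ennreal (exp (\<Sum>j<p. a j * wvec \<Delta> k x j)) \<partial>M)
    \<le> ennreal (exp (8 * exp (lam * C0) / lam\<^sup>2 * (\<Sum>j<p. (a j)\<^sup>2)))"
proof (cases "(\<Sum>j<p. (a j)\<^sup>2) = 0")
  case True
  then have "\<forall>j\<in>{..<p}. (a j)\<^sup>2 = 0" by (subst (asm) sum_nonneg_eq_0_iff) auto
  then have "(\<Sum>j<p. a j * wvec \<Delta> k x j) = 0" for x by (intro sum.neutral) auto
  then show ?thesis unfolding True by (simp add: emeasure_space_1)
next
  case False
  define V where "V = (\<Sum>j<p. (a j)\<^sup>2)"
  have V: "0 < V" using False sum_nonneg[of "{..<p}" "\<lambda>j. (a j)\<^sup>2"] by (auto simp: V_def order_less_le)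
  define t where "t = sqrt V"
  have t: "0 < t" "t\<^sup>2 = V" using V by (auto simp: t_def)
  have tl: "t \<le> lam / 2"
    unfolding t_def V_def using a lam_pos by (intro real_le_lsqrt) auto
  define h where "h = (\<lambda>j. a j / t)"
  have h: "(\<Sum>j<p. (h j)\<^sup>2) = 1"
    using V by (simp add: h_def power_divide sum_divide_distrib[symmetric] t V_def[symmetric])
  define g where "g = (\<Sum>j<p. h j * \<Delta> j)"
  have g: "\<bar>g\<bar> \<le> C0"
  proof -
    have "\<bar>g\<bar> \<le> (\<Sum>j<p. \<bar>h j\<bar> * \<bar>\<Delta> j\<bar>)"
      unfolding g_def by (rule order_trans[OF sum_abs]) (simp add: abs_mult)
    also have "\<dots> \<le> L2_set h {..<p} * L2_set \<Delta> {..<p}" by (rule L2_set_mult_ineq)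
    also have "L2_set h {..<p} = 1" by (simp add: L2_set_def h)
    also have "L2_set \<Delta> {..<p} \<le> C0" unfolding L2_set_def using Del C0 by (intro real_le_lsqrt) auto
    finally show ?thesis by simp
  qed
  let ?A = "lin k (comb h 0)" and ?B = "lin k (comb \<Delta> 1)"
  let ?G = "\<lambda>x. ?A x * ?B x - g"
  have Gint: "integrable M ?G" "expectation ?G = 0"
    using lin_cov(1)[OF k, of "comb h 0" "comb \<Delta> 1"] lin_comb_cov[OF k, of h 0 \<Delta> 1]
    by (auto simp: g_def prob_space)
  have e1: "(\<Sum>j<p. a j * wvec \<Delta> k x j) = t * ?G x" for x
  proof -
    have "(\<Sum>j<p. a j * wvec \<Delta> k x j) = t * (\<Sum>j<p. h j * wvec \<Delta> k x j)"
      using t by (simp add: h_def sum_distrib_left)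
    then show ?thesis by (simp add: inner_wvec g_def)
  qed
  have pt1: "exp (lam * \<bar>?G x\<bar>) \<le> exp (lam * C0) / 2 * (exp (lam * (?A x)\<^sup>2) + exp (lam * (?B x)\<^sup>2))" for x
  proof -
    let ?p = "lam * (?A x)\<^sup>2" and ?q = "lam * (?B x)\<^sup>2"
    have "2 * (\<bar>?A x\<bar> * \<bar>?B x\<bar>) \<le> (?A x)\<^sup>2 + (?B x)\<^sup>2"
      using sum_squares_bound[of "\<bar>?A x\<bar>" "\<bar>?B x\<bar>"] by simp
    moreover have "\<bar>?G x\<bar> \<le> \<bar>?A x\<bar> * \<bar>?B x\<bar> + \<bar>g\<bar>"
      using abs_triangle_ineq4[of "?A x * ?B x" g] unfolding abs_mult .
    moreover have "w \<le> a / 2" if "2 * w \<le> a" for w a :: real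
      using that by simp
    ultimately have "\<bar>?G x\<bar> \<le> ((?A x)\<^sup>2 + (?B x)\<^sup>2) / 2 + C0"
      by (meson add_mono g order_trans)
    then have "lam * \<bar>?G x\<bar> \<le> lam * (((?A x)\<^sup>2 + (?B x)\<^sup>2) / 2 + C0)" using lam_pos by (intro mult_left_mono) auto
    also have "\<dots> = ?p / 2 + ?q / 2 + lam * C0" by (simp add: algebra_simps add_divide_distrib)
    finally have "exp (lam * \<bar>?G x\<bar>) \<le> exp (?p / 2) * exp (?q / 2) * exp (lam * C0)"
      by (simp add: exp_add[symmetric])
    also have "exp (?p / 2) * exp (?q / 2) \<le> (exp ?p + exp ?q) / 2"
    proof -
      have "(exp (?p / 2))\<^sup>2 = exp ?p" "(exp (?q / 2))\<^sup>2 = exp ?q" by (simp_all add: exp_double[symmetric])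
      then show ?thesis using sum_squares_bound[of "exp (?p / 2)" "exp (?q / 2)"] by simp
    qed
    finally show ?thesis by (simp add: mult_ac mult_right_mono)
  qed
  have m1: "(\<integral>\<^sup>+ x. ennreal (exp (lam * \<bar>?G x\<bar>)) \<partial>M) \<le> ennreal (2 * exp (lam * C0))"
  proof -
    have "(\<integral>\<^sup>+ x. ennreal (exp (lam * \<bar>?G x\<bar>)) \<partial>M)
        \<le> (\<integral>\<^sup>+ x. ennreal (exp (lam * C0) / 2) * (ennreal (exp (lam * (?A x)\<^sup>2)) + ennreal (exp (lam * (?B x)\<^sup>2))) \<partial>M)"
      using pt1 by (intro nn_integral_mono) (simp flip: ennreal_mult' ennreal_plus add: ennreal_leI)
    also have "\<dots> = ennreal (exp (lam * C0) / 2) * ((\<integral>\<^sup>+ x. ennreal (exp (lam * (?A x)\<^sup>2)) \<partial>M) + (\<integral>\<^sup>+ x. ennreal (exp (lam * (?B x)\<^sup>2)) \<partial>M))"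
      using k by (subst nn_integral_cmult, measurable) (subst nn_integral_add, measurable)
    also have "\<dots> \<le> ennreal (exp (lam * C0) / 2) * (2 + 2)"
      using C0 Del lam_pos by (intro mult_left_mono add_mono exp_sq_lin k lam_le) (auto simp: sq_comb h)
    also have "\<dots> = ennreal (exp (lam * C0) / 2) * ennreal 4" by simp
    also have "\<dots> = ennreal (exp (lam * C0) / 2 * 4)" by (intro ennreal_mult'[symmetric]) simp
    finally show ?thesis by (simp add: mult.commute)
  qed
  have ig: "integrable M (\<lambda>x. exp (lam * \<bar>?G x\<bar>))" "expectation (\<lambda>x. exp (lam * \<bar>?G x\<bar>)) \<le> 2 * exp (lam * C0)"
    using k by (intro nn_integral_le_imp_integrable[OF _ _ m1]; simp)+
  \<comment> \<open>Since t \<le> \<open>lam\<close> / 2, only half of the available exponent is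
    spent on exp \<bar>t G\<bar>; the other half absorbs the factor G^2.\<close>
  have pt2: "exp (t * ?G x) \<le> 1 + t * ?G x + V * (4 / lam\<^sup>2) * exp (lam * \<bar>?G x\<bar>)" for x
  proof -
    let ?G' = "?G x"
    have "(t * ?G')\<^sup>2 / 2 * exp \<bar>t * ?G'\<bar> \<le> V * (4 / lam\<^sup>2) * exp (lam * \<bar>?G'\<bar>)"
    proof -
      have "(lam / 2 * \<bar>?G'\<bar>) ^ 2 \<le> fact 2 * exp (lam / 2 * \<bar>?G'\<bar>)"
        using lam_pos by (intro power_le_fact_exp) simp
      then have "?G'\<^sup>2 / 2 \<le> 4 / lam\<^sup>2 * exp (lam / 2 * \<bar>?G'\<bar>)"
        using lam_pos by (simp add: power_mult_distrib power_divide fact_2 field_simps)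
      then have "V * (?G'\<^sup>2 / 2) \<le> V * (4 / lam\<^sup>2 * exp (lam / 2 * \<bar>?G'\<bar>))" using V by (intro mult_left_mono) auto
      moreover have "exp \<bar>t * ?G'\<bar> \<le> exp (lam / 2 * \<bar>?G'\<bar>)"
      proof -
        have "\<bar>t * ?G'\<bar> = t * \<bar>?G'\<bar>" using t by (simp add: abs_mult)
        also have "\<dots> \<le> lam / 2 * \<bar>?G'\<bar>" by (rule mult_right_mono[OF tl abs_ge_zero])
        finally show ?thesis by (simp only: exp_le_cancel_iff)
      qed
      ultimately have "V * (?G'\<^sup>2 / 2) * exp \<bar>t * ?G'\<bar> \<le> V * (4 / lam\<^sup>2 * exp (lam / 2 * \<bar>?G'\<bar>)) * exp (lam / 2 * \<bar>?G'\<bar>)"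
        by (rule mult_mono) (use V in auto)
      also have "\<dots> = V * (4 / lam\<^sup>2) * exp (lam * \<bar>?G'\<bar>)"
        by (simp add: mult.assoc exp_add[symmetric])
      also have "V * (?G'\<^sup>2 / 2) * exp \<bar>t * ?G'\<bar> = (t * ?G')\<^sup>2 / 2 * exp \<bar>t * ?G'\<bar>"
        by (simp add: power_mult_distrib t)
      finally show ?thesis .
    qed
    then show ?thesis using exp_le_quadratic[of "t * ?G'"] by linarith
  qed
  have it: "integrable M (\<lambda>x. exp (t * ?G x))"
  proof (rule Bochner_Integration.integrable_bound[OF ig(1)])
    show "AE x in M. norm (exp (t * ?G x)) \<le> norm (exp (lam * \<bar>?G x\<bar>))"
    proof (rule AE_I2)
      fix x
      have "t * ?G x \<le> lam * \<bar>?G x\<bar>"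
      proof -
        have "t * ?G x \<le> t * \<bar>?G x\<bar>" using t by (intro mult_left_mono) auto
        also have "\<dots> \<le> lam * \<bar>?G x\<bar>" using tl lam_pos by (intro mult_right_mono) auto
        finally show ?thesis .
      qed
      then show "norm (exp (t * ?G x)) \<le> norm (exp (lam * \<bar>?G x\<bar>))" by simp
    qed
  qed (use k in measurable)
  have "expectation (\<lambda>x. exp (t * ?G x)) \<le> expectation (\<lambda>x. 1 + t * ?G x + V * (4 / lam\<^sup>2) * exp (lam * \<bar>?G x\<bar>))"
    by (intro integral_mono it pt2) (intro Bochner_Integration.integrable_add integrable_mult_right Gint ig integrable_const)
  also have "\<dots> = 1 + t * expectation ?G + V * (4 / lam\<^sup>2) * expectation (\<lambda>x. exp (lam * \<bar>?G x\<bar>))"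
    using Gint(1) ig(1) by (simp only: Bochner_Integration.integral_add Bochner_Integration.integrable_add integrable_mult_right integral_mult_right_zero integrable_const) (simp add: prob_space)
  also have "\<dots> \<le> 1 + V * (4 / lam\<^sup>2) * (2 * exp (lam * C0))"
    unfolding Gint(2) using mult_left_mono[OF ig(2), of "V * (4 / lam\<^sup>2)"] V by simp
  also have "\<dots> \<le> exp (V * (4 / lam\<^sup>2) * (2 * exp (lam * C0)))" by (rule exp_ge_add_one_self)
  also have "V * (4 / lam\<^sup>2) * (2 * exp (lam * C0)) = 8 * exp (lam * C0) / lam\<^sup>2 * V" by simp
  finally show ?thesis unfolding e1 V_def[symmetric]
    using it by (subst nn_integral_eq_integral) (auto intro: ennreal_leI)
qed

end

end

section \<open>Moments of the squared norms of the debiased vectors\<close>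

context design
begin

lemma exp_interpolation:
  fixes z \<theta> :: real
  assumes "0 \<le> \<theta>" "\<theta> \<le> 1"
  shows "exp (\<theta> * z) \<le> 1 - \<theta> + \<theta> * exp z"
  using convex_onD[OF exp_convex assms, of 0 z] by simp

text \<open>In 48 = 4 * 4 * 3, the first 4 splits off the centering, the second sits in the moment
  bound of the product, and 3 bounds e. The summand 4 C^2 is the centering itself.\<close>

definition Dc :: "real \<Rightarrow> real" where "Dc C = 48 / (lam C)\<^sup>2 + 4 * C\<^sup>2"

context
  fixes C0 :: real and \<Delta> :: vec
  assumes C0: "0 \<le> C0" and Del: "(\<Sum>j<p. (\<Delta> j)\<^sup>2) \<le> C0\<^sup>2"
begin

lemma lam_positive: "0 < lam C0" by (rule lam_pos[OF C0 Del])

text \<open>Convexity turns the bound 2 at exponent \<open>lam C0\<close> into 1 + \<theta> \<le>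
  exp \<theta> at the fraction \<theta> of it. A whole row of p squares then costs exp (p \<theta>),
  which is only exp r at \<theta> = r / p.\<close>

lemma row_sq_mgf:
  assumes k: "k \<in> I" and \<theta>: "0 \<le> \<theta>" "\<theta> \<le> 1"
  shows "(\<integral>\<^sup>+ x. ennreal (exp (\<theta> * lam C0 * (\<Sum>j<p. (Z (k, j) x)\<^sup>2))) \<partial>M) \<le> ennreal (exp (real p * \<theta>))"
proof -
  have one: "(\<integral>\<^sup>+ x. ennreal (exp (\<theta> * (lam C0 * (Z (k, j) x)\<^sup>2))) \<partial>M) \<le> ennreal (exp \<theta>)" if j: "j < p" for j
  proof -
    define e :: vec where "e = (\<lambda>i. if i = j then 1 else 0)"
    have l: "lin k e x = Z (k, j) x" for x
      using j by (simp add: lin_def e_def if_distrib[of "\<lambda>c. c * _"] sum.delta cong: if_cong)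
    have s: "sq e = 1" using j by (simp add: sq_def e_def if_distrib[of "\<lambda>c. c\<^sup>2"] sum.delta cong: if_cong)
    have m: "(\<integral>\<^sup>+ x. ennreal (exp (lam C0 * (Z (k, j) x)\<^sup>2)) \<partial>M) \<le> 2"
      using exp_sq_lin[OF k, of "lam C0" e] lam_positive lam_le[OF C0 Del, of e] by (simp add: l s)
    have [measurable]: "Z (k, j) \<in> borel_measurable M" using k j by simp
    have "(\<integral>\<^sup>+ x. ennreal (exp (\<theta> * (lam C0 * (Z (k, j) x)\<^sup>2))) \<partial>M)
        \<le> (\<integral>\<^sup>+ x. ennreal (1 - \<theta>) + ennreal \<theta> * ennreal (exp (lam C0 * (Z (k, j) x)\<^sup>2)) \<partial>M)"
      using \<theta> exp_interpolation[OF \<theta>]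
      by (intro nn_integral_mono) (simp flip: ennreal_mult' ennreal_plus add: ennreal_leI)
    also have "\<dots> = ennreal (1 - \<theta>) + ennreal \<theta> * (\<integral>\<^sup>+ x. ennreal (exp (lam C0 * (Z (k, j) x)\<^sup>2)) \<partial>M)"
      by (subst nn_integral_add, measurable) (subst nn_integral_cmult, measurable, simp add: emeasure_space_1)
    also have "\<dots> \<le> ennreal (1 - \<theta>) + ennreal \<theta> * ennreal 2"
      using m by (intro add_mono mult_left_mono) auto
    also have "\<dots> = ennreal (1 + \<theta>)" using \<theta> by (subst ennreal_mult'[symmetric]) (auto simp flip: ennreal_plus)
    also have "\<dots> \<le> ennreal (exp \<theta>)" by (intro ennreal_leI exp_ge_add_one_self)
    finally show ?thesis .
  qed
  have iv: "indep_vars (\<lambda>_. borel) (\<lambda>j. Z (k, j)) {..<p}"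
    by (rule indep_vars_subset[OF indep_row[OF k]]) auto
  have "(\<integral>\<^sup>+ x. ennreal (exp (\<theta> * lam C0 * (\<Sum>j<p. (Z (k, j) x)\<^sup>2))) \<partial>M)
      = (\<integral>\<^sup>+ x. (\<Prod>j\<in>{..<p}. ennreal (exp (\<theta> * (lam C0 * (Z (k, j) x)\<^sup>2)))) \<partial>M)"
    by (simp add: sum_distrib_left exp_sum prod_ennreal mult.assoc)
  also have "\<dots> = (\<Prod>j\<in>{..<p}. \<integral>\<^sup>+ x. ennreal (exp (\<theta> * (lam C0 * (Z (k, j) x)\<^sup>2))) \<partial>M)"
    by (rule indep_vars_nn_integral[OF _ indep_vars_compose2[OF iv]]) auto
  also have "\<dots> \<le> (\<Prod>j\<in>{..<p}. ennreal (exp \<theta>))" by (intro prod_mono_ennreal one) auto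
  also have "\<dots> = ennreal (exp (real p * \<theta>))" by (simp add: ennreal_power exp_of_nat_mult)
  finally show ?thesis .
qed

text \<open>Up to centering, the squared norm is u^2 S with u the residual and S the squared length
  of the row; they are dependent. The factor r! is due to u^2 alone: S is of order p, and for r
  \<le> p its r-th moment is p^r up to a constant to the power r, which the exponent \<theta> = r /
  p detects.\<close>

lemma wvec_sq_moment:
  assumes k: "k \<in> I" and r: "r \<le> p"
  shows "(\<integral>\<^sup>+ x. ennreal ((\<Sum>j<p. (wvec \<Delta> k x j)\<^sup>2) ^ r) \<partial>M) \<le> ennreal ((Dc C0 * real p) ^ r * fact r)"
proof (cases "r = 0")
  case True
  show ?thesis unfolding True power_0 fact_0 by (simp add: emeasure_space_1)
next
  case False
  then have r1: "1 \<le> r" and p0: "0 < p" using r by auto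
  let ?u = "lin k (comb \<Delta> 1)"
  let ?S = "\<lambda>x. \<Sum>j<p. (Z (k, j) x)\<^sup>2"
  define \<theta> where "\<theta> = real r / real p"
  have th: "0 < \<theta>" "\<theta> \<le> 1" "real p * \<theta> = real r" using r1 r p0 by (auto simp: \<theta>_def)
  have S0: "0 \<le> ?S x" for x by (intro sum_nonneg) auto
  have [measurable]: "?S \<in> borel_measurable M" using k by (intro borel_measurable_sum borel_measurable_power) auto
  have w: "(\<Sum>j<p. (wvec \<Delta> k x j)\<^sup>2) \<le> 2 * ((?u x)\<^sup>2 * ?S x) + 2 * C0\<^sup>2" for x
  proof -
    have "(\<Sum>j<p. (wvec \<Delta> k x j)\<^sup>2) \<le> (\<Sum>j<p. 2 * (?u x)\<^sup>2 * (Z (k, j) x)\<^sup>2 + 2 * (\<Delta> j)\<^sup>2)"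
    proof (rule sum_mono)
      fix j assume "j \<in> {..<p}"
      then have e: "wvec \<Delta> k x j = Z (k, j) x * ?u x - \<Delta> j" by (simp add: wvec_def)
      have sqd: "(a - d)\<^sup>2 \<le> 2 * a\<^sup>2 + 2 * d\<^sup>2" for a d :: real
        using zero_le_power2[of "a + d"] by (simp add: power2_diff power2_sum)
      have "(wvec \<Delta> k x j)\<^sup>2 \<le> 2 * (Z (k, j) x * ?u x)\<^sup>2 + 2 * (\<Delta> j)\<^sup>2"
        unfolding e by (rule sqd)
      also have "(Z (k, j) x * ?u x)\<^sup>2 = (?u x)\<^sup>2 * (Z (k, j) x)\<^sup>2"
        by (simp only: power_mult_distrib mult.commute)
      finally show "(wvec \<Delta> k x j)\<^sup>2 \<le> 2 * (?u x)\<^sup>2 * (Z (k, j) x)\<^sup>2 + 2 * (\<Delta> j)\<^sup>2"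
        by (simp only: mult.assoc)
    qed
    also have "\<dots> = 2 * ((?u x)\<^sup>2 * ?S x) + 2 * (\<Sum>j<p. (\<Delta> j)\<^sup>2)"
      unfolding sum.distrib sum_distrib_left[symmetric] mult.assoc ..
    finally show ?thesis using Del by linarith
  qed
  define Q where "Q = real p ^ r * fact r * (4 / (lam C0)\<^sup>2) ^ r"
  have Q0: "0 \<le> Q" using lam_positive by (simp add: Q_def)
  have uS: "((?u x)\<^sup>2 * ?S x) ^ r \<le> Q / 2 * (exp (lam C0 * (?u x)\<^sup>2) + exp (\<theta> * lam C0 * ?S x))" for x
  proof -
    let ?f = "fact r :: real"
    define a where "a = (lam C0 * (?u x)\<^sup>2) ^ r"
    define b where "b = (\<theta> * lam C0 * ?S x) ^ r"
    have a0: "0 \<le> a" "0 \<le> b" using lam_positive th S0[of x] by (auto simp: a_def b_def)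
    have ab: "a * b = (\<theta> * (lam C0)\<^sup>2) ^ r * ((?u x)\<^sup>2 * ?S x) ^ r"
      by (simp add: a_def b_def power_mult_distrib power2_eq_square mult_ac)
    have F: "(fact (2 * r) :: real) \<le> 4 ^ r * ?f\<^sup>2" by (rule fact_double_le)
    have a2: "a\<^sup>2 \<le> 4 ^ r * ?f\<^sup>2 * exp (lam C0 * (?u x)\<^sup>2)"
    proof -
      have "a\<^sup>2 = (lam C0 * (?u x)\<^sup>2) ^ (2 * r)" by (simp add: a_def power_mult[symmetric] mult.commute)
      also have "\<dots> \<le> fact (2 * r) * exp (lam C0 * (?u x)\<^sup>2)" using lam_positive by (intro power_le_fact_exp) simp
      also have "\<dots> \<le> 4 ^ r * ?f\<^sup>2 * exp (lam C0 * (?u x)\<^sup>2)" by (intro mult_right_mono F) simp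
      finally show ?thesis .
    qed
    have b2: "b\<^sup>2 \<le> (4 * (real r)\<^sup>2) ^ r * exp (\<theta> * lam C0 * ?S x)"
    proof -
      have "b\<^sup>2 = (\<theta> * lam C0 * ?S x) ^ (2 * r)" by (simp add: b_def power_mult[symmetric] mult.commute)
      also have "\<dots> \<le> fact (2 * r) * exp (\<theta> * lam C0 * ?S x)" using lam_positive th S0[of x] by (intro power_le_fact_exp) simp
      also have "\<dots> \<le> ((real (2 * r))\<^sup>2) ^ r * exp (\<theta> * lam C0 * ?S x)" by (intro mult_right_mono fact_le_power2) simp
      finally show ?thesis by (simp add: power_mult_distrib)
    qed
    have rr: "0 < real r ^ r" "0 < ?f" using r1 by auto
    text \<open>AM-GM with the weights \<open>r\<^sup>r\<close> and \<open>r!\<close> balances the two factors.\<close>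
    have "2 * ((real r ^ r * a) * (?f * b)) \<le> (real r ^ r * a)\<^sup>2 + (?f * b)\<^sup>2"
      using sum_squares_bound[of "real r ^ r * a" "?f * b"] by (simp add: mult.assoc)
    also have "\<dots> = (real r ^ r)\<^sup>2 * a\<^sup>2 + ?f\<^sup>2 * b\<^sup>2" by (simp add: power_mult_distrib)
    also have "\<dots> \<le> (real r ^ r)\<^sup>2 * (4 ^ r * ?f\<^sup>2 * exp (lam C0 * (?u x)\<^sup>2)) + ?f\<^sup>2 * ((4 * (real r)\<^sup>2) ^ r * exp (\<theta> * lam C0 * ?S x))"
      by (intro add_mono mult_left_mono a2 b2) auto
    also have "\<dots> = (4 ^ r * (real r ^ r)\<^sup>2 * ?f\<^sup>2) * (exp (lam C0 * (?u x)\<^sup>2) + exp (\<theta> * lam C0 * ?S x))"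
      by (simp add: power_mult_distrib power_mult[symmetric] algebra_simps)
    finally have "(real r ^ r * ?f) * (2 * (a * b)) \<le> (real r ^ r * ?f) * (4 ^ r * real r ^ r * ?f * (exp (lam C0 * (?u x)\<^sup>2) + exp (\<theta> * lam C0 * ?S x)))"
      by (simp add: power2_eq_square mult_ac)
    then have "2 * (a * b) \<le> 4 ^ r * real r ^ r * ?f * (exp (lam C0 * (?u x)\<^sup>2) + exp (\<theta> * lam C0 * ?S x))"
      using rr by (subst (asm) mult_le_cancel_left_pos) (auto intro: mult_pos_pos)
    then have "(\<theta> * (lam C0)\<^sup>2) ^ r * ((?u x)\<^sup>2 * ?S x) ^ r \<le> (\<theta> * (lam C0)\<^sup>2) ^ r * (Q / 2 * (exp (lam C0 * (?u x)\<^sup>2) + exp (\<theta> * lam C0 * ?S x)))"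
    proof -
      have "(\<theta> * (lam C0)\<^sup>2) ^ r * Q = 4 ^ r * real r ^ r * ?f"
        using lam_positive p0 by (simp add: Q_def \<theta>_def power_mult_distrib power_divide)
      moreover have "A * (Q / 2 * E) = A * Q * E / 2" for A E :: real by simp
      ultimately have "(\<theta> * (lam C0)\<^sup>2) ^ r * (Q / 2 * (exp (lam C0 * (?u x)\<^sup>2) + exp (\<theta> * lam C0 * ?S x)))
        = 4 ^ r * real r ^ r * ?f * (exp (lam C0 * (?u x)\<^sup>2) + exp (\<theta> * lam C0 * ?S x)) / 2"
        by (simp only:)
      then show ?thesis using \<open>2 * (a * b) \<le> _\<close> unfolding ab by linarith
    qed
    then show ?thesis using th lam_positive by (subst (asm) mult_le_cancel_left_pos) auto
  qed
  have muS: "(\<integral>\<^sup>+ x. ennreal (((?u x)\<^sup>2 * ?S x) ^ r) \<partial>M) \<le> ennreal (Q * 3 ^ r)"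
  proof -
    have "(\<integral>\<^sup>+ x. ennreal (((?u x)\<^sup>2 * ?S x) ^ r) \<partial>M)
      \<le> (\<integral>\<^sup>+ x. ennreal (Q / 2) * (ennreal (exp (lam C0 * (?u x)\<^sup>2)) + ennreal (exp (\<theta> * lam C0 * ?S x))) \<partial>M)"
      using uS Q0 by (intro nn_integral_mono) (simp flip: ennreal_mult' ennreal_plus add: ennreal_leI)
    also have "\<dots> = ennreal (Q / 2) * ((\<integral>\<^sup>+ x. ennreal (exp (lam C0 * (?u x)\<^sup>2)) \<partial>M) + (\<integral>\<^sup>+ x. ennreal (exp (\<theta> * lam C0 * ?S x)) \<partial>M))"
      using k by (subst nn_integral_cmult, measurable) (subst nn_integral_add, measurable)
    also have "\<dots> \<le> ennreal (Q / 2) * (ennreal 2 + ennreal (exp (real p * \<theta>)))"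
    proof (intro mult_left_mono add_mono)
      show "(\<integral>\<^sup>+ x. ennreal (exp (lam C0 * (?u x)\<^sup>2)) \<partial>M) \<le> ennreal 2"
        using exp_sq_lin[OF k, of "lam C0" "comb \<Delta> 1"] lam_positive lam_le[OF C0 Del, of "comb \<Delta> 1"] Del by (simp add: sq_comb)
      show "(\<integral>\<^sup>+ x. ennreal (exp (\<theta> * lam C0 * ?S x)) \<partial>M) \<le> ennreal (exp (real p * \<theta>))"
        using row_sq_mgf[OF k, of \<theta>] th by simp
    qed simp
    also have "\<dots> = ennreal (Q / 2 * (2 + exp (real r)))"
      unfolding th(3) using Q0 by (subst ennreal_plus[symmetric], simp, simp) (subst ennreal_mult'[symmetric], auto)
    also have "\<dots> \<le> ennreal (Q * 3 ^ r)"
    proof (rule ennreal_leI)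
      have "exp (real r) = exp 1 ^ r" by (simp add: exp_of_nat_mult[symmetric])
      also have "\<dots> \<le> 3 ^ r" using exp_le by (intro power_mono) auto
      finally have "exp (real r) \<le> 3 ^ r" .
      moreover have "(3::real) ^ 1 \<le> 3 ^ r" using r1 by (intro power_increasing) auto
      ultimately have "2 + exp (real r) \<le> 2 * 3 ^ r" by simp
      from mult_left_mono[OF this, of "Q / 2"] Q0 show "Q / 2 * (2 + exp (real r)) \<le> Q * 3 ^ r" by simp
    qed
    finally show ?thesis .
  qed
  have "(\<integral>\<^sup>+ x. ennreal ((\<Sum>j<p. (wvec \<Delta> k x j)\<^sup>2) ^ r) \<partial>M)
      \<le> (\<integral>\<^sup>+ x. ennreal (4 ^ r) * ennreal (((?u x)\<^sup>2 * ?S x) ^ r) + ennreal ((4 * C0\<^sup>2) ^ r) \<partial>M)"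
  proof (rule nn_integral_mono)
    fix x
    have us0: "0 \<le> (?u x)\<^sup>2 * ?S x" using S0[of x] by simp
    have "(\<Sum>j<p. (wvec \<Delta> k x j)\<^sup>2) ^ r \<le> (2 * ((?u x)\<^sup>2 * ?S x) + 2 * C0\<^sup>2) ^ r"
      by (intro power_mono w sum_nonneg) auto
    also have "\<dots> \<le> 2 ^ r * ((2 * ((?u x)\<^sup>2 * ?S x)) ^ r + (2 * C0\<^sup>2) ^ r)"
      using us0 by (intro power_sum_le) auto
    also have "\<dots> = 4 ^ r * ((?u x)\<^sup>2 * ?S x) ^ r + (4 * C0\<^sup>2) ^ r"
    proof -
      have a: "2 ^ r * (2 * X) ^ r = (4 * X) ^ r" for X :: real
        unfolding power_mult_distrib[symmetric] by simp
      show ?thesis unfolding distrib_left a by (simp only: power_mult_distrib[of 4 "(?u x)\<^sup>2 * ?S x"])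
    qed
    finally show "ennreal ((\<Sum>j<p. (wvec \<Delta> k x j)\<^sup>2) ^ r) \<le> ennreal (4 ^ r) * ennreal (((?u x)\<^sup>2 * ?S x) ^ r) + ennreal ((4 * C0\<^sup>2) ^ r)"
      using us0 by (simp flip: ennreal_mult' ennreal_plus add: ennreal_leI)
  qed
  also have "\<dots> = ennreal (4 ^ r) * (\<integral>\<^sup>+ x. ennreal (((?u x)\<^sup>2 * ?S x) ^ r) \<partial>M) + ennreal ((4 * C0\<^sup>2) ^ r)"
    using k by (subst nn_integral_add, measurable) (subst nn_integral_cmult, measurable, simp add: emeasure_space_1)
  also have "\<dots> \<le> ennreal (4 ^ r) * ennreal (Q * 3 ^ r) + ennreal ((4 * C0\<^sup>2) ^ r)"
    by (intro add_mono mult_left_mono muS) auto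
  also have "\<dots> = ennreal (4 ^ r * (Q * 3 ^ r) + (4 * C0\<^sup>2) ^ r)"
    using Q0 by (simp flip: ennreal_mult' ennreal_plus)
  also have "\<dots> \<le> ennreal ((Dc C0 * real p) ^ r * fact r)"
  proof (rule ennreal_leI)
    have "4 ^ r * (Q * 3 ^ r) = (48 / (lam C0)\<^sup>2) ^ r * (real p ^ r * fact r)"
    proof -
      have "(48 / (lam C0)\<^sup>2) ^ r = (4 * 3 * (4 / (lam C0)\<^sup>2)) ^ r" by simp
      also have "\<dots> = 4 ^ r * 3 ^ r * (4 / (lam C0)\<^sup>2) ^ r" by (simp only: power_mult_distrib)
      finally show ?thesis by (simp add: Q_def mult_ac)
    qed
    moreover have "(4 * C0\<^sup>2) ^ r \<le> (4 * C0\<^sup>2) ^ r * (real p ^ r * fact r)"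
    proof -
      have "1 * 1 \<le> real p ^ r * (fact r :: real)" using p0 by (intro mult_mono one_le_power) auto
      then show ?thesis using mult_left_mono[of 1 "real p ^ r * fact r" "(4 * C0\<^sup>2) ^ r"] by simp
    qed
    ultimately have "4 ^ r * (Q * 3 ^ r) + (4 * C0\<^sup>2) ^ r \<le> ((48 / (lam C0)\<^sup>2) ^ r + (4 * C0\<^sup>2) ^ r) * (real p ^ r * fact r)"
      by (simp add: distrib_right)
    also have "\<dots> \<le> Dc C0 ^ r * (real p ^ r * fact r)"
      unfolding Dc_def using r1 by (intro mult_right_mono sum_power_le) auto
    finally show "4 ^ r * (Q * 3 ^ r) + (4 * C0\<^sup>2) ^ r \<le> (Dc C0 * real p) ^ r * fact r"
      by (simp add: power_mult_distrib)
  qed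
  finally show ?thesis .
qed

end

end

section \<open>Tail bounds for a fixed pilot error\<close>

context design
begin

context
  fixes C0 :: real and \<Delta> :: vec
  assumes C0: "0 \<le> C0" and Del: "(\<Sum>j<p. (\<Delta> j)\<^sup>2) \<le> C0\<^sup>2"
begin

definition mgf_const :: real where "mgf_const = 8 * exp (lam C0 * C0) / (lam C0)\<^sup>2"

text \<open>The \<gamma> of \<open>subexp_vectors\<close> at radius \<open>lam C0 / 2\<close>. It is
  written out in terms of \<open>K\<close> and \<open>C0\<close> because \<open>tail_const\<close>
  refers to it before any law is given.\<close>

definition gam :: real where
  "gam = exp (2 * mgf_const * (lam C0 / 2)\<^sup>2) / (lam C0 / 2)\<^sup>2"

definition lin_stat :: "vec \<Rightarrow> 'a \<Rightarrow> real" where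
  "lin_stat \<theta> x = (\<Sum>k\<in>I. \<Sum>j<p. \<theta> j * wvec \<Delta> k x j)"

definition quad_stat :: "'a \<Rightarrow> real" where
  "quad_stat x = (\<Sum>k\<in>I. \<Sum>l\<in>I - {k}. \<Sum>j<p. wvec \<Delta> k x j * wvec \<Delta> l x j)"

lemma wvec_tails:
  assumes r: "1 \<le> r" "2 * r \<le> card I" "2 * r \<le> p"
  shows "prob {x \<in> space M. 2 * exp 2 * (gam * real (2 * r) * real (card I) * (\<Sum>j<p. (\<theta> j)\<^sup>2)) < (lin_stat \<theta> x)\<^sup>2}
      \<le> exp (- real (2 * r))" (is ?lin)
    and "prob {x \<in> space M. 2 * exp 2 * (real (2 * r) * (real (card I))\<^sup>2 * real p * (512 * gam * Dc C0 + 4096 * gam\<^sup>2)) < (quad_stat x)\<^sup>2}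
      \<le> exp (- real (2 * r))" (is ?quad)
proof -
  let ?V = "vec_space {..<p}"
  \<comment> \<open>The locale \<open>indep_vectors\<close> asks for a probability law at every
    index, so a constant vector fills the indices outside \<open>I\<close>.\<close>
  define W where "W k = (if k \<in> I then wvec \<Delta> k else (\<lambda>_. \<lambda>j\<in>{..<p}. 0))" for k
  define \<nu> where "\<nu> k = distr M ?V (W k)" for k
  have Wm [measurable]: "W k \<in> M \<rightarrow>\<^sub>M ?V" for k
    by (cases "k \<in> I") (auto simp: W_def vec_space_def intro!: wvec_measurable[unfolded vec_space_def] measurable_restrict)
  have comp [measurable]: "(\<lambda>w. w j) \<in> borel_measurable ?V" if "j < p" for j
    unfolding vec_space_def using that by (intro measurable_component_singleton) auto
  interpret N: indep_vectors I "{..<p}" \<nu>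
  proof (rule indep_vectors.intro)
    show "prob_space (\<nu> k)" for k unfolding \<nu>_def by (rule prob_space_distr[OF Wm])
  qed (auto simp: \<nu>_def finI)
  have lp: "0 < lam C0" by (rule lam_pos[OF C0 Del])
  have mc: "0 \<le> mgf_const" unfolding mgf_const_def by simp
  have dc: "0 \<le> Dc C0" unfolding Dc_def by simp
  interpret S: subexp_vectors I "{..<p}" \<nu> "lam C0 / 2" mgf_const "Dc C0 * real p" p
  proof
    show "0 < lam C0 / 2" using lp by simp
    show "0 \<le> mgf_const" by (rule mc)
    show "0 \<le> Dc C0 * real p" using dc by simp
    have ips: "N.ip a b = (\<Sum>j<p. a j * b j)" for a b by (simp add: N.ip_def)
    fix k a assume k: "k \<in> I" and a: "N.ip a a \<le> (lam C0 / 2)\<^sup>2"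
    have "(\<integral>\<^sup>+ w. ennreal (exp (N.ip a w)) \<partial>\<nu> k) = (\<integral>\<^sup>+ x. ennreal (exp (N.ip a (wvec \<Delta> k x))) \<partial>M)"
      using k unfolding \<nu>_def ips by (subst nn_integral_distr) (auto simp: W_def[of k] intro!: wvec_measurable)
    also have "\<dots> \<le> ennreal (exp (mgf_const * N.ip a a))"
      using wvec_mgf[OF C0 Del k, of a] a by (simp add: ips mgf_const_def power2_eq_square)
    finally show "(\<integral>\<^sup>+ w. ennreal (exp (N.ip a w)) \<partial>\<nu> k) \<le> ennreal (exp (mgf_const * N.ip a a))" .
  next
    have ips: "N.ip a b = (\<Sum>j<p. a j * b j)" for a b by (simp add: N.ip_def)
    fix k r assume k: "k \<in> I" and r: "r \<le> p"
    have "(\<integral>\<^sup>+ w. ennreal (N.ip w w ^ r) \<partial>\<nu> k) = (\<integral>\<^sup>+ x. ennreal (N.ip (wvec \<Delta> k x) (wvec \<Delta> k x) ^ r) \<partial>M)"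
      using k unfolding \<nu>_def ips by (subst nn_integral_distr) (auto simp: W_def[of k] intro!: wvec_measurable)
    also have "\<dots> \<le> ennreal ((Dc C0 * real p) ^ r * fact r)"
      using wvec_sq_moment[OF C0 Del k r] by (simp add: ips power2_eq_square)
    finally show "(\<integral>\<^sup>+ w. ennreal (N.ip w w ^ r) \<partial>\<nu> k) \<le> ennreal ((Dc C0 * real p) ^ r * fact r)" .
  qed
  have g: "S.\<gamma> = gam" unfolding S.\<gamma>_def gam_def ..
  have gp: "0 < gam" using S.gamma_pos unfolding g .
  have I0: "I \<noteq> {}" using r by auto
  have sP: "sets (PiM I \<nu>) = sets (PiM I (\<lambda>_. ?V))" by (rule sets_PiM_cong) (auto simp: \<nu>_def)
  have P: "PiM I \<nu> = distr M (PiM I (\<lambda>_. ?V)) (\<lambda>x. \<lambda>k\<in>I. wvec \<Delta> k x)"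
  proof -
    have "distr M (PiM I (\<lambda>_. ?V)) (\<lambda>x. \<lambda>k\<in>I. wvec \<Delta> k x) = (\<Pi>\<^sub>M k\<in>I. distr M ?V (wvec \<Delta> k))"
      using wvec_indep wvec_measurable by (subst indep_vars_iff_distr_eq_PiM'[OF I0, symmetric]) auto
    also have "\<dots> = PiM I \<nu>" by (intro PiM_cong) (auto simp: \<nu>_def W_def)
    finally show ?thesis by simp
  qed
  have tr: "(\<integral>\<^sup>+ y. ennreal (f y) \<partial>PiM I \<nu>) = (\<integral>\<^sup>+ x. ennreal (f (\<lambda>k\<in>I. wvec \<Delta> k x)) \<partial>M)"
    if f: "f \<in> borel_measurable (PiM I \<nu>)" for f :: "(nat \<Rightarrow> vec) \<Rightarrow> real"
  proof -
    have f': "(\<lambda>y. ennreal (f y)) \<in> borel_measurable (PiM I (\<lambda>_. ?V))"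
      using f unfolding measurable_cong_sets[OF sP refl] by measurable
    show ?thesis unfolding P
      by (subst nn_integral_distr) (auto intro!: measurable_restrict wvec_measurable simp: f')
  qed
  have wm: "(\<lambda>x. wvec \<Delta> k x j) \<in> borel_measurable M" if "k \<in> I" "j < p" for k j
    by (rule measurable_compose[OF wvec_measurable[OF that(1)] comp[OF that(2)]])
  let ?n = "real (card I)" and ?q = "real (2 * r)"
  show ?lin
  proof (rule even_moment_tail)
    show "random_variable borel (lin_stat \<theta>)"
      unfolding lin_stat_def[abs_def]
      by (intro borel_measurable_sum borel_measurable_times borel_measurable_const wm) auto
    show "0 \<le> gam * ?q * ?n * (\<Sum>j<p. (\<theta> j)\<^sup>2)" using gp by (intro mult_nonneg_nonneg sum_nonneg) auto
    have "(\<integral>\<^sup>+ x. ennreal (lin_stat \<theta> x ^ (2 * r)) \<partial>M)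
        = (\<integral>\<^sup>+ x. ennreal ((\<Sum>l\<in>I. N.ip \<theta> ((\<lambda>k\<in>I. wvec \<Delta> k x) l)) ^ (2 * r)) \<partial>M)"
      unfolding lin_stat_def by (simp add: N.ip_def)
    also have "\<dots> = (\<integral>\<^sup>+ y. ennreal ((\<Sum>l\<in>I. N.ip \<theta> (y l)) ^ (2 * r)) \<partial>PiM I \<nu>)"
      by (rule tr[symmetric]) (intro borel_measurable_power borel_measurable_sum N.ip_measurable2)
    also have "\<dots> \<le> ennreal (2 * (gam * ?q * ?n * N.ip \<theta> \<theta>) ^ r)"
      using S.linear_moment[OF order_refl order_refl r(1,2), of \<theta>] unfolding g .
    finally show "(\<integral>\<^sup>+ x. ennreal (lin_stat \<theta> x ^ (2 * r)) \<partial>M) \<le> ennreal (2 * (gam * ?q * ?n * (\<Sum>j<p. (\<theta> j)\<^sup>2)) ^ r)"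
      by (simp add: N.ip_def power2_eq_square)
  qed (rule r(1))
  show ?quad
  proof (rule even_moment_tail)
    show "random_variable borel quad_stat"
      unfolding quad_stat_def[abs_def]
      by (intro borel_measurable_sum borel_measurable_times wm) auto
    show "0 \<le> ?q * ?n\<^sup>2 * real p * (512 * gam * Dc C0 + 4096 * gam\<^sup>2)" using gp dc by simp
    have "(\<integral>\<^sup>+ x. ennreal (quad_stat x ^ (2 * r)) \<partial>M)
        = (\<integral>\<^sup>+ x. ennreal (S.offdiag I (\<lambda>k\<in>I. wvec \<Delta> k x) ^ (2 * r)) \<partial>M)"
    proof -
      have "quad_stat x = S.offdiag I (\<lambda>k\<in>I. wvec \<Delta> k x)" for x
        unfolding quad_stat_def S.offdiag_def N.ip_def by (intro sum.cong refl) auto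
      then show ?thesis by simp
    qed
    also have "\<dots> = (\<integral>\<^sup>+ y. ennreal (S.offdiag I y ^ (2 * r)) \<partial>PiM I \<nu>)"
      by (rule tr[symmetric]) (intro borel_measurable_power S.offdiag_measurable order_refl)
    also have "\<dots> \<le> ennreal (2 * (2 * (32 * gam * ?q * ?n) ^ r) * ((Dc C0 * real p) ^ r * pochhammer ?n r)
        + (2 * (32 * gam * ?q * ?n) ^ r)\<^sup>2)"
      using S.offdiag_moment[OF r(1,2)] r(3) unfolding g by simp
    \<comment> \<open>Both summands become r-th powers of multiples of A = 2 r n^2 p. The first uses
      that all factors of the Pochhammer symbol are at most 2 n, the second trades one factor 2 r
      for p.\<close>
    also have "\<dots> \<le> ennreal (2 * (?q * ?n\<^sup>2 * real p * (512 * gam * Dc C0 + 4096 * gam\<^sup>2)) ^ r)"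
    proof (rule ennreal_leI)
      define A where "A = ?q * ?n\<^sup>2 * real p"
      have poch: "pochhammer ?n r \<le> (2 * ?n) ^ r"
      proof -
        have "pochhammer ?n r = (\<Prod>i<r. ?n + real i)" by (simp add: pochhammer_prod atLeast0LessThan)
        also have "\<dots> \<le> (\<Prod>i<r. 2 * ?n)" using r by (intro prod_mono) auto
        finally show ?thesis by simp
      qed
      have x0: "0 \<le> 64 * gam * Dc C0 * A" "0 \<le> 1024 * gam\<^sup>2 * A" using gp dc by (auto simp: A_def)
      have 1: "2 * (2 * (32 * gam * ?q * ?n) ^ r) * ((Dc C0 * real p) ^ r * pochhammer ?n r) \<le> 4 * (64 * gam * Dc C0 * A) ^ r"
      proof -
        have "2 * (2 * (32 * gam * ?q * ?n) ^ r) * ((Dc C0 * real p) ^ r * pochhammer ?n r)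
            \<le> 2 * (2 * (32 * gam * ?q * ?n) ^ r) * ((Dc C0 * real p) ^ r * (2 * ?n) ^ r)"
          using gp dc poch by (intro mult_left_mono) auto
        also have "\<dots> = 4 * ((32 * gam * ?q * ?n) * (Dc C0 * real p) * (2 * ?n)) ^ r"
          by (simp only: power_mult_distrib)
        also have "(32 * gam * ?q * ?n) * (Dc C0 * real p) * (2 * ?n) = 64 * gam * Dc C0 * A"
          by (simp add: A_def power2_eq_square)
        finally show ?thesis .
      qed
      have 2: "(2 * (32 * gam * ?q * ?n) ^ r)\<^sup>2 \<le> 4 * (1024 * gam\<^sup>2 * A) ^ r"
      proof -
        have "(2 * x ^ r)\<^sup>2 = 4 * (x\<^sup>2) ^ r" for x :: real
          by (simp add: power_mult_distrib power_mult[symmetric] mult.commute)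
        then have "(2 * (32 * gam * ?q * ?n) ^ r)\<^sup>2 = 4 * ((32 * gam * ?q * ?n)\<^sup>2) ^ r" .
        also have "\<dots> \<le> 4 * (1024 * gam\<^sup>2 * A) ^ r"
        proof (intro mult_left_mono power_mono)
          have "?q \<le> real p" using r(3) by (simp only: of_nat_le_iff)
          then have "?q * ?q \<le> ?q * real p" by (rule mult_left_mono) simp
          then have "(1024 * gam\<^sup>2 * ?n\<^sup>2) * (?q * ?q) \<le> (1024 * gam\<^sup>2 * ?n\<^sup>2) * (?q * real p)"
            by (rule mult_left_mono) simp
          moreover have "(1024 * gam\<^sup>2 * ?n\<^sup>2) * (?q * ?q) = (32 * gam * ?q * ?n)\<^sup>2"
            by (simp add: power2_eq_square)
          moreover have "(1024 * gam\<^sup>2 * ?n\<^sup>2) * (?q * real p) = 1024 * gam\<^sup>2 * A"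
            by (simp add: A_def)
          ultimately show "(32 * gam * ?q * ?n)\<^sup>2 \<le> 1024 * gam\<^sup>2 * A" by (simp only:)
        qed auto
        finally show ?thesis .
      qed
      have "4 * (64 * gam * Dc C0 * A) ^ r + 4 * (1024 * gam\<^sup>2 * A) ^ r \<le> 4 * (64 * gam * Dc C0 * A + 1024 * gam\<^sup>2 * A) ^ r"
        using sum_power_le[OF x0 r(1)] by simp
      also have "\<dots> \<le> 2 * (4 ^ r * (64 * gam * Dc C0 * A + 1024 * gam\<^sup>2 * A) ^ r)"
      proof -
        have "(4::real) ^ 1 \<le> 4 ^ r" using r(1) by (intro power_increasing) auto
        then have "4 * (64 * gam * Dc C0 * A + 1024 * gam\<^sup>2 * A) ^ r \<le> (2 * 4 ^ r) * (64 * gam * Dc C0 * A + 1024 * gam\<^sup>2 * A) ^ r"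
          using x0 by (intro mult_right_mono) auto
        then show ?thesis by simp
      qed
      also have "\<dots> = 2 * (4 * (64 * gam * Dc C0 * A + 1024 * gam\<^sup>2 * A)) ^ r" by (simp only: power_mult_distrib)
      also have "\<dots> \<le> 2 * (A * (512 * gam * Dc C0 + 4096 * gam\<^sup>2)) ^ r"
        using x0 by (intro mult_left_mono power_mono) (auto simp: algebra_simps)
      finally show "2 * (2 * (32 * gam * ?q * ?n) ^ r) * ((Dc C0 * real p) ^ r * pochhammer ?n r)
        + (2 * (32 * gam * ?q * ?n) ^ r)\<^sup>2 \<le> 2 * (?q * ?n\<^sup>2 * real p * (512 * gam * Dc C0 + 4096 * gam\<^sup>2)) ^ r"
        using 1 2 unfolding A_def[symmetric] by linarith
    qed
    finally show "(\<integral>\<^sup>+ x. ennreal (quad_stat x ^ (2 * r)) \<partial>M) \<le> ennreal (2 * (?q * ?n\<^sup>2 * real p * (512 * gam * Dc C0 + 4096 * gam\<^sup>2)) ^ r)" .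
  qed (rule r(1))
qed

end

end

text \<open>By independence the joint law is a product, and every section over a point of
  \<open>G\<close> has mass at most c. In this way tail bounds for a fixed vector carry over to the
  random pilot error.\<close>

lemma (in prob_space) indep_conditional_bound:
  assumes ind: "indep_var S X T Y"
    and meas: "{z \<in> space (S \<Otimes>\<^sub>M T). G (fst z) \<and> P (fst z) (snd z)} \<in> sets (S \<Otimes>\<^sub>M T)"
    and le: "\<And>a. a \<in> space S \<Longrightarrow> G a \<Longrightarrow> prob {w \<in> space M. P a (Y w)} \<le> c"
    and c: "0 \<le> c"
  shows "prob {w \<in> space M. G (X w) \<and> P (X w) (Y w)} \<le> c"
proof -
  let ?A = "{z \<in> space (S \<Otimes>\<^sub>M T). G (fst z) \<and> P (fst z) (snd z)}"
  have X [measurable]: "X \<in> M \<rightarrow>\<^sub>M S" and Y [measurable]: "Y \<in> M \<rightarrow>\<^sub>M T"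
    using ind by (auto dest: indep_var_rv1 indep_var_rv2)
  interpret DX: prob_space "distr M S X" by (rule prob_space_distr[OF X])
  interpret DY: prob_space "distr M T Y" by (rule prob_space_distr[OF Y])
  have eq: "distr M S X \<Otimes>\<^sub>M distr M T Y = distr M (S \<Otimes>\<^sub>M T) (\<lambda>x. (X x, Y x))"
    using ind by (simp add: indep_var_distribution_eq)
  have "emeasure M {w \<in> space M. G (X w) \<and> P (X w) (Y w)} = emeasure (distr M (S \<Otimes>\<^sub>M T) (\<lambda>x. (X x, Y x))) ?A"
    using meas measurable_space[OF X] measurable_space[OF Y]
    by (subst emeasure_distr) (auto simp: space_pair_measure intro!: arg_cong[where f = "emeasure M"])
  also have "\<dots> = (\<integral>\<^sup>+ a. emeasure (distr M T Y) (Pair a -` ?A) \<partial>distr M S X)"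
    unfolding eq[symmetric] using meas by (intro DY.emeasure_pair_measure_alt) simp
  also have "\<dots> \<le> (\<integral>\<^sup>+ a. ennreal c \<partial>distr M S X)"
  proof (rule nn_integral_mono)
    fix a assume "a \<in> space (distr M S X)"
    then have a: "a \<in> space S" by simp
    show "emeasure (distr M T Y) (Pair a -` ?A) \<le> ennreal c"
    proof (cases "G a")
      case True
      have s: "Pair a -` ?A \<in> sets T" using meas by (rule sets_Pair1)
      have "emeasure (distr M T Y) (Pair a -` ?A) = emeasure M {w \<in> space M. P a (Y w)}"
        using s a True measurable_space[OF Y]
        by (subst emeasure_distr) (auto simp: space_pair_measure intro!: arg_cong[where f = "emeasure M"])
      also have "\<dots> \<le> ennreal c"
        using le[OF a True] by (simp add: emeasure_eq_measure ennreal_leI)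
      finally show ?thesis .
    qed simp
  qed
  also have "\<dots> = ennreal c" by (simp add: DX.emeasure_space_1[simplified])
  finally show ?thesis using c by (simp add: emeasure_eq_measure ennreal_le_iff)
qed

text \<open>Here b is the true coordinate, b - \<sigma> a that of the pilot, and \<sigma> (w k + a)
  the product of design entry and residual. The pilot error cancels identically: (b - \<sigma> a)^2
  + 2 (b - \<sigma> a) \<sigma> a + \<sigma>^2 a^2 = b^2, and the two terms in a w cancel likewise.
  Leaving out the diagonal is what keeps squares of w away.\<close>

lemma debiased_coordinate:
  fixes w :: "nat \<Rightarrow> real" and a b \<sigma> n :: real
  assumes fin: "finite I" and n: "real (card I) = n" "2 \<le> n"
  shows "(b - \<sigma> * a)\<^sup>2 + 2 * (b - \<sigma> * a) / n * (\<Sum>k\<in>I. \<sigma> * (w k + a))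
      + 1 / (n * (n - 1)) * (\<Sum>k\<in>I. \<Sum>l\<in>I - {k}. \<sigma>\<^sup>2 * ((w k + a) * (w l + a)))
    = b\<^sup>2 + 2 * \<sigma> / n * (\<Sum>k\<in>I. b * w k) + \<sigma>\<^sup>2 / (n * (n - 1)) * (\<Sum>k\<in>I. \<Sum>l\<in>I - {k}. w k * w l)"
proof -
  define s where "s = (\<Sum>k\<in>I. w k)"
  define u where "u = (\<Sum>k\<in>I. \<Sum>l\<in>I - {k}. w k * w l)"
  have s1: "(\<Sum>k\<in>I. \<sigma> * (w k + a)) = \<sigma> * (s + n * a)"
    by (simp add: s_def sum_distrib_left[symmetric] sum.distrib n(1))
  have c1: "real (card (I - {k})) = n - 1" if "k \<in> I" for k
    using that fin n by (simp add: card_Diff_singleton of_nat_diff)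
  have "(\<Sum>k\<in>I. \<Sum>l\<in>I - {k}. (w k + a) * (w l + a))
      = (\<Sum>k\<in>I. (\<Sum>l\<in>I - {k}. w k * w l) + ((n - 1) * a * w k + a * (s - w k) + (n - 1) * a\<^sup>2))"
  proof (rule sum.cong[OF refl])
    fix k assume k: "k \<in> I"
    have sk: "(\<Sum>l\<in>I - {k}. w l) = s - w k" using fin k by (simp add: s_def sum_diff1)
    have "(\<Sum>l\<in>I - {k}. (w k + a) * (w l + a)) = (\<Sum>l\<in>I - {k}. w k * w l + a * w l + (a * w k + a\<^sup>2))"
      by (intro sum.cong refl) (simp add: algebra_simps power2_eq_square)
    also have "\<dots> = (\<Sum>l\<in>I - {k}. w k * w l) + a * (s - w k) + (n - 1) * (a * w k + a\<^sup>2)"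
      by (simp add: sum.distrib sum_distrib_left[symmetric] sk c1[OF k])
    finally show "(\<Sum>l\<in>I - {k}. (w k + a) * (w l + a))
        = (\<Sum>l\<in>I - {k}. w k * w l) + ((n - 1) * a * w k + a * (s - w k) + (n - 1) * a\<^sup>2)"
      by (simp add: algebra_simps)
  qed
  also have "\<dots> = u + ((n - 1) * a * s + a * (n * s - s) + n * ((n - 1) * a\<^sup>2))"
    by (simp add: sum.distrib u_def sum_distrib_left[symmetric] sum_subtractf n(1) s_def[symmetric])
  also have "(n - 1) * a * s + a * (n * s - s) + n * ((n - 1) * a\<^sup>2) = n * (n - 1) * (2 * a * s / n + a\<^sup>2)"
    using n by (simp add: field_simps power2_eq_square)
  finally have s2: "(\<Sum>k\<in>I. \<Sum>l\<in>I - {k}. (w k + a) * (w l + a)) = u + n * (n - 1) * (2 * a * s / n + a\<^sup>2)" .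
  have "1 / (n * (n - 1)) * (\<sigma>\<^sup>2 * (u + n * (n - 1) * (2 * a * s / n + a\<^sup>2)))
      = \<sigma>\<^sup>2 / (n * (n - 1)) * u + \<sigma>\<^sup>2 * (2 * a * s / n + a\<^sup>2)"
    using n by (simp add: field_simps)
  moreover have "(b - \<sigma> * a)\<^sup>2 + 2 * (b - \<sigma> * a) / n * (\<sigma> * (s + n * a)) + \<sigma>\<^sup>2 * (2 * a * s / n + a\<^sup>2)
      = b\<^sup>2 + 2 * \<sigma> / n * (b * s)"
    using n by (simp add: field_simps power2_eq_square)
  moreover have s3: "(\<Sum>k\<in>I. \<Sum>l\<in>I - {k}. \<sigma>\<^sup>2 * ((w k + a) * (w l + a)))
      = \<sigma>\<^sup>2 * (\<Sum>k\<in>I. \<Sum>l\<in>I - {k}. (w k + a) * (w l + a))"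
    by (simp only: sum_distrib_left)
  moreover have s4: "(\<Sum>k\<in>I. b * w k) = b * s" by (simp only: s_def sum_distrib_left)
  ultimately show ?thesis
    unfolding s1 s3 s2 s4 u_def[symmetric] by linarith
qed

text \<open>When h \<le> \<tau>, the deviation of q is of order \<tau>^2 and its square root
  suffices. When h > \<tau>, dividing \<bar>q\<bar> - h^2 by sqrt \<bar>q\<bar> + h \<ge> h gains
  the missing factor.\<close>

lemma sqrt_abs_deviation:
  fixes h q \<tau> c :: real
  assumes h: "0 \<le> h" and \<tau>: "0 \<le> \<tau>" and c: "0 \<le> c"
    and d: "(q - h\<^sup>2)\<^sup>2 \<le> c * (\<tau> ^ 4 + \<tau>\<^sup>2 * h\<^sup>2)"
  shows "\<bar>sqrt \<bar>q\<bar> - h\<bar> \<le> (2 + 2 * sqrt c) * \<tau>"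
proof -
  define d where "d = \<bar>q - h\<^sup>2\<bar>"
  have d0: "0 \<le> d" by (simp add: d_def)
  have "d\<^sup>2 \<le> (sqrt c * (\<tau>\<^sup>2 + \<tau> * h))\<^sup>2"
  proof -
    have "\<tau> ^ 4 + \<tau>\<^sup>2 * h\<^sup>2 \<le> (\<tau>\<^sup>2 + \<tau> * h)\<^sup>2"
      using h \<tau> by (simp add: power2_sum power_mult_distrib power_mult[symmetric])
    then have "c * (\<tau> ^ 4 + \<tau>\<^sup>2 * h\<^sup>2) \<le> c * (\<tau>\<^sup>2 + \<tau> * h)\<^sup>2" by (rule mult_left_mono) (rule c)
    then show ?thesis using d c by (simp add: d_def power_mult_distrib)
  qed
  then have db: "d \<le> sqrt c * (\<tau>\<^sup>2 + \<tau> * h)"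
    by (rule power2_le_imp_le) (use c h \<tau> in simp)
  show ?thesis
  proof (cases "h \<le> \<tau>")
    case True
    have "\<tau> * h \<le> \<tau> * \<tau>" using True \<tau> by (intro mult_left_mono)
    then have "sqrt c * (\<tau>\<^sup>2 + \<tau> * h) \<le> sqrt c * (2 * \<tau>\<^sup>2)"
      using c by (intro mult_left_mono) (auto simp: power2_eq_square)
    with db have "d \<le> 2 * sqrt c * \<tau>\<^sup>2" by simp
    also have "\<dots> \<le> ((1 + 2 * sqrt c) * \<tau>)\<^sup>2"
    proof -
      have "2 * sqrt c \<le> (1 + 2 * sqrt c)\<^sup>2" using c by (simp add: power2_sum)
      then show ?thesis by (simp add: power_mult_distrib mult_right_mono)
    qed
    finally have "sqrt d \<le> (1 + 2 * sqrt c) * \<tau>" using c \<tau> by (intro real_le_lsqrt) auto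
    moreover have "sqrt \<bar>q\<bar> \<le> h + sqrt d"
    proof -
      have "\<bar>q\<bar> \<le> h\<^sup>2 + d" using zero_le_power2[of h] unfolding d_def by linarith
      then have "sqrt \<bar>q\<bar> \<le> sqrt (h\<^sup>2 + d)" by (rule real_sqrt_le_mono)
      also have "\<dots> \<le> sqrt (h\<^sup>2) + sqrt d" using d0 by (intro sqrt_add_le_add_sqrt) auto
      finally show ?thesis using h by simp
    qed
    moreover have "\<tau> \<le> (2 + 2 * sqrt c) * \<tau>" "(1 + 2 * sqrt c) * \<tau> \<le> (2 + 2 * sqrt c) * \<tau>"
      using c \<tau> by (auto simp: algebra_simps)
    moreover have "0 \<le> sqrt \<bar>q\<bar>" by simp
    ultimately show ?thesis using True h by linarith
  next
    case False
    then have h0: "0 < h" using \<tau> by linarith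
    have "\<bar>sqrt \<bar>q\<bar> - h\<bar> * h \<le> \<bar>sqrt \<bar>q\<bar> - h\<bar> * (sqrt \<bar>q\<bar> + h)" by (intro mult_left_mono) auto
    also have "\<dots> = \<bar>(sqrt \<bar>q\<bar> - h) * (sqrt \<bar>q\<bar> + h)\<bar>" using h by (simp add: abs_mult)
    also have "(sqrt \<bar>q\<bar> - h) * (sqrt \<bar>q\<bar> + h) = \<bar>q\<bar> - h\<^sup>2"
      by (simp add: algebra_simps power2_eq_square)
    also have "\<bar>\<bar>q\<bar> - h\<^sup>2\<bar> \<le> d" using abs_triangle_ineq3[of q "h\<^sup>2"] by (simp add: d_def)
    also have "d \<le> sqrt c * (\<tau>\<^sup>2 + \<tau> * h)" by (rule db)
    also have "\<dots> \<le> sqrt c * (\<tau> * h + \<tau> * h)"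
      using False \<tau> c by (intro mult_left_mono add_right_mono) (auto simp: power2_eq_square mult_left_mono)
    also have "\<dots> = (2 * sqrt c * \<tau>) * h" by (simp add: algebra_simps)
    finally have "\<bar>sqrt \<bar>q\<bar> - h\<bar> \<le> 2 * sqrt c * \<tau>" using h0 by (rule mult_right_le_imp_le)
    also have "\<dots> \<le> (2 + 2 * sqrt c) * \<tau>" using \<tau> by (simp add: algebra_simps)
    finally show ?thesis .
  qed
qed

section \<open>The estimation bounds\<close>

text \<open>By \<open>slope_pilot_bound\<close> and \<open>noise_tail\<close> the squared pilot
  error is at most 16^2 * 8 K^2 = 2048 K^2 in units of \<sigma>^2, and 48^2 = 2304.\<close>

definition pilot_radius :: "real \<Rightarrow> real" where "pilot_radius K = 48 * K"

text \<open>The 16 exp 2 is the 2 exp 2 of \<open>even_moment_tail\<close> times 8: a 2 from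
  squaring a sum, and a 4 from the coefficient 2 / n or from 1 / (n - 1)^2 \<le> 4 / n^2. Absolute
  values and the added 1 give positivity for every \<open>K\<close>.\<close>

definition tail_const :: "real \<Rightarrow> real" where
  "tail_const K = (let g = design.gam K (pilot_radius K); D = design.Dc K (pilot_radius K)
     in 16 * exp 2 * (\<bar>g\<bar> + \<bar>512 * g * D + 4096 * g\<^sup>2\<bar>) + 1)"

lemma tail_const_pos: "0 < tail_const K"
  by (auto simp: tail_const_def Let_def intro!: add_nonneg_pos mult_nonneg_nonneg)

definition coord :: "nat \<Rightarrow> nat \<times> nat \<Rightarrow> mat \<times> vec \<Rightarrow> real" where
  "coord p ij = (if snd ij < p then entry (fst ij) (snd ij) else noise (fst ij))"

definition observe :: "nat \<Rightarrow> nat \<Rightarrow> vec \<Rightarrow> real \<Rightarrow> mat \<times> vec \<Rightarrow> mat \<times> vec" where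
  "observe N p \<theta> \<sigma> = (\<lambda>(X, \<xi>). (X, \<lambda>i\<in>{..<N}. (\<Sum>j<p. X (i, j) * \<theta> j) + \<sigma> * \<xi> i))"

lemma subgaussian_mono:
  assumes "subgaussian \<Omega> K Z" "0 \<le> K" "K \<le> K'"
  shows "subgaussian \<Omega> K' Z"
  unfolding subgaussian_def
proof (intro allI conjI)
  fix t
  show "integrable \<Omega> (\<lambda>w. exp (t * Z w))" using assms(1) by (simp add: subgaussian_def)
  have "(\<integral>w. exp (t * Z w) \<partial>\<Omega>) \<le> exp (K\<^sup>2 * t\<^sup>2 / 2)" using assms(1) by (simp add: subgaussian_def)
  also have "\<dots> \<le> exp (K'\<^sup>2 * t\<^sup>2 / 2)"
    using assms(2,3) by (simp add: mult_right_mono power_mono)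
  finally show "(\<integral>w. exp (t * Z w) \<partial>\<Omega>) \<le> exp (K'\<^sup>2 * t\<^sup>2 / 2)" .
qed

lemma design_of_law:
  assumes Q: "design_noise_law N p Q" and K: "0 < L" "0 < M"
    and sL: "\<forall>i<N. subgaussian Q L (noise i)"
    and sM: "\<forall>i<N. \<forall>j<p. subgaussian Q M (entry i j)"
    and I: "I \<subseteq> {..<N}"
  shows "design Q (coord p) I p (max L M)"
proof -
  interpret prob_space Q using Q by (simp add: design_noise_law_def)
  define f :: "nat \<times> nat \<Rightarrow> (nat \<times> nat) + nat" where "f = (\<lambda>(i, j). if j < p then Inl (i, j) else Inr i)"
  let ?X = "\<lambda>k. case k of Inl (i, j) \<Rightarrow> entry i j | Inr i \<Rightarrow> noise i"
  have inj: "inj_on f (I \<times> {..p})"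
    by (rule inj_onI) (auto simp: f_def split: if_splits)
  have "f ` (I \<times> {..p}) \<subseteq> ({..<N} \<times> {..<p}) <+> {..<N}"
    using I by (auto simp: f_def)
  then have "indep_vars (\<lambda>_. borel) ?X (f ` (I \<times> {..p}))"
    by (rule indep_vars_subset[rotated]) (use Q in \<open>simp add: design_noise_law_def\<close>)
  from indep_vars_reindex[OF inj this]
  have iv: "indep_vars (\<lambda>_. borel) (\<lambda>ij. ?X (f ij)) (I \<times> {..p})" .
  have "(\<lambda>ij. ?X (f ij)) = coord p"
  proof
    fix ij :: "nat \<times> nat"
    show "?X (f ij) = coord p ij" by (cases ij) (simp add: f_def coord_def)
  qed
  with iv have iv: "indep_vars (\<lambda>_. borel) (coord p) (I \<times> {..p})" by simp
  show ?thesis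
  proof
    show "finite I" using I finite_subset by auto
    show "0 < max L M" using K by simp
    show "indep_vars (\<lambda>_. borel) (coord p) (I \<times> {..p})" by (rule iv)
    fix k j assume "k \<in> I" "j \<le> p"
    then have k: "k < N" using I by auto
    show "standardized Q (coord p (k, j))" using Q k by (simp add: design_noise_law_def coord_def)
    show "subgaussian Q (max L M) (coord p (k, j))"
    proof (cases "j < p")
      case True
      then have "subgaussian Q M (coord p (k, j))" using sM k by (simp add: coord_def)
      then show ?thesis by (rule subgaussian_mono) (use K in auto)
    next
      case False
      then have "subgaussian Q L (coord p (k, j))" using sL k by (simp add: coord_def)
      then show ?thesis by (rule subgaussian_mono) (use K in auto)
    qed
  qed
qed

lemma obs_law_prob:
  assumes "prob_space Q" and sQ: "sets Q = sets (data_space {..<N} p)"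
    and P: "{d \<in> space (data_space {..<N} p). P d} \<in> sets (data_space {..<N} p)"
  shows "\<P>(d in obs_law N p Q \<theta> \<sigma>. P d) = measure Q {w \<in> space Q. P (observe N p \<theta> \<sigma> w)}"
proof -
  have m: "observe N p \<theta> \<sigma> \<in> Q \<rightarrow>\<^sub>M data_space {..<N} p"
    unfolding observe_def measurable_cong_sets[OF sQ refl] by (rule measurable_observation)
  have "\<P>(d in obs_law N p Q \<theta> \<sigma>. P d)
      = measure (distr Q (data_space {..<N} p) (observe N p \<theta> \<sigma>)) {d \<in> space (data_space {..<N} p). P d}"
    by (simp add: obs_law_def observe_def)
  also have "\<dots> = measure Q (observe N p \<theta> \<sigma> -` {d \<in> space (data_space {..<N} p). P d} \<inter> space Q)"
    by (rule measure_distr[OF m P])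
  also have "observe N p \<theta> \<sigma> -` {d \<in> space (data_space {..<N} p). P d} \<inter> space Q
      = {w \<in> space Q. P (observe N p \<theta> \<sigma> w)}"
    using measurable_space[OF m] by auto
  finally show ?thesis .
qed

text \<open>For a < 1 the right-hand side is at least 1, because \<open>C'\<close> is at least e;
  every probability satisfies the bound. This disposes of moment orders too small for Markov's
  inequality.\<close>

lemma le_mult_exp_neg:
  fixes m a C' :: real
  assumes "a < 1" "exp (- a) \<le> A + exp (- (m / C'))" "3 \<le> C'" "prb \<le> 1" "0 \<le> A"
  shows "prb \<le> C' * (A + exp (- (m / C')))"
proof -
  have "1 \<le> C' * exp (- a)"
  proof -
    have "exp a \<le> exp 1" using assms(1) by simp
    also have "\<dots> \<le> C'" using exp_le assms(3) by linarith
    finally show ?thesis by (simp add: exp_minus field_simps)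
  qed
  also have "\<dots> \<le> C' * (A + exp (- (m / C')))" using assms by (intro mult_left_mono) auto
  finally show ?thesis using assms(4) by linarith
qed

text \<open>The first bound in \<open>rate\<close> makes level 1 admissible in
  \<open>restricted_eigenvalue_event\<close>; its half compensates for dividing by 2 n instead of n.
  The second is the condition \<open>small\<close> of \<open>slope_pilot_bound\<close>.\<close>

locale split_experiment =
  fixes L M \<sigma> :: real and n p s :: nat and Q :: "(mat \<times> vec) measure" and I1 I2 :: "nat set"
    and est :: "mat \<times> vec \<Rightarrow> vec" and \<theta> :: vec
  assumes LM: "0 < L" "0 < M" and n: "2 \<le> n" and p: "2 \<le> p" and s: "1 \<le> s" "s \<le> p"
    and Q: "design_noise_law (2 * n) p Q"
    and sL: "\<forall>i<2 * n. subgaussian Q L (noise i)"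
    and sM: "\<forall>i<2 * n. \<forall>j<p. subgaussian Q M (entry i j)"
    and rate: "sparsity_rate p s / real (2 * n) \<le> re_kappa (max L M) / 2"
      "sparsity_rate p s / real (2 * n) \<le> 1 / (48 * re_const (max L M))\<^sup>2"
    and split: "sample_split n I1 I2" and est: "srs_estimator (re_const (max L M)) I1 p est"
    and \<theta>: "\<theta> \<in> B0 p s" and \<sigma>: "0 < \<sigma>"
begin

lemma sparsity_rate_bounds: "0 \<le> sparsity_rate p s" "sparsity_rate p s \<le> real p"
proof -
  show "0 \<le> sparsity_rate p s"
    unfolding sparsity_rate_def using s
    by (intro mult_nonneg_nonneg ln_ge_zero) (auto simp: field_simps intro: order_trans[of _ "real p * 1"] mult_mono)
  show "sparsity_rate p s \<le> real p"
    using log_ratio_mono[OF s(1) s(2) order_refl] p by (simp add: sparsity_rate_def)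
qed

text \<open>Four exceptional events make up the right-hand side: the restricted eigenvalue
  inequality fails, the noise of the first subsample is large, or the linear or the quadratic
  statistic deviates while the pilot is good. Off these events the bound is deterministic.\<close>

lemma Q_hat_moment_bound:
  assumes r: "1 \<le> r" "2 * r \<le> n" "2 * r \<le> p"
  shows "measure Q {w \<in> space Q. tail_const (max L M) * real (2 * r) *
        (\<sigma> ^ 4 * (real p / (real n)\<^sup>2) + \<sigma>\<^sup>2 * ((norm2 {..<p} \<theta>)\<^sup>2 / real n))
        < (Q_hat I1 I2 p est (observe (2 * n) p \<theta> \<sigma> w) - (norm2 {..<p} \<theta>)\<^sup>2)\<^sup>2}
    \<le> 2 * exp (- real n) + exp (- real n / (1536 * (max L M) ^ 4)) + 2 * exp (- real (2 * r))"
proof -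
  define K where "K = max L M"
  have K: "0 < K" using LM by (simp add: K_def)
  define N where "N = 2 * n"
  let ?Z = "coord p"
  let ?obs = "observe N p \<theta> \<sigma>"
  have I12: "I1 \<union> I2 = {..<N}" "I1 \<inter> I2 = {}" "card I1 = n" "card I2 = n"
    using split by (auto simp: sample_split_def N_def)
  have sub: "I1 \<subseteq> {..<N}" "I2 \<subseteq> {..<N}" using I12 by auto
  interpret D0: design Q ?Z "{..<N}" p K
    unfolding K_def by (rule design_of_law[OF Q[folded N_def] LM sL[folded N_def] sM[folded N_def] order_refl])
  interpret D1: design Q ?Z I1 p K
    unfolding K_def by (rule design_of_law[OF Q[folded N_def] LM sL[folded N_def] sM[folded N_def] sub(1)])
  interpret D2: design Q ?Z I2 p K
    unfolding K_def by (rule design_of_law[OF Q[folded N_def] LM sL[folded N_def] sM[folded N_def] sub(2)])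
  let ?n = "real n"
  have n0: "0 < n" and p0: "0 < p" using n p by auto
  define b where "b = re_const K"
  have b: "0 < b" using re_const_pos[OF K] by (simp add: b_def)
  define C0 where "C0 = pilot_radius K"
  have C0: "0 \<le> C0" using K by (simp add: C0_def pilot_radius_def)
  have rate0: "1 \<le> sparsity_rate p s / real s"
    using D0.log_rate_ge_one[OF s] s by (simp add: sparsity_rate_def)
  have logp: "ln (exp 1 * real p) \<le> re_kappa K * real (card I1)"
  proof -
    have "ln (exp 1 * real p) \<le> sparsity_rate p s"
      using log_ratio_mono[of 1 s p] s by (simp add: sparsity_rate_def)
    also have "\<dots> \<le> re_kappa K * ?n" using rate(1) n0 by (simp add: K_def field_simps)
    finally show ?thesis by (simp add: I12)
  qed
  have small: "48 * b * sqrt (sparsity_rate p s / (2 * ?n)) \<le> 1"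
  proof -
    have "sqrt (sparsity_rate p s / (2 * ?n)) \<le> sqrt ((1 / (48 * b))\<^sup>2)"
      using rate(2) by (intro real_sqrt_le_mono) (simp add: K_def b_def power_divide)
    also have "\<dots> = 1 / (48 * b)" using b by simp
    finally have "48 * b * sqrt (sparsity_rate p s / (2 * ?n)) \<le> 48 * b * (1 / (48 * b))"
      using b by (intro mult_left_mono) auto
    then show ?thesis using b by simp
  qed
  obtain Bad where Bad: "Bad \<in> D0.events"
    "D0.prob Bad \<le> exp (- ?n) + exp (- ?n / (1536 * K ^ 4))"
    "\<And>x \<delta>. x \<in> space Q - Bad \<Longrightarrow>
       L2_set \<delta> {..<p} / 4 - re_const K * slope_norm 1 n p \<delta>
         \<le> mnorm I1 p (\<lambda>k j. ?Z (k, j) x) \<delta> / sqrt ?n"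
    using D1.restricted_eigenvalue_event[OF p0 _ logp] n0 unfolding I12 by blast
  define Noise where "Noise = {w \<in> space Q. 8 * K\<^sup>2 * ?n \<le> (\<Sum>k\<in>I1. (?Z (k, p) w)\<^sup>2)}"
  have Noise: "D0.prob Noise \<le> exp (- ?n)" using D1.noise_tail unfolding I12 Noise_def .
  have Noise_ev: "Noise \<in> D0.events"
  proof -
    have [measurable]: "(\<lambda>w. \<Sum>k\<in>I1. (?Z (k, p) w)\<^sup>2) \<in> borel_measurable Q"
      by (intro borel_measurable_sum borel_measurable_power D1.Z_measurable) auto
    show ?thesis unfolding Noise_def by measurable
  qed
  \<comment> \<open>The first subsample as a function of the coordinates with row in
    \<open>I1\<close>. Through \<open>F\<close>, the pilot error becomes a function of this block,
    which is independent of the block of \<open>I2\<close>.\<close>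
  define d1 :: "(nat \<times> nat \<Rightarrow> real) \<Rightarrow> mat \<times> vec" where
    "d1 y = (\<lambda>ij\<in>I1 \<times> {..<p}. y ij, \<lambda>i\<in>I1. (\<Sum>j<p. y (i, j) * \<theta> j) + \<sigma> * y (i, p))" for y
  let ?S1 = "PiM (I1 \<times> {..p}) (\<lambda>_. borel :: real measure)"
  let ?S2 = "PiM (I2 \<times> {..p}) (\<lambda>_. borel :: real measure)"
  let ?R1 = "\<lambda>w. restrict (\<lambda>i. ?Z i w) (I1 \<times> {..p})"
  let ?R2 = "\<lambda>w. restrict (\<lambda>i. ?Z i w) (I2 \<times> {..p})"
  have d1R: "subsample I1 p (?obs w) = d1 (?R1 w)" for w
    using sub by (auto simp: subsample_def observe_def d1_def coord_def entry_def noise_def case_prod_unfold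
        fun_eq_iff restrict_def intro!: sum.cong)
  have d1m: "d1 \<in> ?S1 \<rightarrow>\<^sub>M data_space I1 p"
    unfolding d1_def data_space_def vec_space_def
    by (intro measurable_Pair measurable_restrict borel_measurable_add borel_measurable_sum borel_measurable_times
        measurable_component_singleton borel_measurable_const) auto
  define F where "F y = (\<lambda>j\<in>{..<p}. (\<theta> j - est (d1 y) j) / \<sigma>)" for y
  have Fm: "F \<in> ?S1 \<rightarrow>\<^sub>M vec_space {..<p}"
    unfolding F_def vec_space_def
  proof (intro measurable_restrict borel_measurable_divide borel_measurable_diff borel_measurable_const)
    fix j assume j: "j \<in> {..<p}"
    have "(\<lambda>y. est (d1 y)) \<in> ?S1 \<rightarrow>\<^sub>M vec_space {..<p}"
      by (rule measurable_compose[OF d1m]) (use est in \<open>simp add: srs_estimator_def\<close>)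
    then show "(\<lambda>y. est (d1 y) j) \<in> borel_measurable ?S1"
      unfolding vec_space_def by (rule measurable_compose) (rule measurable_component_singleton[OF j])
  qed
  define Dl where "Dl w = F (?R1 w)" for w
  have ind: "D0.indep_var ?S1 ?R1 ?S2 ?R2"
    by (rule D0.indep_var_restrict[OF D0.indep]) (use I12 sub in auto)
  let ?SS = "?S1 \<Otimes>\<^sub>M ?S2"
  define wv :: "vec \<Rightarrow> (nat \<times> nat \<Rightarrow> real) \<Rightarrow> nat \<Rightarrow> nat \<Rightarrow> real" where
    "wv a y k j = y (k, j) * ((\<Sum>i<p. a i * y (k, i)) + y (k, p)) - a j" for a y k j
  define LS where "LS a y = (\<Sum>k\<in>I2. \<Sum>j<p. \<theta> j * wv a y k j)" for a y
  define QS where "QS a y = (\<Sum>k\<in>I2. \<Sum>l\<in>I2 - {k}. \<Sum>j<p. wv a y k j * wv a y l j)" for a y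
  define G where "G a \<longleftrightarrow> (\<Sum>j<p. (a j)\<^sup>2) \<le> C0\<^sup>2" for a :: vec
  have wvw: "wv a (?R2 w) k j = D2.wvec a k w j" if "k \<in> I2" "j < p" for a w k j
    using that by (simp add: wv_def D2.wvec_def D2.lin_comb)
  let ?g = "D2.gam C0" and ?Dc = "D2.Dc C0"
  let ?V = "(norm2 {..<p} \<theta>)\<^sup>2"
  have V: "?V = (\<Sum>j<p. (\<theta> j)\<^sup>2)" by (simp add: norm2_def sum_nonneg)
  define T1 where "T1 = 2 * exp 2 * (?g * real (2 * r) * ?n * ?V)"
  define T2 where "T2 = 2 * exp 2 * (real (2 * r) * ?n\<^sup>2 * real p * (512 * ?g * ?Dc + 4096 * ?g\<^sup>2))"
  let ?ST = "vec_space {..<p} \<Otimes>\<^sub>M ?S2"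
  have am: "(\<lambda>z. fst z j) \<in> borel_measurable ?ST" if "j < p" for j
    unfolding vec_space_def by (rule measurable_compose[OF measurable_fst measurable_component_singleton]) (use that in auto)
  have ym: "(\<lambda>z. snd z (k, j)) \<in> borel_measurable ?ST" if "k \<in> I2" "j \<le> p" for k j
    by (rule measurable_compose[OF measurable_snd measurable_component_singleton]) (use that in auto)
  have wvm: "(\<lambda>z. wv (fst z) (snd z) k j) \<in> borel_measurable ?ST" if "k \<in> I2" "j < p" for k j
    unfolding wv_def using that by (intro borel_measurable_diff borel_measurable_times borel_measurable_add borel_measurable_sum am ym) auto
  have Gm [measurable]: "(\<lambda>z. \<Sum>j<p. (fst z j)\<^sup>2) \<in> borel_measurable ?ST"
    by (intro borel_measurable_sum borel_measurable_power am) auto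
  have LSm [measurable]: "(\<lambda>z. LS (fst z) (snd z)) \<in> borel_measurable ?ST"
    unfolding LS_def by (intro borel_measurable_sum borel_measurable_times borel_measurable_const wvm) auto
  have QSm [measurable]: "(\<lambda>z. QS (fst z) (snd z)) \<in> borel_measurable ?ST"
    unfolding QS_def by (intro borel_measurable_sum borel_measurable_times wvm) auto
  have Fz: "(\<lambda>z. (F (fst z), snd z)) \<in> ?SS \<rightarrow>\<^sub>M ?ST"
    by (intro measurable_Pair measurable_compose[OF measurable_fst Fm] measurable_snd)
  have [measurable]: "(\<lambda>z. \<Sum>j<p. (F (fst z) j)\<^sup>2) \<in> borel_measurable ?SS"
    "(\<lambda>z. LS (F (fst z)) (snd z)) \<in> borel_measurable ?SS"
    "(\<lambda>z. QS (F (fst z)) (snd z)) \<in> borel_measurable ?SS"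
    using measurable_compose[OF Fz LSm] measurable_compose[OF Fz QSm] measurable_compose[OF Fz Gm] by simp_all
  have rI: "2 * r \<le> card I2" using r I12 by simp
  have E1: "D0.prob {w \<in> space Q. G (Dl w) \<and> T1 < (LS (Dl w) (?R2 w))\<^sup>2} \<le> exp (- real (2 * r))"
    unfolding Dl_def
  proof (rule D0.indep_conditional_bound[OF ind, where G = "\<lambda>y. G (F y)" and P = "\<lambda>y y'. T1 < (LS (F y) y')\<^sup>2"])
    show "{z \<in> space ?SS. G (F (fst z)) \<and> T1 < (LS (F (fst z)) (snd z))\<^sup>2} \<in> sets ?SS"
      unfolding G_def by measurable
    fix y assume G: "G (F y)"
    define a where "a = F y"
    have a: "(\<Sum>j<p. (a j)\<^sup>2) \<le> C0\<^sup>2" using G by (simp add: G_def a_def)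
    have "LS a (?R2 w) = D2.lin_stat a \<theta> w" for w
      unfolding LS_def D2.lin_stat_def[OF C0 a] by (intro sum.cong refl) (simp add: wvw)
    then show "D0.prob {w \<in> space Q. T1 < (LS (F y) (?R2 w))\<^sup>2} \<le> exp (- real (2 * r))"
      using D2.wvec_tails(1)[OF C0 a r(1) rI r(3), of \<theta>] by (simp only: T1_def V I12 a_def)
  qed simp
  have E2: "D0.prob {w \<in> space Q. G (Dl w) \<and> T2 < (QS (Dl w) (?R2 w))\<^sup>2} \<le> exp (- real (2 * r))"
    unfolding Dl_def
  proof (rule D0.indep_conditional_bound[OF ind, where G = "\<lambda>y. G (F y)" and P = "\<lambda>y y'. T2 < (QS (F y) y')\<^sup>2"])
    show "{z \<in> space ?SS. G (F (fst z)) \<and> T2 < (QS (F (fst z)) (snd z))\<^sup>2} \<in> sets ?SS"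
      unfolding G_def by measurable
    fix y assume G: "G (F y)"
    define a where "a = F y"
    have a: "(\<Sum>j<p. (a j)\<^sup>2) \<le> C0\<^sup>2" using G by (simp add: G_def a_def)
    have "QS a (?R2 w) = D2.quad_stat a w" for w
      unfolding QS_def D2.quad_stat_def[OF C0 a] by (intro sum.cong refl) (simp add: wvw)
    then show "D0.prob {w \<in> space Q. T2 < (QS (F y) (?R2 w))\<^sup>2} \<le> exp (- real (2 * r))"
      using D2.wvec_tails(2)[OF C0 a r(1) rI r(3)] by (simp only: T2_def I12 a_def)
  qed simp
  have pilot: "G (Dl w)" if w: "w \<in> space Q - (Bad \<union> Noise)" for w
  proof -
    define y where "y = ?R1 w"
    have y: "y (k, j) = ?Z (k, j) w" if "k \<in> I1" "j \<le> p" for k j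
      using that by (simp add: y_def)
    have ys: "y \<in> space ?S1" by (simp add: y_def space_PiM)
    let ?t = "est (d1 y)"
    have d1s: "d1 y \<in> space (data_space I1 p)"
      by (rule measurable_space[OF d1m ys])
    have am: "is_arg_min (srs_objective b I1 p (d1 y)) (\<lambda>t. t \<in> space (vec_space {..<p})) ?t"
      using est d1s by (simp add: srs_estimator_def b_def K_def)
    have "L2_set (\<lambda>j. ?t j - \<theta> j) {..<p} \<le> 16 * (L2_set (\<lambda>k. \<sigma> * ?Z (k, p) w) I1 / sqrt ?n)"
    proof (rule slope_pilot_bound[OF n0 p0 s b _ _ small I12(3), where X = "\<lambda>k j. ?Z (k, j) w"])
      show "L2_set (\<lambda>j. ?t j - \<theta> j) {..<p} / 4 - b * slope_norm 1 n p (\<lambda>j. ?t j - \<theta> j)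
          \<le> mnorm I1 p (\<lambda>k j. ?Z (k, j) w) (\<lambda>j. ?t j - \<theta> j) / sqrt ?n"
        using Bad(3)[of w "\<lambda>j. ?t j - \<theta> j"] w by (simp add: b_def)
      show "card {j \<in> {..<p}. \<theta> j \<noteq> 0} \<le> s" using \<theta> by (simp add: B0_def)
      show "snd (d1 y) k = (\<Sum>j<p. fst (d1 y) (k, j) * \<theta> j) + \<sigma> * ?Z (k, p) w" if "k \<in> I1" for k
        using that by (simp add: d1_def y)
      show "fst (d1 y) (k, j) = ?Z (k, j) w" if "k \<in> I1" "j < p" for k j
        using that by (simp add: d1_def y)
      have "\<theta> \<in> space (vec_space {..<p})" using \<theta> by (simp add: B0_def)
      then show "srs_objective b I1 p (d1 y) ?t \<le> srs_objective b I1 p (d1 y) \<theta>"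
        using am by (auto simp: is_arg_min_def not_less)
    qed
    also have "L2_set (\<lambda>k. \<sigma> * ?Z (k, p) w) I1 = \<sigma> * sqrt (\<Sum>k\<in>I1. (?Z (k, p) w)\<^sup>2)"
      using \<sigma> by (simp add: L2_set_def power_mult_distrib sum_distrib_left[symmetric] real_sqrt_mult)
    finally have "(L2_set (\<lambda>j. ?t j - \<theta> j) {..<p})\<^sup>2 \<le> (16 * (\<sigma> * sqrt (\<Sum>k\<in>I1. (?Z (k, p) w)\<^sup>2) / sqrt ?n))\<^sup>2"
      by (rule power_mono) simp
    also have "\<dots> = 256 * \<sigma>\<^sup>2 * ((\<Sum>k\<in>I1. (?Z (k, p) w)\<^sup>2) / ?n)"
      by (simp add: power_mult_distrib power_divide sum_nonneg)
    also have "\<dots> \<le> 256 * \<sigma>\<^sup>2 * (8 * K\<^sup>2)"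
    proof (rule mult_left_mono)
      have "(\<Sum>k\<in>I1. (?Z (k, p) w)\<^sup>2) \<le> 8 * K\<^sup>2 * ?n" using w by (auto simp: Noise_def)
      then show "(\<Sum>k\<in>I1. (?Z (k, p) w)\<^sup>2) / ?n \<le> 8 * K\<^sup>2" using n0 by (simp add: field_simps)
    qed simp
    also have "\<dots> \<le> \<sigma>\<^sup>2 * C0\<^sup>2" by (simp add: C0_def pilot_radius_def power_mult_distrib)
    finally have "(\<Sum>j<p. (?t j - \<theta> j)\<^sup>2) \<le> \<sigma>\<^sup>2 * C0\<^sup>2" by (simp add: L2_set_def sum_nonneg)
    moreover have "(\<Sum>j<p. (Dl w j)\<^sup>2) = (\<Sum>j<p. (?t j - \<theta> j)\<^sup>2) / \<sigma>\<^sup>2"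
      by (simp add: Dl_def y_def[symmetric] F_def power_divide sum_divide_distrib power2_commute[of "\<theta> _"])
    ultimately have "\<sigma>\<^sup>2 * (\<Sum>j<p. (Dl w j)\<^sup>2) \<le> \<sigma>\<^sup>2 * C0\<^sup>2" using \<sigma> by simp
    then show ?thesis using \<sigma> by (simp add: G_def)
  qed
  have ident: "Q_hat I1 I2 p est (?obs w) - ?V
      = 2 * \<sigma> / ?n * LS (Dl w) (?R2 w) + \<sigma>\<^sup>2 / (?n * (?n - 1)) * QS (Dl w) (?R2 w)" for w
  proof -
    let ?t = "est (d1 (?R1 w))" and ?a = "Dl w" and ?w = "wv (Dl w) (?R2 w)"
    let ?d = "subsample I2 p (?obs w)"
    have fI2: "finite I2" by (rule D2.finI)
    have t: "?t j = \<theta> j - \<sigma> * ?a j" if "j < p" for j using that \<sigma> by (simp add: Dl_def F_def)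
    have X: "fst ?d (k, j) = ?Z (k, j) w" if "k \<in> I2" "j < p" for k j
      using that by (simp add: subsample_def observe_def coord_def entry_def case_prod_unfold)
    have Y: "snd ?d k = (\<Sum>j<p. ?Z (k, j) w * \<theta> j) + \<sigma> * ?Z (k, p) w" if "k \<in> I2" for k
      using that sub by (auto simp: subsample_def observe_def coord_def entry_def noise_def case_prod_unfold)
    have rs: "resid p ?d ?t k = \<sigma> * ((\<Sum>i<p. ?a i * ?Z (k, i) w) + ?Z (k, p) w)" if k: "k \<in> I2" for k
    proof -
      have "(\<Sum>j<p. fst ?d (k, j) * ?t j) = (\<Sum>j<p. ?Z (k, j) w * \<theta> j - \<sigma> * (?a j * ?Z (k, j) w))"
        using k by (intro sum.cong refl) (simp add: X t algebra_simps)
      then show ?thesis unfolding resid_def Y[OF k]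
        by (simp add: sum_subtractf sum_distrib_left[symmetric] algebra_simps)
    qed
    have Xr: "fst ?d (k, j) * resid p ?d ?t k = \<sigma> * (?w k j + ?a j)" if "k \<in> I2" "j < p" for k j
      using that by (simp add: X rs wv_def)
    have one: "debiased_sq I2 p ?d ?t j
        = (\<theta> j)\<^sup>2 + 2 * \<sigma> / ?n * (\<Sum>k\<in>I2. \<theta> j * ?w k j) + \<sigma>\<^sup>2 / (?n * (?n - 1)) * (\<Sum>k\<in>I2. \<Sum>l\<in>I2 - {k}. ?w k j * ?w l j)"
      if j: "j < p" for j
    proof -
      have "(\<Sum>k\<in>I2. fst ?d (k, j) * resid p ?d ?t k) = (\<Sum>k\<in>I2. \<sigma> * (?w k j + ?a j))"
        using j by (intro sum.cong refl Xr)
      moreover have "(\<Sum>k\<in>I2. \<Sum>l\<in>I2 - {k}. fst ?d (k, j) * fst ?d (l, j) * resid p ?d ?t k * resid p ?d ?t l)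
          = (\<Sum>k\<in>I2. \<Sum>l\<in>I2 - {k}. \<sigma>\<^sup>2 * ((?w k j + ?a j) * (?w l j + ?a j)))"
      proof (rule sum.cong[OF refl], rule sum.cong[OF refl])
        fix k l assume "k \<in> I2" "l \<in> I2 - {k}"
        then have "(fst ?d (k, j) * resid p ?d ?t k) * (fst ?d (l, j) * resid p ?d ?t l) = (\<sigma> * (?w k j + ?a j)) * (\<sigma> * (?w l j + ?a j))"
          using j by (simp only: Xr DiffD1)
        then show "fst ?d (k, j) * fst ?d (l, j) * resid p ?d ?t k * resid p ?d ?t l = \<sigma>\<^sup>2 * ((?w k j + ?a j) * (?w l j + ?a j))"
          by (simp add: power2_eq_square mult_ac)
      qed
      ultimately show ?thesis
        unfolding debiased_sq_def Let_def I12(4) t[OF j]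
        using debiased_coordinate[OF fI2, of ?n "\<theta> j" \<sigma> "?a j" "\<lambda>k. ?w k j"] n I12(4) by (simp only:)
    qed
    have "Q_hat I1 I2 p est (?obs w) = (\<Sum>j<p. debiased_sq I2 p ?d ?t j)"
      by (simp add: Q_hat_def d1R)
    also have "\<dots> = (\<Sum>j<p. (\<theta> j)\<^sup>2 + 2 * \<sigma> / ?n * (\<Sum>k\<in>I2. \<theta> j * ?w k j) + \<sigma>\<^sup>2 / (?n * (?n - 1)) * (\<Sum>k\<in>I2. \<Sum>l\<in>I2 - {k}. ?w k j * ?w l j))"
      by (intro sum.cong refl one) simp
    also have "\<dots> = ?V + 2 * \<sigma> / ?n * (\<Sum>j<p. \<Sum>k\<in>I2. \<theta> j * ?w k j) + \<sigma>\<^sup>2 / (?n * (?n - 1)) * (\<Sum>j<p. \<Sum>k\<in>I2. \<Sum>l\<in>I2 - {k}. ?w k j * ?w l j)"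
      by (simp only: sum.distrib sum_distrib_left[symmetric] V)
    also have "(\<Sum>j<p. \<Sum>k\<in>I2. \<theta> j * ?w k j) = LS ?a (?R2 w)" unfolding LS_def by (rule sum.swap)
    also have "(\<Sum>j<p. \<Sum>k\<in>I2. \<Sum>l\<in>I2 - {k}. ?w k j * ?w l j) = QS ?a (?R2 w)"
      unfolding QS_def by (subst sum.swap) (intro sum.cong refl sum.swap)
    finally show ?thesis by linarith
  qed
  let ?thr = "tail_const K * real (2 * r) * (\<sigma> ^ 4 * (real p / ?n\<^sup>2) + \<sigma>\<^sup>2 * (?V / ?n))"
  have det: "(Q_hat I1 I2 p est (?obs w) - ?V)\<^sup>2 \<le> ?thr"
    if l: "(LS (Dl w) (?R2 w))\<^sup>2 \<le> T1" and q: "(QS (Dl w) (?R2 w))\<^sup>2 \<le> T2" for w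
  proof -
    let ?l = "LS (Dl w) (?R2 w)" and ?q = "QS (Dl w) (?R2 w)"
    have sqd: "(x + y)\<^sup>2 \<le> 2 * x\<^sup>2 + 2 * y\<^sup>2" for x y :: real
      using zero_le_power2[of "x - y"] by (simp add: power2_diff power2_sum)
    let ?gg = "\<bar>?g\<bar>" and ?GG = "\<bar>512 * ?g * ?Dc + 4096 * ?g\<^sup>2\<bar>"
    have A: "2 * (2 * \<sigma> / ?n * ?l)\<^sup>2 \<le> 16 * exp 2 * ?gg * real (2 * r) * (\<sigma>\<^sup>2 * (?V / ?n))"
    proof -
      have "?g * real (2 * r) * ?n * ?V \<le> ?gg * real (2 * r) * ?n * ?V"
        by (intro mult_right_mono) auto
      then have "?l\<^sup>2 \<le> 2 * exp 2 * (?gg * real (2 * r) * ?n * ?V)"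
        using l unfolding T1_def by (elim order_trans) (intro mult_left_mono, auto)
      then have "8 * \<sigma>\<^sup>2 / ?n\<^sup>2 * ?l\<^sup>2 \<le> 8 * \<sigma>\<^sup>2 / ?n\<^sup>2 * (2 * exp 2 * (?gg * real (2 * r) * ?n * ?V))"
        by (rule mult_left_mono) simp
      also have "\<dots> = 16 * exp 2 * ?gg * real (2 * r) * (\<sigma>\<^sup>2 * (?V / ?n))"
        using n0 by (simp add: power2_eq_square)
      finally show ?thesis by (simp add: power_mult_distrib power_divide)
    qed
    have B: "2 * (\<sigma>\<^sup>2 / (?n * (?n - 1)) * ?q)\<^sup>2 \<le> 16 * exp 2 * ?GG * real (2 * r) * (\<sigma> ^ 4 * (real p / ?n\<^sup>2))"
    proof -
      have n1: "?n / 2 \<le> ?n - 1" using n by simp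
      have "(?n / 2)\<^sup>2 \<le> (?n - 1)\<^sup>2" using n1 by (intro power_mono) auto
      then have nn: "1 / (?n - 1)\<^sup>2 \<le> 4 / ?n\<^sup>2" using n by (simp add: field_simps power_divide)
      have "real (2 * r) * ?n\<^sup>2 * real p * (512 * ?g * ?Dc + 4096 * ?g\<^sup>2) \<le> real (2 * r) * ?n\<^sup>2 * real p * ?GG"
        by (intro mult_left_mono abs_ge_self) auto
      then have qb: "?q\<^sup>2 \<le> 2 * exp 2 * (real (2 * r) * ?n\<^sup>2 * real p * ?GG)"
        using q unfolding T2_def by (elim order_trans) (intro mult_left_mono, auto)
      have s4: "(\<sigma>\<^sup>2)\<^sup>2 = \<sigma> ^ 4" by simp
      have "2 * (\<sigma>\<^sup>2 / (?n * (?n - 1)) * ?q)\<^sup>2 = 2 * \<sigma> ^ 4 / ?n\<^sup>2 * (1 / (?n - 1)\<^sup>2) * ?q\<^sup>2"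
        by (simp add: power_mult_distrib power_divide)
      also have "\<dots> \<le> 2 * \<sigma> ^ 4 / ?n\<^sup>2 * (4 / ?n\<^sup>2) * (2 * exp 2 * (real (2 * r) * ?n\<^sup>2 * real p * ?GG))"
        using nn qb by (intro mult_mono) auto
      also have "\<dots> = 16 * exp 2 * ?GG * real (2 * r) * (\<sigma> ^ 4 * (real p / ?n\<^sup>2))"
        using n0 by (simp add: power2_eq_square)
      finally show ?thesis .
    qed
    have "(Q_hat I1 I2 p est (?obs w) - ?V)\<^sup>2 \<le> 2 * (2 * \<sigma> / ?n * ?l)\<^sup>2 + 2 * (\<sigma>\<^sup>2 / (?n * (?n - 1)) * ?q)\<^sup>2"
      unfolding ident by (rule sqd)
    also have "\<dots> \<le> 16 * exp 2 * ?gg * real (2 * r) * (\<sigma>\<^sup>2 * (?V / ?n)) + 16 * exp 2 * ?GG * real (2 * r) * (\<sigma> ^ 4 * (real p / ?n\<^sup>2))"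
      by (rule add_mono[OF A B])
    also have "\<dots> \<le> tail_const K * real (2 * r) * (\<sigma>\<^sup>2 * (?V / ?n)) + tail_const K * real (2 * r) * (\<sigma> ^ 4 * (real p / ?n\<^sup>2))"
    proof (intro add_mono mult_right_mono)
      have "0 \<le> 16 * exp 2 * ?gg" "0 \<le> 16 * exp 2 * ?GG" by simp_all
      then show "16 * exp 2 * ?gg \<le> tail_const K" "16 * exp 2 * ?GG \<le> tail_const K"
        unfolding tail_const_def Let_def C0_def[symmetric] distrib_left by linarith+
    qed auto
    also have "\<dots> = ?thr" by (simp add: algebra_simps)
    finally show ?thesis .
  qed
  have meas: "(\<lambda>w. (?R1 w, ?R2 w)) \<in> Q \<rightarrow>\<^sub>M ?SS"
    using D0.indep_var_rv1[OF ind] D0.indep_var_rv2[OF ind] by (rule measurable_Pair)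
  have [measurable]: "(\<lambda>w. LS (Dl w) (?R2 w)) \<in> borel_measurable Q" "(\<lambda>w. QS (Dl w) (?R2 w)) \<in> borel_measurable Q"
     "(\<lambda>w. \<Sum>j<p. (Dl w j)\<^sup>2) \<in> borel_measurable Q"
    using measurable_compose[OF measurable_compose[OF meas Fz] LSm] measurable_compose[OF measurable_compose[OF meas Fz] QSm]
      measurable_compose[OF measurable_compose[OF meas Fz] Gm] by (simp_all add: Dl_def)
  let ?E1 = "{w \<in> space Q. G (Dl w) \<and> T1 < (LS (Dl w) (?R2 w))\<^sup>2}"
  let ?E2 = "{w \<in> space Q. G (Dl w) \<and> T2 < (QS (Dl w) (?R2 w))\<^sup>2}"
  have ev: "?E1 \<in> D0.events" "?E2 \<in> D0.events" unfolding G_def by measurable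
  have "{w \<in> space Q. ?thr < (Q_hat I1 I2 p est (?obs w) - ?V)\<^sup>2} \<subseteq> (Bad \<union> Noise) \<union> (?E1 \<union> ?E2)"
    using det pilot by (force simp: not_less)
  then have "measure Q {w \<in> space Q. ?thr < (Q_hat I1 I2 p est (?obs w) - ?V)\<^sup>2} \<le> measure Q ((Bad \<union> Noise) \<union> (?E1 \<union> ?E2))"
    using Bad(1) Noise_ev ev by (intro D0.finite_measure_mono) auto
  also have "\<dots> \<le> measure Q (Bad \<union> Noise) + measure Q (?E1 \<union> ?E2)"
    using Bad(1) Noise_ev ev by (intro measure_Un_le) auto
  also have "\<dots> \<le> (measure Q Bad + measure Q Noise) + (measure Q ?E1 + measure Q ?E2)"
    using Bad(1) Noise_ev ev by (intro add_mono measure_Un_le) auto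
  finally show ?thesis using Bad(2) Noise E1 E2 unfolding K_def[symmetric] N_def[symmetric] by linarith
qed

lemma Q_hat_bound:
  assumes v: "0 < v"
    and C: "3 * tail_const (max L M) \<le> C" and C'_ge: "7 + 1536 * (max L M) ^ 4 \<le> C'"
  shows "\<P>(d in obs_law (2 * n) p Q \<theta> \<sigma>. (Q_hat I1 I2 p est d - (norm2 {..<p} \<theta>)\<^sup>2)\<^sup>2
      > C * v *
        (\<sigma> ^ 4 * (real p / (real n)\<^sup>2) + \<sigma>\<^sup>2 * ((norm2 {..<p} \<theta>)\<^sup>2 / real n)))
    \<le> C' * (exp (- v) + exp (- (min (real n) (sparsity_rate p s) / C')))"
proof -
  let ?N = "2 * n"
  let ?c = "tail_const (max L M)"
  let ?x = "\<sigma> ^ 4 * (real p / (real n)\<^sup>2) + \<sigma>\<^sup>2 * ((norm2 {..<p} \<theta>)\<^sup>2 / real n)"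
  let ?dev = "\<lambda>d. (Q_hat I1 I2 p est d - (norm2 {..<p} \<theta>)\<^sup>2)\<^sup>2"
  define m where "m = min (real n) (sparsity_rate p s)"
  define C1 where "C1 = 1536 * (max L M) ^ 4"
  have C1: "0 < C1" using LM by (simp add: C1_def)
  have C': "7 + C1 \<le> C'" using C'_ge by (simp add: C1_def)
  interpret prob_space Q using Q by (simp add: design_noise_law_def)
  have sQ: "sets Q = sets (data_space {..<?N} p)" using Q by (simp add: design_noise_law_def)
  have meas [measurable]: "Q_hat I1 I2 p est \<in> borel_measurable (data_space {..<?N} p)"
    by (rule measurable_Q_hat[OF split est])
  have eq: "\<P>(d in obs_law ?N p Q \<theta> \<sigma>. t < ?dev d) = prob {w \<in> space Q. t < ?dev (observe ?N p \<theta> \<sigma> w)}" for t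
    by (rule obs_law_prob[OF prob_space_axioms sQ]) measurable
  have m: "0 \<le> m" "m \<le> real n" "m \<le> real p" using sparsity_rate_bounds by (auto simp: m_def)
  have em: "exp (- a) \<le> exp (- (m / C'))" if "m / c \<le> a" "0 < c" "c \<le> C'" for a c
  proof -
    have "m / C' \<le> m / c" using m that by (intro divide_left_mono) (auto intro: mult_pos_pos)
    then show ?thesis using that by simp
  qed
  have en: "exp (- (real n / 4)) \<le> exp (- (m / C'))" "exp (- (real p / 4)) \<le> exp (- (m / C'))"
    proof -
    show "exp (- (real n / 4)) \<le> exp (- (m / C'))" by (rule em[of 4]) (use m C1 C' in auto)
    show "exp (- (real p / 4)) \<le> exp (- (m / C'))" by (rule em[of 4]) (use m C1 C' in auto)
  qed
  \<comment> \<open>The quarters leave room for rounding up to an even order that is still at most n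
    and p. An active cap costs only multiples of the second exponential, since \<open>m\<close> is
    at most n and p.\<close>
  define v' where "v' = min v (min (real p / 4) (real n / 4))"
  have v'e: "exp (- v') \<le> exp (- v) + 2 * exp (- (m / C'))"
    using en unfolding v'_def min_def by (auto intro: order_trans[OF en(1)] order_trans[OF en(2)] add_increasing)
  have v'e1: "exp (- v') \<le> exp (- v) + exp (- (m / C'))"
    using en unfolding v'_def min_def by (auto intro: order_trans[OF en(1)] order_trans[OF en(2)] add_increasing)
  show ?thesis
  proof (cases "v' < 1")
    case True
    show ?thesis unfolding m_def[symmetric]
      using C1 C' by (intro le_mult_exp_neg[OF True v'e1]) (auto simp: eq)
  next
    case False
    \<comment> \<open>Rounding gives v' \<le> 2 r \<le> v' + 2 \<le> 3 v', as v' \<ge> 1 here. This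
      is the 3 required of \<open>C\<close>, and 3 v' stays below n and p.\<close>
    define r where "r = nat \<lceil>v' / 2\<rceil>"
    have r: "v' \<le> real (2 * r)" "real (2 * r) \<le> v' + 2" "1 \<le> r"
    proof -
      have "0 < \<lceil>v' / 2\<rceil>" using False by simp
      then have "real r = real_of_int \<lceil>v' / 2\<rceil>" by (simp add: r_def)
      then have "v' / 2 \<le> real r" "real r \<le> v' / 2 + 1" by linarith+
      then show "v' \<le> real (2 * r)" "real (2 * r) \<le> v' + 2" by simp_all
      have "0 < real r" using \<open>v' / 2 \<le> real r\<close> False by linarith
      then show "1 \<le> r" by simp
    qed
    have v4: "v' \<le> v" "v' \<le> real p / 4" "v' \<le> real n / 4" by (auto simp: v'_def)
    have r3: "real (2 * r) \<le> 3 * v'" using r(2) False by linarith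
    have "real (2 * r) \<le> real n" "real (2 * r) \<le> real p" using r3 v4 by linarith+
    then have rn: "2 * r \<le> n" "2 * r \<le> p" by (simp_all only: of_nat_le_iff)
    have x0: "0 \<le> ?x" using \<sigma> by (intro add_nonneg_nonneg mult_nonneg_nonneg) auto
    have "?c * real (2 * r) * ?x \<le> C * v * ?x"
    proof (rule mult_right_mono[OF _ x0])
      have "?c * real (2 * r) \<le> ?c * (3 * v)"
        using r3 v4 tail_const_pos by (intro mult_left_mono) (auto simp: less_imp_le)
      also have "\<dots> = 3 * ?c * v" by simp
      also have "\<dots> \<le> C * v" using C v by (intro mult_right_mono) auto
      finally show "?c * real (2 * r) \<le> C * v" .
    qed
    then have "prob {w \<in> space Q. C * v * ?x < ?dev (observe ?N p \<theta> \<sigma> w)}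
        \<le> prob {w \<in> space Q. ?c * real (2 * r) * ?x < ?dev (observe ?N p \<theta> \<sigma> w)}"
    proof (intro finite_measure_mono)
      have "observe ?N p \<theta> \<sigma> \<in> Q \<rightarrow>\<^sub>M data_space {..<?N} p"
        unfolding observe_def measurable_cong_sets[OF sQ refl] by (rule measurable_observation)
      from measurable_compose[OF this meas]
      have [measurable]: "(\<lambda>w. Q_hat I1 I2 p est (observe ?N p \<theta> \<sigma> w)) \<in> borel_measurable Q" .
      show "{w \<in> space Q. ?c * real (2 * r) * ?x < ?dev (observe ?N p \<theta> \<sigma> w)} \<in> events" by measurable
    qed auto
    also have "\<dots> \<le> 2 * exp (- real n) + exp (- real n / (1536 * (max L M) ^ 4)) + 2 * exp (- real (2 * r))"
      by (rule Q_hat_moment_bound[OF r(3) rn])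
    \<comment> \<open>The second exponential is collected 2 + 1 + 2 * 2 = 7 times, the 7 required of
      \<open>C'\<close>.\<close>
    also have "\<dots> \<le> 2 * exp (- (m / C')) + exp (- (m / C')) + 2 * (exp (- v) + 2 * exp (- (m / C')))"
    proof (intro add_mono mult_left_mono)
      show "exp (- real n) \<le> exp (- (m / C'))" using m C1 C' by (intro em[of 1]) auto
      have "exp (- (real n / C1)) \<le> exp (- (m / C'))"
        using m C1 C' by (intro em[of C1]) (auto simp: divide_right_mono)
      then show "exp (- real n / (1536 * (max L M) ^ 4)) \<le> exp (- (m / C'))" by (simp add: C1_def)
      have "exp (- real (2 * r)) \<le> exp (- v')" using r(1) by simp
      then show "exp (- real (2 * r)) \<le> exp (- v) + 2 * exp (- (m / C'))" using v'e by linarith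
    qed auto
    also have "\<dots> = 2 * exp (- v) + 7 * exp (- (m / C'))" by simp
    also have "\<dots> \<le> C' * exp (- v) + C' * exp (- (m / C'))"
      using C1 C' by (intro add_mono mult_right_mono) auto
    finally show ?thesis unfolding eq m_def[symmetric] by (simp add: distrib_left)
  qed
qed

lemma Lambda_hat_bound:
  assumes v: "0 < v"
    and c_ge: "3 * tail_const (max L M) \<le> c" and C: "2 + 2 * sqrt c \<le> C"
    and C'_ge: "7 + 1536 * (max L M) ^ 4 \<le> C'"
  shows "\<P>(d in obs_law (2 * n) p Q \<theta> \<sigma>. \<bar>Lambda_hat I1 I2 p est d - norm2 {..<p} \<theta>\<bar>
      > C * \<sigma> * ((real p * v) powr (1 / 4) / sqrt (real n)))
    \<le> 2 * C' * (exp (- v) + exp (- (min (real n) (sparsity_rate p s) / (2 * C'))))"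
proof -
  let ?N = "2 * n"
  let ?h = "norm2 {..<p} \<theta>"
  define m where "m = min (real n) (sparsity_rate p s)"
  have C': "7 \<le> C'" using C'_ge by (rule order_trans[rotated]) simp
  have c: "0 \<le> c" using tail_const_pos[of "max L M"] c_ge by linarith
  \<comment> \<open>The term with the squared norm of \<theta> calls for v \<le> sqrt (p v), which
    fails for v > p. Cutting v at p restores it, and exp (- p) is absorbed by the second
    exponential.\<close>
  define v1 where "v1 = min v (real p)"
  have v1: "0 < v1" using v p by (simp add: v1_def)
  define \<tau> where "\<tau> = \<sigma> * ((real p * v) powr (1 / 4) / sqrt (real n))"
  have \<tau>: "0 \<le> \<tau>" using \<sigma> by (simp add: \<tau>_def)
  have pv: "0 < real p * v" using p v by simp
  have t2: "\<tau>\<^sup>2 = \<sigma>\<^sup>2 * (sqrt (real p * v) / real n)"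
  proof -
    have "((real p * v) powr (1 / 4))\<^sup>2 = (real p * v) powr (1 / 2)"
      using pv by (simp add: power2_eq_square powr_add[symmetric])
    also have "\<dots> = sqrt (real p * v)" using pv by (simp add: powr_half_sqrt)
    finally show ?thesis by (simp add: \<tau>_def power_mult_distrib power_divide)
  qed
  have t4: "\<tau> ^ 4 = \<sigma> ^ 4 * (real p * v / (real n)\<^sup>2)"
  proof -
    have "\<tau> ^ 4 = (\<tau>\<^sup>2)\<^sup>2" by simp
    also have "\<dots> = \<sigma> ^ 4 * (real p * v / (real n)\<^sup>2)"
      unfolding t2 using pv by (simp add: power_mult_distrib power_divide)
    finally show ?thesis .
  qed
  have v1s: "v1 \<le> sqrt (real p * v)"
  proof (rule real_le_rsqrt)
    show "v1\<^sup>2 \<le> real p * v" unfolding power2_eq_square using v p by (intro mult_mono) (auto simp: v1_def)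
  qed
  let ?x = "\<sigma> ^ 4 * (real p / (real n)\<^sup>2) + \<sigma>\<^sup>2 * (?h\<^sup>2 / real n)"
  have le: "c * v1 * ?x \<le> c * (\<tau> ^ 4 + \<tau>\<^sup>2 * ?h\<^sup>2)"
  proof -
    have "v1 * (\<sigma> ^ 4 * (real p / (real n)\<^sup>2)) \<le> v * (\<sigma> ^ 4 * (real p / (real n)\<^sup>2))"
      by (intro mult_right_mono) (auto simp: v1_def)
    moreover have "v1 * (\<sigma>\<^sup>2 * (?h\<^sup>2 / real n)) \<le> sqrt (real p * v) * (\<sigma>\<^sup>2 * (?h\<^sup>2 / real n))"
      by (intro mult_right_mono v1s) auto
    ultimately have "v1 * ?x \<le> \<tau> ^ 4 + \<tau>\<^sup>2 * ?h\<^sup>2"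
      unfolding t4 t2 by (simp add: distrib_left mult_ac)
    from mult_left_mono[OF this c] show ?thesis by (simp add: mult.assoc)
  qed
  interpret prob_space Q using Q by (simp add: design_noise_law_def)
  have sQ: "sets Q = sets (data_space {..<?N} p)" using Q by (simp add: design_noise_law_def)
  have meas [measurable]: "Q_hat I1 I2 p est \<in> borel_measurable (data_space {..<?N} p)"
    by (rule measurable_Q_hat[OF split est])
  have omeas: "observe ?N p \<theta> \<sigma> \<in> Q \<rightarrow>\<^sub>M data_space {..<?N} p"
    unfolding observe_def measurable_cong_sets[OF sQ refl] by (rule measurable_observation)
  have [measurable]: "(\<lambda>w. Q_hat I1 I2 p est (observe ?N p \<theta> \<sigma> w)) \<in> borel_measurable Q"
    by (rule measurable_compose[OF omeas meas])
  have "\<P>(d in obs_law ?N p Q \<theta> \<sigma>. C * \<sigma> * ((real p * v) powr (1 / 4) / sqrt (real n)) < \<bar>Lambda_hat I1 I2 p est d - ?h\<bar>)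
      = prob {w \<in> space Q. C * \<sigma> * ((real p * v) powr (1 / 4) / sqrt (real n)) < \<bar>Lambda_hat I1 I2 p est (observe ?N p \<theta> \<sigma> w) - ?h\<bar>}"
    unfolding Lambda_hat_def by (rule obs_law_prob[OF prob_space_axioms sQ]) measurable
  also have "\<dots> \<le> prob {w \<in> space Q. c * v1 * ?x < (Q_hat I1 I2 p est (observe ?N p \<theta> \<sigma> w) - ?h\<^sup>2)\<^sup>2}"
  proof (rule finite_measure_mono)
    show "{w \<in> space Q. C * \<sigma> * ((real p * v) powr (1 / 4) / sqrt (real n)) < \<bar>Lambda_hat I1 I2 p est (observe ?N p \<theta> \<sigma> w) - ?h\<bar>}
      \<subseteq> {w \<in> space Q. c * v1 * ?x < (Q_hat I1 I2 p est (observe ?N p \<theta> \<sigma> w) - ?h\<^sup>2)\<^sup>2}"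
    proof (intro Collect_mono impI, elim conjE, intro conjI, assumption, rule ccontr)
      fix w
      let ?q = "Q_hat I1 I2 p est (observe ?N p \<theta> \<sigma> w)"
      assume a: "C * \<sigma> * ((real p * v) powr (1 / 4) / sqrt (real n)) < \<bar>Lambda_hat I1 I2 p est (observe ?N p \<theta> \<sigma> w) - ?h\<bar>"
        and b: "\<not> c * v1 * ?x < (?q - ?h\<^sup>2)\<^sup>2"
      have "(?q - ?h\<^sup>2)\<^sup>2 \<le> c * (\<tau> ^ 4 + \<tau>\<^sup>2 * ?h\<^sup>2)" using b le by linarith
      then have "\<bar>sqrt \<bar>?q\<bar> - ?h\<bar> \<le> (2 + 2 * sqrt c) * \<tau>"
        by (intro sqrt_abs_deviation \<tau> c) (simp_all add: norm2_def sum_nonneg)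
      also have "\<dots> \<le> C * \<tau>" by (rule mult_right_mono[OF C \<tau>])
      finally show False using a by (simp add: Lambda_hat_def \<tau>_def mult.assoc)
    qed
  qed measurable
  also have "\<dots> = \<P>(d in obs_law ?N p Q \<theta> \<sigma>. c * v1 * ?x < (Q_hat I1 I2 p est d - ?h\<^sup>2)\<^sup>2)"
    by (rule obs_law_prob[OF prob_space_axioms sQ, symmetric]) measurable
  also have "\<dots> \<le> C' * (exp (- v1) + exp (- (m / C')))"
    unfolding m_def by (rule Q_hat_bound[OF v1 c_ge C'_ge])
  also have "\<dots> \<le> 2 * C' * (exp (- v) + exp (- (m / (2 * C'))))"
  proof -
    have m: "0 \<le> m" "m \<le> real p" using sparsity_rate_bounds by (auto simp: m_def)
    have e1: "exp (- (m / C')) \<le> exp (- (m / (2 * C')))"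
      using m C' by (simp add: field_simps)
    have "m / (2 * C') \<le> m / 1" using m C' by (intro divide_left_mono) auto
    then have "exp (- real p) \<le> exp (- (m / (2 * C')))" using m by simp
    then have "exp (- v1) \<le> exp (- v) + exp (- (m / (2 * C')))"
      unfolding v1_def min_def by (auto intro: add_increasing)
    from add_mono[OF this e1] have "exp (- v1) + exp (- (m / C')) \<le> exp (- v) + 2 * exp (- (m / (2 * C')))"
      by simp
    also have "\<dots> \<le> 2 * (exp (- v) + exp (- (m / (2 * C'))))" by simp
    finally have "exp (- v1) + exp (- (m / C')) \<le> 2 * (exp (- v) + exp (- (m / (2 * C'))))" .
    from mult_left_mono[OF this, of C'] C' show ?thesis by simp
  qed
  finally show ?thesis unfolding m_def .
qed

end

section \<open>Choice of the constants\<close>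

theorem theorem4:
  fixes L M :: real
  assumes "L > 0" and "M > 0"
  shows "\<exists>\<kappa>bar>0. \<forall>\<kappa>0. 0 < \<kappa>0 \<and> \<kappa>0 \<le> \<kappa>bar \<longrightarrow>
    (\<exists>c>0. \<exists>C>0. \<exists>C'>0.
      \<forall>(n::nat) (p::nat) (s::nat) Q I1 I2 est (v::real).
        n \<ge> 2 \<and> p \<ge> 2 \<and> 1 \<le> s \<and> s \<le> p \<and>
        design_noise_law (2 * n) p Q \<and>
        (\<forall>i<2 * n. subgaussian Q L (noise i)) \<and>
        (\<forall>i<2 * n. \<forall>j<p. subgaussian Q M (entry i j)) \<and>
        sparsity_rate p s / real (2 * n) \<le> \<kappa>0 \<and>
        sample_split n I1 I2 \<and> srs_estimator c I1 p est \<and>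
        0 < v \<and> v \<le> real n powr (1 / 3)
        \<longrightarrow>
        (SUP \<theta>\<in>B0 p s. SUP \<sigma>\<in>{0<..}.
           \<P>(d in obs_law (2 * n) p Q \<theta> \<sigma>.
              (Q_hat I1 I2 p est d - (norm2 {..<p} \<theta>)\<^sup>2)\<^sup>2
              > C * v * (\<sigma> ^ 4 * (real p / (real n)\<^sup>2)
                         + \<sigma>\<^sup>2 * ((norm2 {..<p} \<theta>)\<^sup>2 / real n))))
          \<le> C' * (exp (- v) + exp (- (min (real n) (sparsity_rate p s) / C')))
        \<and>
        (SUP \<theta>\<in>B0 p s. SUP \<sigma>\<in>{0<..}.
           \<P>(d in obs_law (2 * n) p Q \<theta> \<sigma>.
              \<bar>Lambda_hat I1 I2 p est d - norm2 {..<p} \<theta>\<bar>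
              > C * \<sigma> * ((real p * v) powr (1 / 4) / sqrt (real n))))
          \<le> C' * (exp (- v) + exp (- (min (real n) (sparsity_rate p s) / C'))))"
proof -
  define K where "K = max L M"
  have K: "0 < K" using assms by (simp add: K_def)
  define b where "b = re_const K"
  have b: "0 < b" using re_const_pos[OF K] by (simp add: b_def)
  \<comment> \<open>The two entries of the minimum are the two bounds \<open>rate\<close> of
    \<open>split_experiment\<close>.\<close>
  define \<kappa>bar where "\<kappa>bar = min (re_kappa K / 2) (1 / (48 * b)\<^sup>2)"
  have kb: "0 < \<kappa>bar" using re_kappa_pos[OF K] b by (simp add: \<kappa>bar_def)
  define c where "c = 3 * tail_const K"
  have c: "0 < c" using tail_const_pos[of K] by (simp add: c_def)
  \<comment> \<open>One constant serves both claims: it exceeds \<open>c\<close> for the quadratic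
    functional and 2 + 2 sqrt c for the norm, where c enters through
    \<open>sqrt_abs_deviation\<close>.\<close>
  define C where "C = c + (2 + 2 * sqrt c)"
  have C: "0 < C" "c \<le> C" "2 + 2 * sqrt c \<le> C"
    unfolding C_def using c by (auto intro!: add_pos_nonneg add_nonneg_nonneg)
  define C1 where "C1 = 7 + 1536 * K ^ 4"
  have C1: "0 < C1" using K by (simp add: C1_def add_pos_pos)
  show ?thesis
  proof (rule exI[of _ \<kappa>bar], rule conjI[OF kb], rule allI, rule impI, rule exI[of _ b], rule conjI[OF b],
      rule exI[of _ C], rule conjI[OF C(1)], rule exI[of _ "2 * C1"], rule conjI, goal_cases)
    case 1
    show ?case using C1 by simp
  next
    case (2 \<kappa>0)
    show ?case
    proof (intro allI impI, goal_cases)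
      case (1 n p s Q I1 I2 est v)
      with 2 have h: "2 \<le> n" "2 \<le> p" "1 \<le> s" "s \<le> p" "design_noise_law (2 * n) p Q"
        "\<forall>i<2 * n. subgaussian Q L (noise i)" "\<forall>i<2 * n. \<forall>j<p. subgaussian Q M (entry i j)"
        "sparsity_rate p s / real (2 * n) \<le> re_kappa (max L M) / 2"
        "sparsity_rate p s / real (2 * n) \<le> 1 / (48 * re_const (max L M))\<^sup>2"
        "sample_split n I1 I2" "srs_estimator (re_const (max L M)) I1 p est" and v: "0 < v"
        by (auto simp: \<kappa>bar_def K_def b_def)
      \<comment> \<open>On the reals \<open>cSUP_least\<close> turns a pointwise bound into one for
        the supremum only over a nonempty index set; the extensional zero vector provides a
        member.\<close>
      have ne: "B0 p s \<noteq> {}"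
      proof -
        have "(\<lambda>j\<in>{..<p}. 0) \<in> B0 p s" by (simp add: B0_def vec_space_def space_PiM)
        then show ?thesis by blast
      qed
      have C1': "7 + 1536 * (max L M) ^ 4 \<le> 2 * C1" "7 + 1536 * (max L M) ^ 4 \<le> C1"
        using C1 by (auto simp: C1_def K_def)
      have c': "3 * tail_const (max L M) \<le> C" "3 * tail_const (max L M) \<le> c"
        using C(2) by (auto simp: c_def K_def)
      show ?case
      proof (intro conjI cSUP_least[OF ne] cSUP_least)
        fix \<theta> and \<sigma> :: real
        assume th: "\<theta> \<in> B0 p s" and "\<sigma> \<in> {0<..}"
        then have "split_experiment L M \<sigma> n p s Q I1 I2 est \<theta>"
          using assms h by unfold_locales auto
        then interpret split_experiment L M \<sigma> n p s Q I1 I2 est \<theta> .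
        show "\<P>(d in obs_law (2 * n) p Q \<theta> \<sigma>. (Q_hat I1 I2 p est d - (norm2 {..<p} \<theta>)\<^sup>2)\<^sup>2
            > C * v * (\<sigma> ^ 4 * (real p / (real n)\<^sup>2) + \<sigma>\<^sup>2 * ((norm2 {..<p} \<theta>)\<^sup>2 / real n)))
          \<le> 2 * C1 * (exp (- v) + exp (- (min (real n) (sparsity_rate p s) / (2 * C1))))"
          by (rule Q_hat_bound[OF v c'(1) C1'(1)])
        show "\<P>(d in obs_law (2 * n) p Q \<theta> \<sigma>. \<bar>Lambda_hat I1 I2 p est d - norm2 {..<p} \<theta>\<bar>
            > C * \<sigma> * ((real p * v) powr (1 / 4) / sqrt (real n)))
          \<le> 2 * C1 * (exp (- v) + exp (- (min (real n) (sparsity_rate p s) / (2 * C1))))"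
          by (rule Lambda_hat_bound[OF v c'(2) C(3) C1'(2)])
      qed auto
    qed
  qed
qed

end
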